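(* Let $n\ge 1$ be an integer and let $\mathcal{C}_n$ be the half-cylinder with $n$ marked points. The flip graph of $2$-triangulations on $\mathcal{C}_n$ is regular. Equivalently, the associated simplicial complex $\Delta_{\mathcal{C}_n,2}$ is pure and a weak pseudomanifold.
   Context: **Half-cylinder and universal cover.** $\mathcal{C}_n$ is the annulus with $n$ marked points on one of its boundary components (and none on the other). Its universal cover $\overline{\mathcal{C}}_n$ has vertices $\alpha_i$, $i\in\mathbb{Z}$ (the lifts of the marked points, in order along the boundary line); the covering map $\pi$ sends $\alpha_i$ to the marked point indexed by $i \bmod n$. Write $\alpha_i+j=\alpha_{i+j}$, $\alpha_j-\alpha_i=j-i$, and $\alpha_i<\alpha_j$ iff $i<j$. An edge of $\overline{\mathcal{C}}_n$ is an isotopy class of curves joining two distinct vertices $u,v$; it is determined by the unordered pair and denoted $[u,v]=[v,u]$. Its length is $|v-u|$. Put $[u,v]+j=[u+j,v+j]$; a translation of $e$ is an edge $e+\ell n$ with $\ell\in\mathbb{Z}$. An edge of $\mathcal{C}_n$ is a projection $\pi(e)$ of an edge $e$ of $\overline{\mathcal{C}}_n$, with $\pi(e)=\pi(f)$ iff $f$ is a translation of $e$; the length of $\pi(e)$ is the length of $e$. **Crossings.** Two edges of $\overline{\mathcal{C}}_n$ intersect iff they can be written $[a_1,b_1]$, $[a_2,b_2]$ with $a_1<a_2<b_1<b_2$. A $3$-crossing is a set of three pairwise intersecting edges. **$2$-triangulations.** A $2$-triangulation on $\mathcal{C}_n$ is an inclusion-maximal set $T$ of edges of $\mathcal{C}_n$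 such that $\pi^{-1}(T)$ contains no $3$-crossing. Convention: edges of length $<2$ (which never occur in a $3$-crossing) are disregarded, i.e. only edges of length $\ge 2$ are considered. An edge is $2$-relevant if its length $\ell$ satisfies $2<\ell\le 2n$. **Flip graph.** Its vertices are the $2$-triangulations on $\mathcal{C}_n$; two distinct ones $T,T'$ are adjacent iff they are related by a flip, i.e. $T'=(T\setminus\{e\})\cup\{f\}$ for some $2$-relevant edge $e\in T$ and some edge $f\notin T$. **Complex.** $\Delta_{\mathcal{C}_n,2}$ is the simplicial complex whose vertices are the $2$-relevant edges of $\mathcal{C}_n$ and whose facets are the sets of $2$-relevant edges of the $2$-triangulations on $\mathcal{C}_n$. A weak pseudomanifold (without boundary) is a pure simplicial complex in which every codimension-$1$ face lies in exactly two facets. *)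

theory Defs
  imports Main
begin

section \<open>Edges of the half-cylinder and of its universal cover\<close>

text \<open>The vertex \<open>\<alpha>\<^sub>i\<close> of the universal cover is the integer \<open>i\<close>. An isotopy class of curves joining two
  distinct vertices is determined by the unordered pair of its endpoints, so it is encoded as the
  two-element set of these endpoints.\<close>

definition cover_edges :: "int set set" where
  "cover_edges = {{u, v} | u v. u \<noteq> v}"

definition cover_length :: "int set \<Rightarrow> int" where
  "cover_length e = Max e - Min e"

lemma cover_length_doubleton: "cover_length {u, v} = \<bar>v - u\<bar>"
  by (auto simp: cover_length_def max_def min_def)

definition translate :: "int set \<Rightarrow> int \<Rightarrow> int set" where
  "translate e j = (\<lambda>x. x + j) ` e"

definition proj :: "nat \<Rightarrow> int set \<Rightarrow> int set set" where
  "proj n e = {translate e (l * int n) | l. True}"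

lemma translate_translate: "translate (translate e i) j = translate e (i + j)"
  by (auto simp: translate_def image_image add.assoc)

lemma translate_0: "translate e 0 = e"
  by (simp add: translate_def)

lemma proj_self: "e \<in> proj n e"
  unfolding proj_def using translate_0[of e] by (force intro: exI[of _ 0])

lemma proj_eq_iff: "proj n e = proj n f \<longleftrightarrow> (\<exists>l. f = translate e (l * int n))"
proof
  assume "proj n e = proj n f"
  then show "\<exists>l. f = translate e (l * int n)"
    using proj_self[of f n] by (auto simp: proj_def)
next
  assume "\<exists>l. f = translate e (l * int n)"
  then obtain l where f: "f = translate e (l * int n)" by blast
  have 1: "translate f (m * int n) = translate e ((l + m) * int n)" for m
    by (simp add: f translate_translate algebra_simps)
  have 2: "translate e (m * int n) = translate f ((m - l) * int n)" for m
    by (simp add: 1)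
  show "proj n e = proj n f"
    unfolding proj_def using 1 2 by blast
qed

lemma cover_length_translate:
  assumes "e \<in> cover_edges"
  shows "cover_length (translate e j) = cover_length e"
  using assms by (auto simp: cover_edges_def translate_def cover_length_doubleton)

text \<open>The length of an edge of the half-cylinder is the common length of its lifts
  (see \<open>cover_length_translate\<close>); edges of length less than \<open>2\<close> are disregarded.\<close>

definition cyl_edges :: "nat \<Rightarrow> int set set set" where
  "cyl_edges n = {proj n e | e. e \<in> cover_edges \<and> 2 \<le> cover_length e}"

definition relevant_edges :: "nat \<Rightarrow> int set set set" where
  "relevant_edges n =
    {proj n e | e. e \<in> cover_edges \<and> 2 < cover_length e \<and> cover_length e \<le> 2 * int n}"

definition lift :: "nat \<Rightarrow> int set set set \<Rightarrow> int set set" where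
  "lift n T = {e \<in> cover_edges. proj n e \<in> T}"


section \<open>Crossings, 2-triangulations and flips\<close>

definition edges_cross :: "int set \<Rightarrow> int set \<Rightarrow> bool" where
  "edges_cross e f \<longleftrightarrow> (\<exists>a1 b1 a2 b2. a1 < a2 \<and> a2 < b1 \<and> b1 < b2 \<and> {e, f} = {{a1, b1}, {a2, b2}})"

definition three_crossing :: "int set set \<Rightarrow> bool" where
  "three_crossing X \<longleftrightarrow> X \<subseteq> cover_edges \<and> card X = 3 \<and> pairwise edges_cross X"

definition three_crossing_free :: "nat \<Rightarrow> int set set set \<Rightarrow> bool" where
  "three_crossing_free n T \<longleftrightarrow> \<not> (\<exists>X. X \<subseteq> lift n T \<and> three_crossing X)"

definition two_triangulations :: "nat \<Rightarrow> int set set set set" where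
  "two_triangulations n =
    {T. T \<subseteq> cyl_edges n \<and> three_crossing_free n T \<and>
        (\<forall>T'. T' \<subseteq> cyl_edges n \<and> three_crossing_free n T' \<and> T \<subseteq> T' \<longrightarrow> T' = T)}"

definition flip_adjacent :: "nat \<Rightarrow> int set set set \<Rightarrow> int set set set \<Rightarrow> bool" where
  "flip_adjacent n T T' \<longleftrightarrow>
    T \<in> two_triangulations n \<and> T' \<in> two_triangulations n \<and> T \<noteq> T' \<and>
    (\<exists>e f. e \<in> T \<and> e \<in> relevant_edges n \<and> f \<in> cyl_edges n \<and> f \<notin> T \<and> T' = insert f (T - {e}))"

definition regular_graph :: "'a set \<Rightarrow> ('a \<Rightarrow> 'a \<Rightarrow> bool) \<Rightarrow> bool" where
  "regular_graph V adj \<longleftrightarrow>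
    (\<exists>d. \<forall>v\<in>V. finite {w \<in> V. adj v w} \<and> card {w \<in> V. adj v w} = d)"


section \<open>Simplicial complexes\<close>

text \<open>A complex is given by its set \<open>V\<close> of vertices and its set \<open>K\<close> of faces, the empty face included.\<close>

definition simplicial_complex :: "'a set \<Rightarrow> 'a set set \<Rightarrow> bool" where
  "simplicial_complex V K \<longleftrightarrow>
    {} \<in> K \<and> (\<forall>F\<in>K. finite F \<and> F \<subseteq> V) \<and> (\<forall>F\<in>K. \<forall>G. G \<subseteq> F \<longrightarrow> G \<in> K) \<and> (\<forall>v\<in>V. {v} \<in> K)"

definition facets :: "'a set set \<Rightarrow> 'a set set" where
  "facets K = {F \<in> K. \<forall>G\<in>K. F \<subseteq> G \<longrightarrow> G = F}"

definition pure_complex :: "'a set \<Rightarrow> 'a set set \<Rightarrow> bool" where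
  "pure_complex V K \<longleftrightarrow> simplicial_complex V K \<and> (\<exists>d. \<forall>F\<in>facets K. card F = d)"

definition weak_pseudomanifold :: "'a set \<Rightarrow> 'a set set \<Rightarrow> bool" where
  "weak_pseudomanifold V K \<longleftrightarrow> pure_complex V K \<and>
    (\<forall>F\<in>K. (\<exists>G\<in>facets K. F \<subseteq> G \<and> card G = card F + 1) \<longrightarrow> card {G \<in> facets K. F \<subseteq> G} = 2)"

text \<open>The faces of \<open>\<Delta>\<close> are the subsets of the sets of 2-relevant edges of 2-triangulations; that
  these sets are exactly its facets is \<open>facets_Delta\<close> below.\<close>

definition Delta :: "nat \<Rightarrow> int set set set set" where
  "Delta n = {F. \<exists>T\<in>two_triangulations n. F \<subseteq> T \<inter> relevant_edges n}"

lemma edges_crossI: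
  "a1 < a2 \<Longrightarrow> a2 < b1 \<Longrightarrow> b1 < b2 \<Longrightarrow> edges_cross {a1, b1} {a2, b2}"
  "a1 < a2 \<Longrightarrow> a2 < b1 \<Longrightarrow> b1 < b2 \<Longrightarrow> edges_cross {a2, b2} {a1, b1}"
  unfolding edges_cross_def by blast+

lemma cover_edgesE:
  assumes "e \<in> cover_edges"
  obtains a b where "e = {a, b}" "a < b" "cover_length e = b - a"
proof -
  obtain u v where uv: "e = {u, v}" "u \<noteq> v"
    using assms by (auto simp: cover_edges_def)
  show ?thesis
  proof (cases "u < v")
    case True
    then show ?thesis using uv that[of u v] by (simp add: cover_length_doubleton)
  next
    case False
    then show ?thesis using uv that[of v u]
      by (simp add: cover_length_doubleton insert_commute)
  qed
qed

lemma edges_crossD: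
  assumes "edges_cross {a, b} {c, d}" "a < b" "c < d"
  shows "a < c \<and> c < b \<and> b < d \<or> c < a \<and> a < d \<and> d < b"
  using assms unfolding edges_cross_def by (auto simp: doubleton_eq_iff)

lemma three_crossing_length:
  assumes X: "three_crossing X" and e: "e \<in> X"
  shows "2 < cover_length e"
proof -
  have fin: "finite X" and c: "card (X - {e}) = 2"
    using X e by (auto simp: three_crossing_def intro: card_ge_0_finite)
  then obtain f g where fg: "X - {e} = {f, g}" "f \<noteq> g"
    by (meson card_2_iff)
  then have mem: "f \<in> X" "g \<in> X" "f \<noteq> e" "g \<noteq> e" by auto
  have cr: "edges_cross e f" "edges_cross e g" "edges_cross f g"
    using X e mem fg(2) by (auto simp: three_crossing_def pairwise_def)
  have ce: "e \<in> cover_edges" "f \<in> cover_edges" "g \<in> cover_edges"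
    using X e mem by (auto simp: three_crossing_def)
  obtain a b where e': "e = {a, b}" "a < b" "cover_length e = b - a" using ce(1) by (rule cover_edgesE)
  obtain c d where f': "f = {c, d}" "c < d" using ce(2) by (rule cover_edgesE)
  obtain p q where g': "g = {p, q}" "p < q" using ce(3) by (rule cover_edgesE)
  show ?thesis
    using edges_crossD[OF cr(1)[unfolded e'(1) f'(1)] e'(2) f'(2)]
      edges_crossD[OF cr(2)[unfolded e'(1) g'(1)] e'(2) g'(2)]
      edges_crossD[OF cr(3)[unfolded f'(1) g'(1)] f'(2) g'(2)] e'(3)
    by linarith
qed

lemma long_edge_three_crossing:
  assumes "n \<ge> 1" "e \<in> cover_edges" "2 * int n < cover_length e" "proj n e \<in> T"
  shows "\<not> three_crossing_free n T"
proof -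
  obtain a b where e: "e = {a, b}" "a < b" "cover_length e = b - a"
    using assms(2) by (rule cover_edgesE)
  define f where "f l = translate e (l * int n)" for l
  have f: "f l = {a + l * int n, b + l * int n}" for l
    by (auto simp: f_def translate_def e)
  let ?X = "{f 0, f 1, f 2}"
  have "f l \<in> cover_edges" for l
    unfolding f cover_edges_def using e(2) by force
  moreover have "proj n (f l) = proj n e" for l
    unfolding f_def by (metis proj_eq_iff)
  ultimately have lift: "?X \<subseteq> lift n T" "?X \<subseteq> cover_edges"
    using assms(4) by (auto simp: lift_def)
  have cr: "edges_cross (f 0) (f 1)" "edges_cross (f 1) (f 0)" "edges_cross (f 0) (f 2)"
    "edges_cross (f 2) (f 0)" "edges_cross (f 1) (f 2)" "edges_cross (f 2) (f 1)"
    unfolding f using assms(1,3) e(2,3)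
    by (simp_all add: edges_crossI(1), simp_all add: edges_crossI(2))
  have "f 0 \<noteq> f 1" "f 0 \<noteq> f 2" "f 1 \<noteq> f 2"
    unfolding f using assms(1) e(2) by (auto simp: doubleton_eq_iff)
  then have "card ?X = 3" by simp
  moreover have "pairwise edges_cross ?X"
    using cr by (auto simp: pairwise_def)
  ultimately show ?thesis
    using lift unfolding three_crossing_free_def three_crossing_def by blast
qed

lemma two_triangulation_eqI:
  assumes n: "n \<ge> 1" and T: "T \<in> two_triangulations n" and T': "T' \<in> two_triangulations n"
    and sub: "T \<inter> relevant_edges n \<subseteq> T'"
  shows "T = T'"
proof -
  have "T \<subseteq> T'"
  proof
    fix E assume E: "E \<in> T"
    then have "E \<in> cyl_edges n" using T by (auto simp: two_triangulations_def)
    then obtain e where e: "E = proj n e" "e \<in> cover_edges" "2 \<le> cover_length e"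
      by (auto simp: cyl_edges_def)
    have le: "cover_length e \<le> 2 * int n"
      using long_edge_three_crossing[OF n e(2), of T] E e(1) T
      by (force simp: two_triangulations_def)
    show "E \<in> T'"
    proof (cases "E \<in> relevant_edges n")
      case True
      then show ?thesis using E sub by blast
    next
      case False
      then have l2: "cover_length e = 2"
        using e le by (force simp: relevant_edges_def)
      have "three_crossing_free n (insert E T')"
        unfolding three_crossing_free_def
      proof
        assume "\<exists>X. X \<subseteq> lift n (insert E T') \<and> three_crossing X"
        then obtain X where X: "X \<subseteq> lift n (insert E T')" "three_crossing X" by blast
        have "x \<in> lift n T'" if x: "x \<in> X" for x
        proof -
          have "proj n x \<noteq> E"
          proof
            assume "proj n x = E"
            then obtain l where "x = translate e (l * int n)"
              using e(1) proj_eq_iff by metis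
            then show False
              using cover_length_translate[OF e(2)] l2 three_crossing_length[OF X(2) x] by simp
          qed
          then show ?thesis using X(1) x by (auto simp: lift_def)
        qed
        then have "X \<subseteq> lift n T'" by blast
        then show False
          using X(2) T' by (auto simp: two_triangulations_def three_crossing_free_def)
      qed
      then have "insert E T' = T'"
        using T' \<open>E \<in> cyl_edges n\<close> unfolding two_triangulations_def by blast
      then show ?thesis by blast
    qed
  qed
  then show ?thesis
    using T T' unfolding two_triangulations_def by blast
qed

lemma facets_Delta:
  assumes "n \<ge> 1"
  shows "facets (Delta n) = {T \<inter> relevant_edges n | T. T \<in> two_triangulations n}"
proof
  show "facets (Delta n) \<subseteq> {T \<inter> relevant_edges n | T. T \<in> two_triangulations n}"
    unfolding facets_def Delta_def by blast
next
  show "{T \<inter> relevant_edges n | T. T \<in> two_triangulations n} \<subseteq> facets (Delta n)"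
  proof
    fix F assume "F \<in> {T \<inter> relevant_edges n | T. T \<in> two_triangulations n}"
    then obtain T where T: "F = T \<inter> relevant_edges n" "T \<in> two_triangulations n" by blast
    have "G = F" if G: "G \<in> Delta n" "F \<subseteq> G" for G
    proof -
      obtain T' where T': "T' \<in> two_triangulations n" "G \<subseteq> T' \<inter> relevant_edges n"
        using G(1) by (auto simp: Delta_def)
      have "T = T'"
        using two_triangulation_eqI[OF assms T(2) T'(1)] T(1) G(2) T'(2) by blast
      then show ?thesis using T(1) T'(2) G(2) by blast
    qed
    then show "F \<in> facets (Delta n)"
      using T by (auto simp: facets_def Delta_def)
  qed
qed

end

(*
Let A be the preimage in the universal cover of a 2-triangulation: a periodic set of chords of the
line of integers.  As for 2-triangulations of a polygon, A decomposes into 2-stars (pentagrams):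
  - every relevant chord is the lower "ceiling" of a star lying below it, found by choosing extremal
    chords and using maximality: a missing chord is blocked either by two crossing chords of A, or by
    one chord of A together with two translates of the missing chord;
  - call a vertex m crossed if two crossing chords of A pass over it; then a shortest such pair
    consists of the two ceilings of a star with middle vertex m.  If m is not crossed then [m, m+2n]
    lies in A.  Considering a longest chord shows that uncrossed vertices exist, hence they form
    exactly one class modulo n.
Sending a relevant chord to the star below it is therefore a bijection onto pairs (crossed vertex
class, one of two ceilings), so there are 2(n-1) relevant chords, which is purity.

For the flips, a relevant chord e of length < 2n is shared by the star L below it and a star U above
it, and it can only be replaced by the common bisector of L and U: a missing chord lies in the cone of
a star at each of its ends, which provides two crossing chords blocking it, and e must be one of these.
Two cases are degenerate: U may be a translate of L, and U is missing if e has length 2n.  In the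
latter case e is replaced by [m, m+2n], m being the middle vertex of L.
*)
theory Submission
  imports Defs
begin

section \<open>Crossing-free chord sets and stars\<close>

text \<open>The layers of assumptions follow what survives each operation. Cutting the circle at
  another point, or exchanging a single edge while keeping its translates, destroys periodicity but
  not crossing-freeness, so the local analysis of two adjacent stars uses
  \<open>crossing_free\<close> alone. The main obstacle is that a flip on the half-cylinder
  exchanges infinitely many edges of the cover at once, and a 3-crossing after the exchange may
  contain several translates of the new edge. In the generic case the translates do not interfere.
  In the degenerate cases the bound \<open>2 * n\<close> on lengths leaves at most two new
  translates in a 3-crossing, and these are examined directly. An exchanged set is only shown to be
  crossing-free; its maximality comes from the count of relevant edges, since an extension to a
  2-triangulation has no room for another one. Cyclic order is used for stars because infinity may
  lie in any of their five gaps; the line returns only to make the case analysis linear.\<close>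

locale crossing_free =
  fixes A :: "int \<Rightarrow> int \<Rightarrow> bool"
  assumes sym: "A x y \<Longrightarrow> A y x"
    and no_crossing: "A a b \<Longrightarrow> A c d \<Longrightarrow> A e f \<Longrightarrow>
          a < c \<Longrightarrow> c < e \<Longrightarrow> e < b \<Longrightarrow> b < d \<Longrightarrow> d < f \<Longrightarrow> False"
begin

lemma no_crossing':
  assumes "A a b" "A c d" "A e f"
    and "a < c \<and> c < b \<and> b < d \<or> c < a \<and> a < d \<and> d < b"
    and "a < e \<and> e < b \<and> b < f \<or> e < a \<and> a < f \<and> f < b"
    and "c < e \<and> e < d \<and> d < f \<or> e < c \<and> c < f \<and> f < d"
  shows False
proof -
  note * = assms(1-3)
  have "a < c \<or> c < a" "c < e \<or> e < c" "a < e \<or> e < a"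
    using assms by auto
  then consider "a < c" "c < e" | "a < e" "e < c" | "c < a" "a < e" | "c < e" "e < a" | "e < a" "a < c" | "e < c" "c < a"
    by linarith
  then show False
  proof cases
    case 1 then show False using assms by (intro no_crossing[OF *(1,2,3)]) auto
  next
    case 2 then show False using assms by (intro no_crossing[OF *(1,3,2)]) auto
  next
    case 3 then show False using assms by (intro no_crossing[OF *(2,1,3)]) auto
  next
    case 4 then show False using assms by (intro no_crossing[OF *(2,3,1)]) auto
  next
    case 5 then show False using assms by (intro no_crossing[OF *(3,1,2)]) auto
  next
    case 6 then show False using assms by (intro no_crossing[OF *(3,2,1)]) auto
  qed
qed

end

locale cover_graph = crossing_free +
  fixes n :: int
  assumes n_pos: "1 \<le> n"
    and shift_up: "A x y \<Longrightarrow> A (x + n) (y + n)"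
    and shift_down: "A x y \<Longrightarrow> A (x - n) (y - n)"
    and length_ge: "A x y \<Longrightarrow> 2 \<le> \<bar>x - y\<bar>"
    and length_le: "A x y \<Longrightarrow> \<bar>x - y\<bar> \<le> 2 * n"

text \<open>\<open>blocked\<close> is maximality spelled out: adding [x, y] with all its translates
  creates a 3-crossing. As \<open>y - x \<le> 2 * n\<close>, this contains, up to translation,
  either [x, y] and two edges of \<open>A\<close>, or [x, y], [x + n, y + n] and one edge of
  \<open>A\<close>.\<close>

locale max_cover_graph = cover_graph +
  assumes short: "A x (x + 2)"
    and blocked: "\<not> A x y \<Longrightarrow> 2 \<le> y - x \<Longrightarrow> y - x \<le> 2 * n \<Longrightarrow>
      (\<exists>a b c d. A a b \<and> A c d \<and> a < c \<and> b < d \<and>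
        (x < a \<and> c < y \<and> y < b \<or> a < x \<and> x < c \<and> c < b \<and> b < y \<and> y < d \<or>
         c < x \<and> x < b \<and> d < y)) \<or>
      (\<exists>a b. A a b \<and> x + n < y \<and>
        (a < x \<and> x + n < b \<and> b < y \<or> x < a \<and> a < x + n \<and> y < b \<and> b < y + n \<or>
         x + n < a \<and> a < y \<and> y + n < b))"
begin

text \<open>In \<open>R\<close>, \<open>M\<close>, \<open>L\<close> the two edges of
  \<open>A\<close> are to the right of [x, y], on both sides of it, or to its left. A
  \<open>T\<close> marks the cases with two translates of [x, y]; the edge of \<open>A\<close> is
  then left of both, between them, or right of both.\<close>

lemma blocked_cases:
  assumes "\<not> A x y" "2 \<le> y - x" "y - x \<le> 2 * n"
  obtains (R) a b c d where "A a b" "A c d" "x < a" "a < c" "c < y" "y < b" "b < d"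
  | (M) a b c d where "A a b" "A c d" "a < x" "x < c" "c < b" "b < y" "y < d"
  | (L) a b c d where "A a b" "A c d" "a < c" "c < x" "x < b" "b < d" "d < y"
  | (TL) a b where "A a b" "a < x" "x + n < b" "b < y" "x + n < y"
  | (TM) a b where "A a b" "x < a" "a < x + n" "x + n < y" "y < b" "b < y + n"
  | (TR) a b where "A a b" "x + n < a" "a < y" "y + n < b" "x + n < y"
  using blocked[OF assms] by blast

section \<open>The edges of a star below a given edge, obtained from maximality\<close>

lemma lower_star_inner_edge:
  assumes pq: "A p q" "p + 3 \<le> q" and w: "p < w" "w < d" "d < q" "A w q"
    and wmin: "\<And>x. p < x \<Longrightarrow> x < w \<Longrightarrow> \<not> A x q"
    and dmin: "\<And>x c. w < x \<Longrightarrow> x < d \<Longrightarrow> A x c \<Longrightarrow> p \<le> c \<and> c \<le> q"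
    and c: "A d c" "c < p \<or> q < c"
  shows "A p d"
proof (rule ccontr)
  assume nA: "\<not> A p d"
  have len: "q - p \<le> 2 * n" using length_le[OF pq(1)] by linarith
  have e1: "A (p + n) (q + n)" using shift_up[OF pq(1)] .
  note cc = no_crossing'
  \<comment> \<open>Two crossing edges that pass over \<open>d\<close> inside the interval from
    \<open>p\<close> to \<open>q\<close> are both crossed by [d, c], since \<open>c\<close> is
    outside.\<close>
  have D: False if "A x y" "A u v" "x < y" "u < v" "p \<le> x" "p \<le> u" "x < d" "d < y" "u < d" "d < v"
    "y \<le> q" "v \<le> q" "x < u \<and> u < y \<and> y < v \<or> u < x \<and> x < v \<and> v < y" for x y u v
  proof (cases "c < p")
    case True
    then show False using cc[OF that(1,2) sym[OF c(1)]] that by (smt (verit))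
  next
    case False
    then show False using cc[OF that(1,2) c(1)] that c(2) by (smt (verit))
  qed
  from len w have "2 \<le> d - p" "d - p \<le> 2 * n" by auto
  with nA show False
  proof (cases rule: blocked_cases)
    case (L x y x' y')
    then show False using cc[OF L(1,2) pq(1)] w by (smt (verit))
  next
    case (M x y x' y')
    have "y' \<le> q" using cc[OF M(1,2) pq(1)] M w by (smt (verit))
    have "y \<le> w" using dmin[of y x, OF _ _ sym[OF M(1)]] M by (smt (verit))
    then have "y' \<noteq> q" using wmin[of x'] M by force
    then show False using D[OF M(2) w(4)] M w \<open>y' \<le> q\<close> \<open>y \<le> w\<close> by (smt (verit))
  next
    case (R x y x' y')
    have "y \<le> q" using cc[OF R(1,2) pq(1)] R w by (smt (verit))
    show False
    proof (cases "y' \<le> q")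
      case True
      then show False using D[OF R(1,2)] R w by (smt (verit))
    next
      case False
      then have "x' \<le> w" using dmin[of x' y', OF _ _ R(2)] R by (smt (verit))
      then have "y \<noteq> q" using wmin[of x] R by force
      then show False using D[OF R(1) w(4)] R w \<open>y \<le> q\<close> \<open>x' \<le> w\<close> by (smt (verit))
    qed
  next
    case (TL x y)
    then show False using cc[OF TL(1) pq(1) e1] w n_pos by (smt (verit))
  next
    case (TM x y)
    have yq: "y \<le> q" using cc[OF TM(1) pq(1) e1] TM w n_pos by (smt (verit))
    have pn: "p + n \<le> w" using dmin[of "p+n" "q+n", OF _ _ e1] TM n_pos by (smt (verit))
    then have "y \<noteq> q" using wmin[of x] TM by force
    then show False using D[OF TM(1) w(4)] TM w yq pn by (smt (verit))
  next
    case (TR x y)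
    have g: "A (x - n) (y - n)" using shift_down[OF TR(1)] .
    have yq: "y \<le> q + n" using cc[OF TR(1) pq(1) e1] TR w n_pos by (smt (verit))
    show False
    proof (cases "y \<le> q")
      case True
      then show False using D[OF TR(1) g] TR w n_pos by (smt (verit))
    next
      case False
      then have "x \<le> w" using dmin[of x y, OF _ _ TR(1)] TR by (smt (verit))
      moreover have "y - n \<noteq> q" using wmin[of "x - n"] \<open>x \<le> w\<close> TR g n_pos by force
      ultimately show False using D[OF g w(4)] TR w n_pos yq by (smt (verit))
    qed
  qed
qed


text \<open>The case of the star \<open>p w d q c\<close>. Its middle vertex \<open>d\<close> has no
  edge beyond its outer neighbours, as they bound the cone containing infinity; hence
  \<open>c\<close> has to be the farthest neighbour of \<open>d\<close>.\<close>

lemma lower_star_outer_edge_right: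
  assumes pq: "A p q" "p + 3 \<le> q" and w: "p < w" "w < d" "d < q" "A w q"
    and wmin: "\<And>x. p < x \<Longrightarrow> x < w \<Longrightarrow> \<not> A x q"
    and dmin: "\<And>x c. w < x \<Longrightarrow> x < d \<Longrightarrow> A x c \<Longrightarrow> p \<le> c \<and> c \<le> q"
    and c: "A d c" "q < c" and cmax: "\<And>x. A d x \<Longrightarrow> p \<le> x \<and> x \<le> c"
  shows "A w c"
proof (rule ccontr)
  assume nA: "\<not> A w c"
  have len: "q - p \<le> 2 * n" using length_le[OF pq(1)] by linarith
  have cand: "p \<le> y \<and> y \<le> c \<and> (x < d \<longrightarrow> y \<le> q)" if "A x y" "w < x" "x \<le> d" for x y
    using dmin[OF that(2) _ that(1)] cmax[of y] that c(2) by (cases "x = d") auto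
  have pq': "A (p + n) (q + n)" and wq': "A (w + n) (q + n)" and dc': "A (d + n) (c + n)"
    and cd': "A (c - n) (d - n)"
    using shift_up[OF pq(1)] shift_up[OF w(4)] shift_up[OF c(1)] shift_down[OF sym[OF c(1)]] by auto
  \<comment> \<open>Maximality speaks only of lengths up to \<open>2 * n\<close>. If [w, c] were
    longer, then \<open>w < c - 2 * n \<le> d\<close>, and this vertex would have the neighbour
    \<open>d - 2 * n\<close> below \<open>p\<close>, against the choice of \<open>d\<close> and
    \<open>c\<close>.\<close>
  have "A (c - n - n) (d - n - n)" using shift_down[OF cd'] .
  from cand[OF this] have len': "c - w \<le> 2 * n" using length_le[OF c(1)] len w by linarith
  note cc = no_crossing'
  have "2 \<le> c - w" using w c by linarith
  with nA show False using len'
  proof (cases rule: blocked_cases)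
    case (L x y x' y')
    then show False using cc[OF L(1,2) w(4)] cc[OF L(1,2) c(1)] cand[OF sym[OF L(1)]] wmin[of x']
        cc[OF L(2) pq(1) c(1)] w c(2) by (smt (verit))
  next
    case (M x y x' y')
    then show False using cc[OF M(1,2) c(1)] cand[OF M(2)] w c(2) by (smt (verit))
  next
    case (R x y x' y')
    then show False using cc[OF R(1,2) c(1)] cand[OF R(1)] w c(2) by (smt (verit))
  next
    case (TL x y)
    have g: "A (y - n) (x - n)" using shift_down[OF sym[OF TL(1)]] .
    have W: "q + n = c \<Longrightarrow> d - n \<le> p \<or> w \<le> d - n"
      using wmin[of "d - n"] shift_down[OF c(1)] by force
    show False using TL cc[OF TL(1) c(1) dc'] cc[OF TL(1) c(1) wq'] cand[OF pq'] cc[OF pq(1) pq' c(1)]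
        cand[OF g] W cc[OF TL(1) w(4) wq'] cc[OF pq(1) TL(1) c(1)] wmin[of x] length_le[OF TL(1)] 
        w c(2) n_pos by (smt (verit))
  next
    case (TM x y)
    have g: "A (x - n) (y - n)" using shift_down[OF TM(1)] .
    show False using TM cand[OF TM(1)] cc[OF TM(1) c(1) dc'] cc[OF TM(1) c(1) wq'] wmin[of "x - n"] g
        cc[OF pq(1) g c(1)] cc[OF TM(1) pq(1) c(1)] cand[OF cd'] cc[OF pq(1) pq' c(1)] cand[OF pq'] 
        w c(2) n_pos by (smt (verit))
  next
    case (TR x y)
    have g: "A (x - n) (y - n)" using shift_down[OF TR(1)] .
    show False using TR cc[OF TR(1) c(1) dc'] cand[OF g] w c(2) n_pos by (smt (verit))
  qed
qed

text \<open>The case of the star \<open>c p w d q\<close>. Here the cone at \<open>d\<close> is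
  bounded by \<open>c\<close> and \<open>p\<close>, so \<open>c\<close> has to be the nearest
  neighbour of \<open>d\<close> to the left of \<open>p\<close>.\<close>

lemma lower_star_outer_edge_left:
  assumes pq: "A p q" "p + 3 \<le> q" and w: "p < w" "w < d" "d < q" "A w q"
    and wmin: "\<And>x. p < x \<Longrightarrow> x < w \<Longrightarrow> \<not> A x q"
    and dmin: "\<And>x c. w < x \<Longrightarrow> x < d \<Longrightarrow> A x c \<Longrightarrow> p \<le> c \<and> c \<le> q"
    and c: "A c d" "c < p" and cmax: "\<And>x. A d x \<Longrightarrow> x < p \<Longrightarrow> x \<le> c"
  shows "A c w"
proof (rule ccontr)
  assume nA: "\<not> A c w"
  have cand: "x = d \<and> y \<le> c" if "A x y" "w < x" "x \<le> d" "y < p" for x y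
    using dmin[OF that(2) _ that(1)] cmax[of y] that c(2) by (cases "x = d") auto
  have cd': "A (c + n) (d + n)" using shift_up[OF c(1)] .
  have W: "d + n = q \<Longrightarrow> c + n \<le> p \<or> w \<le> c + n"
    using wmin[of "c + n"] cd' by force
  note cc = no_crossing'
  have "2 \<le> w - c" "w - c \<le> 2 * n" using w c length_le[OF c(1)] by linarith+
  with nA show False
  proof (cases rule: blocked_cases)
    case (L x y x' y')
    then show False using cc[OF L(1,2) c(1)] w by (smt (verit))
  next
    case (M x y x' y')
    then show False using cc[OF M(1,2) c(1)] cand[OF sym[OF M(2)]] cc[OF M(1) pq(1) c(1)] w c(2)
      by (smt (verit))
  next
    case (R x y x' y')
    then show False using cc[OF R(1,2) c(1)] cand[OF sym[OF R(1)]] wmin[of x'] cc[OF R(1,2) w(4)]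
        cc[OF R(2) pq(1) c(1)] w c(2) by (smt (verit))
  next
    case (TL x y)
    then show False using cc[OF TL(1) c(1) cd'] w n_pos by (smt (verit))
  next
    case (TM x y)
    show False using TM cc[OF TM(1) c(1) cd'] cand[OF sym[OF TM(1)]] cc[OF pq(1) c(1) cd'] W
        cc[OF cd' w(4) c(1)] w c(2) n_pos by (smt (verit))
  next
    case (TR x y)
    have g: "A (y - n) (x - n)" using shift_down[OF sym[OF TR(1)]] .
    show False using TR cc[OF TR(1) c(1) cd'] cand[OF g] cc[OF pq(1) c(1) cd'] W
        cc[OF cd' w(4) c(1)] length_le[OF c(1)] w c(2) n_pos by (smt (verit))
  qed
qed

text \<open>If one of the three edges that complete the pentagram were missing, each way of blocking
  it would give a 3-crossing, or a crossing pair over \<open>m\<close> of smaller total length, made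
  of the given and the blocking edges and their translates.\<close>

lemma shortest_pair_star:
  assumes e1: "A c1 d1" and e2: "A c2 d2" and o: "c1 < c2" "c2 < m" "m < d1" "d1 < d2"
    and mn: "\<And>a b c d. A a b \<Longrightarrow> A c d \<Longrightarrow> a < c \<Longrightarrow> c < m \<Longrightarrow> m < b \<Longrightarrow> b < d \<Longrightarrow>
      (d1 - c1) + (d2 - c2) \<le> (b - a) + (d - c)"
  shows "A c1 m" "A c2 d1" "A m d2"
proof -
  note cc = no_crossing'
  have e1': "A (c1 + n) (d1 + n)" and e2': "A (c2 + n) (d2 + n)" and e2'': "A (c2 - n) (d2 - n)"
    using shift_up[OF e1] shift_up[OF e2] shift_down[OF e2] .
  have len: "d1 - c1 \<le> 2 * n" "d2 - c2 \<le> 2 * n"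
    using length_le[OF e1] length_le[OF e2] by linarith+
  show "A c1 m"
  proof (rule ccontr)
    assume "\<not> A c1 m"
    moreover have "2 \<le> m - c1" "m - c1 \<le> 2 * n" using o len by linarith+
    ultimately show False
    proof (cases rule: blocked_cases)
      case (L x y x' y')
      then show False using cc[OF L(1,2) e1] o by (smt (verit))
    next
      case (M x y x' y')
      then show False using cc[OF M(1,2) e1] cc[OF M(1) e1 e2] mn[OF M(2) e2] o by (smt (verit))
    next
      case (R x y x' y')
      then show False using cc[OF e1 R(1,2)] mn[OF R(1) e2] mn[OF R(1,2)] cc[OF e1 e2 R(2)] o
        by (smt (verit))
    next
      case (TL x y)
      then show False using cc[OF TL(1) e1 e1'] o n_pos by (smt (verit))
    next
      case (TM x y)
      then show False using cc[OF TM(1) e1 e1'] mn[OF TM(1) e2] cc[OF e1 e2 e1'] mn[OF TM(1) e1'] o n_pos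
        by (smt (verit))
    next
      case (TR x y)
      have g: "A (x - n) (y - n)" using shift_down[OF TR(1)] .
      show False using TR cc[OF e1 e1' TR(1)] mn[OF e1 e1'] mn[OF TR(1) e2] mn[OF g TR(1)] mn[OF g e2]
          cc[OF e1 e2 TR(1)] mn[OF e1 TR(1)] o n_pos
        by (smt (verit))
    qed
  qed
  show "A c2 d1"
  proof (rule ccontr)
    assume "\<not> A c2 d1"
    moreover have "2 \<le> d1 - c2" "d1 - c2 \<le> 2 * n" using o len by linarith+
    ultimately show False
    proof (cases rule: blocked_cases)
      case (L x y x' y')
      then show False using cc[OF L(1,2) e2] o by (smt (verit))
    next
      case (M x y x' y')
      then show False using cc[OF M(1,2) e1] cc[OF M(1,2) e2] mn[OF M(1,2)] mn[OF e1 M(2)] mn[OF M(1) e2] o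
        by (smt (verit))
    next
      case (R x y x' y')
      then show False using cc[OF e1 R(1,2)] o by (smt (verit))
    next
      case (TL x y)
      then show False using cc[OF TL(1) e2 e2'] o n_pos by (smt (verit))
    next
      case (TM x y)
      then show False using cc[OF TM(1) e1 e2'] o n_pos by (smt (verit))
    next
      case (TR x y)
      then show False using cc[OF TR(1) e1 e1'] o n_pos by (smt (verit))
    qed
  qed
  show "A m d2"
  proof (rule ccontr)
    assume "\<not> A m d2"
    moreover have "2 \<le> d2 - m" "d2 - m \<le> 2 * n" using o len by linarith+
    ultimately show False
    proof (cases rule: blocked_cases)
      case (R x y x' y')
      then show False using cc[OF R(1,2) e2] o by (smt (verit))
    next
      case (M x y x' y')
      then show False using cc[OF M(1,2) e2] cc[OF M(2) e1 e2] mn[OF e1 M(1)] o by (smt (verit))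
    next
      case (L x y x' y')
      then show False using cc[OF e2 L(1,2)] mn[OF e1 L(2)] mn[OF L(1,2)] cc[OF e1 e2 L(1)] o
        by (smt (verit))
    next
      case (TR x y)
      then show False using cc[OF TR(1) e2 e2'] o n_pos by (smt (verit))
    next
      case (TM x y)
      have g: "A (x - n) (y - n)" using shift_down[OF TM(1)] .
      show False using TM cc[OF g e2 e2''] mn[OF e1 g] cc[OF e1 e2 e2''] mn[OF e2'' g] o n_pos
        by (smt (verit))
    next
      case (TL x y)
      have g: "A (x - n) (y - n)" using shift_down[OF TL(1)] .
      show False using TL cc[OF e2 e2'' g] mn[OF e2'' e2] mn[OF e1 g] mn[OF g TL(1)] mn[OF e1 TL(1)]
          cc[OF e1 e2 g] mn[OF g e2] o n_pos
        by (smt (verit))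
    qed
  qed
qed

end

section \<open>Stars on a circle: cyclic order, cones and common bisectors\<close>

definition cyc :: "int \<Rightarrow> int \<Rightarrow> int \<Rightarrow> bool" where
  "cyc a b c \<longleftrightarrow> a < b \<and> b < c \<or> b < c \<and> c < a \<or> c < a \<and> a < b"

definition chords_cross :: "int \<Rightarrow> int \<Rightarrow> int \<Rightarrow> int \<Rightarrow> bool" where
  "chords_cross a b c d \<longleftrightarrow> cyc a c b \<and> cyc b d a \<or> cyc a d b \<and> cyc b c a"

context crossing_free
begin

lemma no_crossing_chords:
  assumes "A a b" "A c d" "A e f"
    "chords_cross a b c d" "chords_cross a b e f" "chords_cross c d e f"
  shows False
proof -
  have *: "A (min x y) (max x y)" if "A x y" for x y
    using that sym[OF that] by (cases "x \<le> y") (auto simp: min_def max_def)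
  have **: "min a b < min c d \<and> min c d < max a b \<and> max a b < max c d \<or>
     min c d < min a b \<and> min a b < max c d \<and> max c d < max a b" if "chords_cross a b c d" for a b c d
    using that unfolding chords_cross_def cyc_def min_def max_def by auto
  show False
    by (rule no_crossing'[OF *[OF assms(1)] *[OF assms(2)] *[OF assms(3)] **[OF assms(4)]
          **[OF assms(5)] **[OF assms(6)]])
qed

text \<open>A star, whose vertices are in cyclic order starting anywhere, so that the point at infinity may lie
  between any two of them. Its cone at \<open>p\<close> is the cyclic interval from \<open>j\<close> to \<open>q\<close>.\<close>

definition cstar :: "int \<Rightarrow> int \<Rightarrow> int \<Rightarrow> int \<Rightarrow> int \<Rightarrow> bool" where
  "cstar p i j q z \<longleftrightarrow> cyc p i j \<and> cyc p j q \<and> cyc p q z \<and>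
     A p j \<and> A p q \<and> A i q \<and> A i z \<and> A j z"

lemma cstar_rotate: "cstar p i j q z \<Longrightarrow> cstar i j q z p"
  unfolding cstar_def cyc_def using sym by auto

text \<open>The edges [i, q] and [j, z] cross each other, and both separate \<open>p\<close> from
  every point between \<open>j\<close> and \<open>q\<close>.\<close>

lemma cstar_cone:
  assumes "cstar p i j q z" "A p x" "cyc j x q"
  shows False
  using assms no_crossing_chords[of p x i q j z]
  unfolding cstar_def chords_cross_def cyc_def by smt


text \<open>Here \<open>p i1 i2 q z\<close> and \<open>p y q o1 o2\<close> are two stars on different sides of their common edge \<open>[p, q]\<close>.
  Of the candidates for a common bisector only \<open>[i2, o2]\<close> and \<open>[i1, o1]\<close> are compatible with
  crossing-freeness.\<close>

lemma flip_cases_linear: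
  assumes o: "p < i1" "i1 < i2" "i2 < q" "q < z" "p < y" "y < q" "q < o1" "o1 < o2"
    and L: "A p q" "A p i2" "A i1 q" "A i1 z" "A i2 z"
    and U: "A p o1" "A y o1" "A y o2" "A q o2"
  shows "y < i2 \<and> z < o2 \<or> i1 < y \<and> o1 < z"
proof -
  have 1: "z = o1 \<Longrightarrow> A i2 o1" "y = i2 \<Longrightarrow> A i2 o2" "y = i1 \<Longrightarrow> A i1 o1" "z = o2 \<Longrightarrow> A i1 o2"
    using L U by auto
  show ?thesis
    using o 1 no_crossing'[OF L(3) U(3) L(5)] no_crossing'[OF _ L(1) L(4), of i2 o2]
      no_crossing'[OF _ U(3) L(1), of i2 o1] no_crossing'[OF L(2) U(2) L(4)]
      no_crossing'[OF _ L(5) L(1), of i1 o1] no_crossing'[OF _ L(1) U(2), of i1 o2]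
    by (smt (verit))
qed

text \<open>Crossing-freeness against pairs of edges of the two stars confines an edge that crosses
  [i2, o2] to four ranges (\<open>S\<close>). Two crossing edges in these ranges form a 3-crossing
  with [p, i2], [p, q] or [y, o2].\<close>

lemma flip_alpha_linear:
  assumes o: "p < i1" "i1 < i2" "i2 < q" "q < z" "p < y" "y < q" "q < o1" "o1 < o2"
    and L: "A p q" "A p i2" "A i1 q" "A i1 z" "A i2 z"
    and U: "A p o1" "A y o1" "A y o2" "A q o2"
    and c: "y < i2" "z < o2"
    and g: "A u v" "p \<le> u" "u < v" "u \<noteq> p \<or> v \<noteq> q" "u < i2 \<and> i2 < v \<and> v < o2 \<or> i2 < u \<and> u < o2 \<and> o2 < v"
    and h: "A s t" "p \<le> s" "s < t" "s \<noteq> p \<or> t \<noteq> q" "s < i2 \<and> i2 < t \<and> t < o2 \<or> i2 < s \<and> s < o2 \<and> o2 < t"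
    and gh: "u < s \<and> s < v \<and> v < t \<or> s < u \<and> u < t \<and> t < v"
  shows False
proof -
  note cc = no_crossing'
  have S: "(u < i2 \<and> i1 \<le> u \<and> i2 < v \<and> v \<le> q) \<or> (y \<le> u \<and> u \<le> i1 \<and> z \<le> v \<and> v \<le> o1) \<or>
      (o1 \<le> u \<and> u < o2 \<and> o2 < v) \<or> (u = p \<and> o1 \<le> v \<and> v < o2)" 
    if g: "A u v" "p \<le> u" "u < v" "u \<noteq> p \<or> v \<noteq> q" "u < i2 \<and> i2 < v \<and> v < o2 \<or> i2 < u \<and> u < o2 \<and> o2 < v" for u v
    using g o c cc[OF g(1) L(2) L(3)] cc[OF g(1) L(2) L(4)] cc[OF g(1) L(1) L(4)] cc[OF g(1) L(1) L(5)]
      cc[OF g(1) L(3) L(5)] cc[OF g(1) L(1) U(2)] cc[OF g(1) L(1) U(3)] cc[OF g(1) U(1) U(3)]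
      cc[OF g(1) U(1) U(4)] cc[OF g(1) U(2) U(4)]
    by (smt (verit))
  show False
    using S[OF g] S[OF h] o c gh cc[OF g(1) h(1) L(2)] cc[OF g(1) h(1) L(1)] cc[OF g(1) h(1) U(3)]
    by (smt (verit))
qed

text \<open>The other outcome of \<open>flip_cases_linear\<close>, with [i1, o1] as the new edge.
  Three ranges remain, and the third edge of the 3-crossing is [i1, q], [p, q] or [y, o1].\<close>

lemma flip_beta_linear:
  assumes o: "p < i1" "i1 < i2" "i2 < q" "q < z" "p < y" "y < q" "q < o1" "o1 < o2"
    and L: "A p q" "A p i2" "A i1 q" "A i1 z" "A i2 z"
    and U: "A p o1" "A y o1" "A y o2" "A q o2"
    and c: "i1 < y" "o1 < z"
    and g: "A u v" "p \<le> u" "u < v" "u \<noteq> p \<or> v \<noteq> q" "u < i1 \<and> i1 < v \<and> v < o1 \<or> i1 < u \<and> u < o1 \<and> o1 < v"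
    and h: "A s t" "p \<le> s" "s < t" "s \<noteq> p \<or> t \<noteq> q" "s < i1 \<and> i1 < t \<and> t < o1 \<or> i1 < s \<and> s < o1 \<and> o1 < t"
    and gh: "u < s \<and> s < v \<and> v < t \<or> s < u \<and> u < t \<and> t < v"
  shows False
proof -
  note cc = no_crossing'
  have S: "(u < i1 \<and> p \<le> u \<and> i1 < v \<and> v \<le> i2) \<or> (i2 \<le> u \<and> u \<le> y \<and> o2 \<le> v \<and> v \<le> z) \<or>
      (q \<le> u \<and> u < o1 \<and> o1 < v \<and> v \<le> o2)" 
    if g: "A u v" "p \<le> u" "u < v" "u \<noteq> p \<or> v \<noteq> q" "u < i1 \<and> i1 < v \<and> v < o1 \<or> i1 < u \<and> u < o1 \<and> o1 < v" for u v
    using g o c cc[OF g(1) L(2) L(3)] cc[OF g(1) L(2) L(4)] cc[OF g(1) L(1) L(4)] cc[OF g(1) L(1) L(5)]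
      cc[OF g(1) L(3) L(5)] cc[OF g(1) L(1) U(2)] cc[OF g(1) L(1) U(3)] cc[OF g(1) U(1) U(3)]
      cc[OF g(1) U(1) U(4)] cc[OF g(1) U(2) U(4)]
    by (smt (verit))
  show False
    using S[OF g] S[OF h] o c gh cc[OF g(1) h(1) L(3)] cc[OF g(1) h(1) L(1)] cc[OF g(1) h(1) U(2)]
    by (smt (verit))
qed


text \<open>Cutting the circle just before \<open>p\<close>: the vertices below \<open>p\<close> are moved above all the others, which allows
  us to treat a cyclic configuration as a linear one. Only a finite window around \<open>p\<close> is kept.\<close>

lemma crossing_free_rotate:
  fixes p K :: int
  assumes "0 < K"
  defines "h \<equiv> \<lambda>u. if u < p + K then u else u - 2 * K"
  shows "crossing_free (\<lambda>u v. p \<le> u \<and> u < p + 2 * K \<and> p \<le> v \<and> v < p + 2 * K \<and> A (h u) (h v))"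
proof
  fix a b c d e f :: int
  assume H: "p \<le> a \<and> a < p + 2 * K \<and> p \<le> b \<and> b < p + 2 * K \<and> A (h a) (h b)"
    "p \<le> c \<and> c < p + 2 * K \<and> p \<le> d \<and> d < p + 2 * K \<and> A (h c) (h d)"
    "p \<le> e \<and> e < p + 2 * K \<and> p \<le> f \<and> f < p + 2 * K \<and> A (h e) (h f)"
    and o: "a < c" "c < e" "e < b" "b < d" "d < f"
  have cy: "cyc (h u) (h v) (h w)" if "p \<le> u" "u < v" "v < w" "w < p + 2 * K" for u v w
    using that unfolding h_def cyc_def by (smt (verit))
  have rot: "cyc x y z \<Longrightarrow> cyc y z x" for x y z
    unfolding cyc_def by (smt (verit))
  have b: "p \<le> a" "f < p + 2 * K" using H by auto
  have cr: "chords_cross (h x) (h y) (h x') (h y')"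
    if "p \<le> x" "x < x'" "x' < y" "y < y'" "y' < p + 2 * K" for x y x' y'
    using cy[of x x' y] rot[OF cy[of x y y']] that unfolding chords_cross_def by simp
  have "chords_cross (h a) (h b) (h c) (h d)" "chords_cross (h a) (h b) (h e) (h f)"
    "chords_cross (h c) (h d) (h e) (h f)"
    using b o by (auto intro!: cr)
  then show False
    using no_crossing_chords H by blast
qed (use sym in auto)


end

lemma finite_int_bound:
  fixes S :: "int set"
  assumes "finite S"
  shows "\<exists>K>0. \<forall>x\<in>S. \<bar>x - p\<bar> < K"
proof -
  have "\<bar>x - p\<bar> < 1 + Max (insert 0 ((\<lambda>x. \<bar>x - p\<bar>) ` S))" if "x \<in> S" for x
    using assms that by (intro zle_add1_eq_le[THEN iffD2, of _ "Max _", unfolded add.commute[of _ 1]] Max_ge) auto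
  moreover have "0 < 1 + Max (insert 0 ((\<lambda>x. \<bar>x - p\<bar>) ` S))"
    using assms by (simp add: add_pos_nonneg)
  ultimately show ?thesis by blast
qed

context crossing_free
begin

text \<open>Transfer of the linear statements to the circle. \<open>K\<close> exceeds the distance
  from \<open>p\<close> of all twelve vertices involved; \<open>g\<close> moves those below
  \<open>p\<close> above the others, and \<open>h\<close> undoes this, so that \<open>p\<close> is
  leftmost in the crossing-free set \<open>R\<close>.\<close>

lemma
  assumes L: "cstar p i1 i2 q z" and U: "cstar q o1 o2 p y"
  shows flip_cases: "cyc p y i2 \<and> cyc q z o2 \<or> cyc p i1 y \<and> cyc q o1 z" (is ?A)
    and flip_alpha: "cyc p y i2 \<Longrightarrow> cyc q z o2 \<Longrightarrow> A u v \<Longrightarrow> {u, v} \<noteq> {p, q} \<Longrightarrow> A s t \<Longrightarrow> {s, t} \<noteq> {p, q} \<Longrightarrow>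
      chords_cross i2 o2 u v \<Longrightarrow> chords_cross i2 o2 s t \<Longrightarrow> chords_cross u v s t \<Longrightarrow> False"
    and flip_beta: "cyc p i1 y \<Longrightarrow> cyc q o1 z \<Longrightarrow> A u v \<Longrightarrow> {u, v} \<noteq> {p, q} \<Longrightarrow> A s t \<Longrightarrow> {s, t} \<noteq> {p, q} \<Longrightarrow>
      chords_cross i1 o1 u v \<Longrightarrow> chords_cross i1 o1 s t \<Longrightarrow> chords_cross u v s t \<Longrightarrow> False"
proof -
  obtain K where K: "0 < K" and KN: "\<forall>x\<in>{p, i1, i2, q, z, o1, o2, y, u, v, s, t}. \<bar>x - p\<bar> < K"
    using finite_int_bound[of "{p, i1, i2, q, z, o1, o2, y, u, v, s, t}" p] by auto
  define h where "h x = (if x < p + K then x else x - 2 * K)" for x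
  define g where "g x = (if p \<le> x then x else x + 2 * K)" for x
  define N where "N x \<longleftrightarrow> \<bar>x - p\<bar> < K" for x
  have N: "N p" "N i1" "N i2" "N q" "N z" "N o1" "N o2" "N y" "N u" "N v" "N s" "N t"
    using KN unfolding N_def by simp_all
  define R where "R u v \<longleftrightarrow> p \<le> u \<and> u < p + 2 * K \<and> p \<le> v \<and> v < p + 2 * K \<and> A (h u) (h v)" for u v
  interpret R: crossing_free R
    using crossing_free_rotate[OF K, of p] unfolding R_def[abs_def] h_def .
  have gp: "g p = p" unfolding g_def by simp
  have gp2: "p \<le> g x" if "N x" for x
    using that unfolding g_def N_def by (smt (verit))
  have inj: "g x = g x' \<longleftrightarrow> x = x'" if "N x" "N x'" for x x'
    using that unfolding g_def N_def by (smt (verit))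
  have hg: "h (g x) = x" "p \<le> g x" "g x < p + 2 * K" if "N x" for x
    using that K unfolding g_def h_def N_def by (smt (verit))+
  have B: "R (g x) (g x')" if "A x x'" "N x" "N x'" for x x'
    using that(1) hg[OF that(2)] hg[OF that(3)] unfolding R_def by simp
  have lt: "g a < g b \<longleftrightarrow> (p \<le> a \<and> a < b \<or> a < b \<and> b < p \<or> b < p \<and> p \<le> a)" if "N a" "N b" for a b
    using that unfolding g_def N_def by (smt (verit))
  have cy: "cyc a b c \<longleftrightarrow> cyc (g a) (g b) (g c)" if "N a" "N b" "N c" for a b c
    unfolding cyc_def lt[OF that(1,2)] lt[OF that(2,3)] lt[OF that(3,1)] by (smt (verit))
  have cp: "cyc p a b \<longleftrightarrow> p < g a \<and> g a < g b" if "N a" "N b" for a b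
    using cy[OF N(1) that] gp2[OF that(1)] gp2[OF that(2)] gp unfolding cyc_def by (smt (verit))
  have o: "p < g i1" "g i1 < g i2" "g i2 < g q" "g q < g z" "p < g y" "g y < g q" "g q < g o1" "g o1 < g o2"
  proof -
    have "cyc p i1 i2" "cyc p i2 q" "cyc p q z" using L unfolding cstar_def by auto
    then show "p < g i1" "g i1 < g i2" "g i2 < g q" "g q < g z" using cp N by auto
    have "cyc p q o1" "cyc p o1 o2" "cyc p y q" using U unfolding cstar_def cyc_def by (smt (verit))+
    then show "p < g y" "g y < g q" "g q < g o1" "g o1 < g o2" using cp N by auto
  qed
  note E = B[OF _ N(1) N(4)] B[OF _ N(1) N(3)] B[OF _ N(2) N(4)] B[OF _ N(2) N(5)] B[OF _ N(3) N(5)]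
    B[OF _ N(1) N(6)] B[OF _ N(8) N(6)] B[OF _ N(8) N(7)] B[OF _ N(4) N(7)]
  have LE: "R p (g q)" "R p (g i2)" "R (g i1) (g q)" "R (g i1) (g z)" "R (g i2) (g z)"
    using L E(1-5) unfolding cstar_def gp by blast+
  have UE: "R p (g o1)" "R (g y) (g o1)" "R (g y) (g o2)" "R (g q) (g o2)"
    using U sym E(6-9) unfolding cstar_def gp by blast+
  have cqo: "cyc q z o2 \<longleftrightarrow> g z < g o2" "cyc q o1 z \<longleftrightarrow> g o1 < g z"
    using cy[OF N(4) N(5) N(7)] cy[OF N(4) N(6) N(5)] o unfolding cyc_def by (smt (verit))+
  show ?A
    using R.flip_cases_linear[OF o LE UE] cp N cqo o by auto
  have ori: "\<exists>u' v'. R u' v' \<and> p \<le> u' \<and> u' < v' \<and> (u' \<noteq> p \<or> v' \<noteq> g q) \<and> (u' = g u \<and> v' = g v \<or> u' = g v \<and> v' = g u)"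
    if "A u v" "{u, v} \<noteq> {p, q}" "u \<noteq> v" "N u" "N v" for u v
  proof -
    have d: "g u = g v \<longleftrightarrow> u = v" "g u = p \<longleftrightarrow> u = p" "g v = p \<longleftrightarrow> v = p" "g u = g q \<longleftrightarrow> u = q" "g v = g q \<longleftrightarrow> v = q"
      using inj N(1,4) that(4,5) gp by metis+
    have x: "R (g u) (g v)" "R (g v) (g u)" using B[OF that(1,4,5)] B[OF sym[OF that(1)] that(5,4)] by blast+
    show ?thesis
    proof (cases "g u < g v")
      case True
      then have "R (g u) (g v) \<and> p \<le> g u \<and> g u < g v \<and> (g u \<noteq> p \<or> g v \<noteq> g q)"
        using x(1) d that(2) gp2[OF that(4)] by auto
      then show ?thesis by blast
    next
      case False
      then have "R (g v) (g u) \<and> p \<le> g v \<and> g v < g u \<and> (g v \<noteq> p \<or> g u \<noteq> g q)"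
        using x(2) d that(2,3) gp2[OF that(5)] by auto
      then show ?thesis by blast
    qed
  qed
  have cross: "a' < c' \<and> c' < b' \<and> b' < d' \<or> c' < a' \<and> a' < d' \<and> d' < b'"
    if "chords_cross a b c d" "N a" "N b" "N c" "N d" "a' < b'" "c' < d'"
      "a' = g a \<and> b' = g b \<or> a' = g b \<and> b' = g a" "c' = g c \<and> d' = g d \<or> c' = g d \<and> d' = g c"
    for a b c d a' b' c' d'
  proof -
    have "chords_cross (g a) (g b) (g c) (g d)"
      using that(1-5) cy unfolding chords_cross_def by blast
    then show ?thesis using that(6-) unfolding chords_cross_def cyc_def by (smt (verit))
  qed
  have ne: "a \<noteq> b \<and> c \<noteq> d" if "chords_cross a b c d" for a b c d
    using that unfolding chords_cross_def cyc_def by auto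
  \<comment> \<open>Both exchanges at once: \<open>f\<close>, \<open>f'\<close> stand for the ends
    of the new edge, either \<open>i2\<close>, \<open>o2\<close> or \<open>i1\<close>,
    \<open>o1\<close>.\<close>
  {
    fix f f'
    assume uv: "A u v" "{u, v} \<noteq> {p, q}" and st: "A s t" "{s, t} \<noteq> {p, q}"
      and cr: "chords_cross f f' u v" "chords_cross f f' s t" "chords_cross u v s t"
      and ff: "g f < g f'" "N f" "N f'"
    obtain u' v' where u': "R u' v'" "p \<le> u'" "u' < v'" "u' \<noteq> p \<or> v' \<noteq> g q" "u' = g u \<and> v' = g v \<or> u' = g v \<and> v' = g u"
      using ori[OF uv _ N(9,10)] ne[OF cr(1)] by blast
    obtain s' t' where s': "R s' t'" "p \<le> s'" "s' < t'" "s' \<noteq> p \<or> t' \<noteq> g q" "s' = g s \<and> t' = g t \<or> s' = g t \<and> t' = g s"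
      using ori[OF st _ N(11,12)] ne[OF cr(2)] by blast
    note X = cross[OF cr(1) ff(2,3) N(9,10) ff(1) u'(3) _ u'(5)] cross[OF cr(2) ff(2,3) N(11,12) ff(1) s'(3) _ s'(5)]
      cross[OF cr(3) N(9-12) u'(3) s'(3) u'(5) s'(5)]
    have "\<exists>u v s t. (R u v \<and> p \<le> u \<and> u < v \<and> (u \<noteq> p \<or> v \<noteq> g q) \<and> (u < g f \<and> g f < v \<and> v < g f' \<or> g f < u \<and> u < g f' \<and> g f' < v)) \<and>
      (R s t \<and> p \<le> s \<and> s < t \<and> (s \<noteq> p \<or> t \<noteq> g q) \<and> (s < g f \<and> g f < t \<and> t < g f' \<or> g f < s \<and> s < g f' \<and> g f' < t)) \<and>
      (u < s \<and> s < v \<and> v < t \<or> s < u \<and> u < t \<and> t < v)"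
      by (rule exI[of _ u'], rule exI[of _ v'], rule exI[of _ s'], rule exI[of _ t'])
        (use X u'(1-4) s'(1-4) in auto)
  } note lin = this
  show False if "cyc p y i2" "cyc q z o2" "A u v" "{u, v} \<noteq> {p, q}" "A s t" "{s, t} \<noteq> {p, q}"
      "chords_cross i2 o2 u v" "chords_cross i2 o2 s t" "chords_cross u v s t"
  proof -
    have c: "g y < g i2" "g z < g o2" using that cp N cqo by auto
    have "g i2 < g o2" using o by linarith
    from lin[OF that(3-9) this N(3,7)] show False
      using R.flip_alpha_linear[OF o LE UE c] by blast
  qed
  show False if "cyc p i1 y" "cyc q o1 z" "A u v" "{u, v} \<noteq> {p, q}" "A s t" "{s, t} \<noteq> {p, q}"
      "chords_cross i1 o1 u v" "chords_cross i1 o1 s t" "chords_cross u v s t"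
  proof -
    have c: "g i1 < g y" "g o1 < g z" using that cp N cqo by auto
    have "g i1 < g o1" using o by linarith
    from lin[OF that(3-9) this N(2,6)] show False
      using R.flip_beta_linear[OF o LE UE c] by blast
  qed
qed

end

lemma int_least:
  fixes x l :: int
  assumes "P x" "\<And>y. P y \<Longrightarrow> l \<le> y"
  obtains m where "P m" "\<And>y. P y \<Longrightarrow> m \<le> y"
proof -
  obtain m where m: "P m" "\<And>y. P y \<Longrightarrow> nat (m - l) \<le> nat (y - l)"
    using ex_has_least_nat[of P x "\<lambda>y. nat (y - l)"] assms(1) by auto
  have "m \<le> y" if "P y" for y using m(2)[OF that] assms(2)[OF that] assms(2)[OF m(1)] by linarith
  with m(1) that show ?thesis by blast
qed

lemma int_greatest:
  fixes x l :: int
  assumes "P x" "\<And>y. P y \<Longrightarrow> y \<le> l"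
  obtains m where "P m" "\<And>y. P y \<Longrightarrow> y \<le> m"
proof -
  obtain m where "P (- m)" "\<And>y. P (- y) \<Longrightarrow> m \<le> y"
    using int_least[of "\<lambda>y. P (- y)" "- x" "- l"] assms by (metis add.inverse_inverse minus_le_iff)
  then show ?thesis using that[of "- m"] by (metis add.inverse_inverse minus_le_iff)
qed

section \<open>Uniqueness of stars\<close>

context crossing_free
begin

text \<open>A star with infinity fixed in the gap between \<open>s4\<close> and \<open>s0\<close>.
  Then \<open>s2\<close> is the middle vertex and [s0, s3], [s1, s4] are the two ceilings.\<close>

definition star :: "int \<Rightarrow> int \<Rightarrow> int \<Rightarrow> int \<Rightarrow> int \<Rightarrow> bool" where
  "star s0 s1 s2 s3 s4 \<longleftrightarrow> s0 < s1 \<and> s1 < s2 \<and> s2 < s3 \<and> s3 < s4 \<and>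
     A s0 s2 \<and> A s0 s3 \<and> A s1 s3 \<and> A s1 s4 \<and> A s2 s4"

lemma star_cstar: "star s0 s1 s2 s3 s4 \<Longrightarrow> cstar s0 s1 s2 s3 s4"
  unfolding star_def cstar_def cyc_def by auto

text \<open>If \<open>j\<close> and \<open>j'\<close> differed, the edge from \<open>p\<close> to
  one of them would lie in the cone of the other star at \<open>p\<close>. The cones at
  \<open>q\<close> and then at \<open>i\<close> determine \<open>i\<close> and \<open>z\<close> in
  the same way.\<close>

lemma cstar_unique:
  assumes "cstar p i j q z" "cstar p i' j' q z'"
  shows "i' = i \<and> j' = j \<and> z' = z"
proof -
  note r = cstar_rotate
  have 1: "j' = j"
    using cstar_cone[OF assms(1), of j'] cstar_cone[OF assms(2), of j] assms
    unfolding cstar_def cyc_def by (smt (verit))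
  have 2: "i' = i"
    using cstar_cone[OF r[OF r[OF r[OF assms(1)]]], of i'] cstar_cone[OF r[OF r[OF r[OF assms(2)]]], of i]
      assms sym[of i q] sym[of i' q]
    unfolding cstar_def cyc_def by (smt (verit))
  have 3: "z' = z"
    using cstar_cone[OF r[OF assms(1)], of z'] cstar_cone[OF r[OF assms(2)], of z] 2 assms
    unfolding cstar_def cyc_def by (smt (verit))
  from 1 2 3 show ?thesis by blast
qed

text \<open>The cone at \<open>m\<close> contains infinity, so \<open>s0\<close> and
  \<open>s4\<close> are the extreme neighbours of \<open>m\<close>. The cones at \<open>s0\<close>
  and \<open>s4\<close>, each with \<open>m\<close> as one bound, then determine \<open>s3\<close>
  and \<open>s1\<close>.\<close>

lemma star_middle_unique:
  assumes "star s0 s1 m s3 s4" "star t0 t1 m t3 t4"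
  shows "t0 = s0 \<and> t1 = s1 \<and> t3 = s3 \<and> t4 = s4"
proof -
  note S = star_cstar[OF assms(1)] and T = star_cstar[OF assms(2)] and r = cstar_rotate
  have 1: "t0 = s0 \<and> t4 = s4"
    using cstar_cone[OF r[OF r[OF S]], of t0] cstar_cone[OF r[OF r[OF T]], of s0]
      cstar_cone[OF r[OF r[OF S]], of t4] cstar_cone[OF r[OF r[OF T]], of s4]
      assms sym[of t0 m] sym[of s0 m]
    unfolding star_def cyc_def by (smt (verit))
  moreover have "t3 = s3"
    using cstar_cone[OF S, of t3] cstar_cone[OF T, of s3] 1 assms
    unfolding star_def cyc_def by (smt (verit))
  moreover have "t1 = s1"
    using cstar_cone[OF r[OF r[OF r[OF r[OF S]]]], of t1] cstar_cone[OF r[OF r[OF r[OF r[OF T]]]], of s1]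
      sym[of t1 t4] sym[of s1 s4] 1 assms
    unfolding star_def cyc_def by (smt (verit))
  ultimately show ?thesis using 1 by blast
qed

end

section \<open>Crossed and uncrossed vertices\<close>

context cover_graph
begin

lemma shift: "A x y \<Longrightarrow> A (x + k * n) (y + k * n)"
proof (induction k rule: int_induct[of _ 0])
  case (step1 i)
  then show ?case using shift_up[of "x + i * n" "y + i * n"] by (simp add: algebra_simps)
next
  case (step2 i)
  then show ?case using shift_down[of "x + i * n" "y + i * n"] by (simp add: algebra_simps)
qed simp

definition crossed :: "int \<Rightarrow> bool" where
  "crossed m \<longleftrightarrow> (\<exists>a b c d. A a b \<and> A c d \<and> a < c \<and> c < m \<and> m < b \<and> b < d)"

lemma crossedI: "A a b \<Longrightarrow> A c d \<Longrightarrow> a < c \<Longrightarrow> c < m \<Longrightarrow> m < b \<Longrightarrow> b < d \<Longrightarrow> crossed m"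
  unfolding crossed_def by blast

lemma crossed_shift: "crossed m \<Longrightarrow> crossed (m + k * n)"
  unfolding crossed_def using shift[of _ _ k] by (metis add_less_cancel_right)

text \<open>The edge crosses its translate by \<open>- n\<close> over \<open>m\<close> and its
  translate by \<open>n\<close> over \<open>m + n\<close>.\<close>

lemma crossed_long:
  assumes "A a b" "a < m" "m + n < b"
  shows "crossed m" "crossed (m + n)"
proof -
  show "crossed m" by (rule crossedI[OF shift_down[OF assms(1)] assms(1)]) (use assms n_pos in auto)
  show "crossed (m + n)" by (rule crossedI[OF assms(1) shift_up[OF assms(1)]]) (use assms n_pos in auto)
qed

text \<open>Consecutive translates of [a, a + 2 * n] cross over every vertex strictly between two
  consecutive translates of \<open>a\<close>.\<close>

lemma crossed_iff:
  assumes "\<not> crossed a" "A a (a + 2 * n)"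
  shows "crossed m \<longleftrightarrow> \<not> n dvd (m - a)"
proof
  assume "crossed m"
  show "\<not> n dvd (m - a)"
  proof
    assume "n dvd (m - a)"
    then obtain k where "m - a = n * k" by (elim dvdE)
    then have "a = m + (- k) * n" by (simp add: algebra_simps)
    with crossed_shift[OF \<open>crossed m\<close>] assms(1) show False by blast
  qed
next
  assume nd: "\<not> n dvd (m - a)"
  define k r where "k = (m - a) div n" and "r = (m - a) mod n"
  have m: "m = a + k * n + r" unfolding k_def r_def by simp
  have "r \<noteq> 0" "0 \<le> r" "r < n" using nd n_pos unfolding r_def by (auto simp: dvd_eq_mod_eq_0)
  moreover have "A (a + k * n) (a + 2 * n + k * n)" using shift[OF assms(2)] .
  ultimately show "crossed m"
    using crossedI[OF shift_down shift, of "a + k * n" "a + 2 * n + k * n" "a + k * n" "a + 2 * n + k * n" 0 m] m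
    by simp
qed

end

section \<open>Existence of stars below an edge, above an edge, and around a missing chord\<close>

context max_cover_graph
begin

text \<open>The extremal choices are dictated by the empty cones of the star to be found. Edges of
  length 2 at \<open>q\<close> and at \<open>q - 1\<close> show that \<open>w\<close> and
  \<open>d\<close> exist. Whether \<open>d\<close> has an edge leaving to the left of
  \<open>p\<close> decides between the two shapes.\<close>

lemma lower_star:
  assumes pq: "A p q" "p + 3 \<le> q"
  shows "(\<exists>s1 m s4. star p s1 m q s4) \<or> (\<exists>s0 m s3. star s0 p m s3 q)"
proof -
  have "A (q - 2) q" using short[of "q - 2"] by simp
  then obtain w where w: "p < w \<and> w < q \<and> A w q" and "\<And>x. p < x \<and> x < q \<and> A x q \<Longrightarrow> w \<le> x"
    using int_least[of "\<lambda>x. p < x \<and> x < q \<and> A x q" "q - 2" p] pq(2) by auto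
  then have wmin: "p < x \<Longrightarrow> x < w \<Longrightarrow> \<not> A x q" for x by force
  have wq: "w < q - 1" using length_ge[of w q] w by linarith
  have "q - 1 + 2 = q + 1" by simp
  then have "A (q - 1) (q + 1)" using short[of "q - 1"] by metis
  then have "w < q - 1 \<and> q - 1 < q \<and> (\<exists>c. A (q - 1) c \<and> (c < p \<or> q < c))" using wq by force
  then obtain d where d: "w < d \<and> d < q \<and> (\<exists>c. A d c \<and> (c < p \<or> q < c))"
    and dm: "\<And>x. w < x \<and> x < q \<and> (\<exists>c. A x c \<and> (c < p \<or> q < c)) \<Longrightarrow> d \<le> x"
    by (rule int_least[where l = w]) auto
  have dmin: "p \<le> c \<and> c \<le> q" if "w < x" "x < d" "A x c" for x c
    using dm[of x] that d by force
  have o: "p < w" "w < d" "d < q" "A w q" using w d by auto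
  obtain c0 where c0: "A d c0" "c0 < p \<or> q < c0" using d by blast
  have pd: "A p d" by (rule lower_star_inner_edge[OF pq o _ _ c0]) (use wmin dmin in blast)+
  show ?thesis
  proof (cases "\<exists>c<p. A d c")
    case True
    then obtain c' where "c' < p \<and> A d c'" by blast
    then obtain c where c: "c < p \<and> A d c" and cm: "\<And>x. x < p \<and> A d x \<Longrightarrow> x \<le> c"
      by (rule int_greatest[where l = p]) auto
    then have c1: "A c d" "c < p" using sym by auto
    have "A c w" by (rule lower_star_outer_edge_left[OF pq o _ _ c1]) (use wmin dmin cm in blast)+
    then have "star c p w d q" unfolding star_def using o c pd pq sym by blast
    then show ?thesis by blast
  next
    case False
    then obtain c' where c': "A d c'" "q < c'" using d by blast
    have b: "x \<le> d + 2 * n" if "A d x" for x using length_le[OF that] by linarith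
    obtain c where c: "A d c" and cm: "\<And>x. A d x \<Longrightarrow> x \<le> c"
      using int_greatest[of "A d" c' "d + 2 * n"] c' b by blast
    have qc: "q < c" using cm[OF c'(1)] c' by linarith
    have cmax: "p \<le> x \<and> x \<le> c" if "A d x" for x using that False cm by force
    have "A w c" by (rule lower_star_outer_edge_right[OF pq o _ _ c qc]) (use wmin dmin cmax in blast)+
    then have "star p w d q c" unfolding star_def using o c pd pq qc by blast
    then show ?thesis by blast
  qed
qed

lemma middle_star:
  assumes "crossed m"
  shows "\<exists>s0 s1 s3 s4. star s0 s1 m s3 s4"
proof -
  let ?P = "\<lambda>k. \<exists>a b c d. A a b \<and> A c d \<and> a < c \<and> c < m \<and> m < b \<and> b < d \<and> k = (b - a) + (d - c)"
  from assms obtain x where "?P x" unfolding crossed_def by blast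
  moreover have "0 \<le> k" if "?P k" for k using that by auto
  ultimately obtain k where k: "?P k" "\<And>y. ?P y \<Longrightarrow> k \<le> y"
    using int_least[of ?P x 0] by blast
  then obtain c1 d1 c2 d2 where P: "A c1 d1" "A c2 d2" "c1 < c2" "c2 < m" "m < d1" "d1 < d2"
      "k = (d1 - c1) + (d2 - c2)"
    by blast
  have "(d1 - c1) + (d2 - c2) \<le> (b - a) + (d - c)"
    if "A a b" "A c d" "a < c" "c < m" "m < b" "b < d" for a b c d
    using k(2)[of "(b - a) + (d - c)"] that P(7) by blast
  from shortest_pair_star[OF P(1-6) this] have "star c1 c2 m d1 d2"
    unfolding star_def using P by blast
  then show ?thesis by blast
qed

text \<open>No two edges cross over a translate of \<open>m\<close>, and by
  \<open>crossed_long\<close> no edge passes over two consecutive translates of \<open>m\<close>.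
  Every configuration blocking [m, m + 2 * n] violates one of these.\<close>

lemma uncrossed_edge:
  assumes "\<not> crossed m"
  shows "A m (m + 2 * n)"
proof (rule ccontr)
  assume nA: "\<not> A m (m + 2 * n)"
  have nc: "\<not> crossed (m + n)" "\<not> crossed (m + 2 * n)"
    using crossed_shift[of "m + n" "-1"] crossed_shift[of "m + 2 * n" "-2"] assms by auto
  have long: "b \<le> m + n" if "A a b" "a < m" for a b
    using crossed_long[OF that] assms by force
  have long': "b \<le> m + 2 * n" if "A a b" "a < m + n" for a b
    using crossed_long[of a b "m + n"] that nc by force
  have long'': "b \<le> m + 3 * n" if "A a b" "a < m + 2 * n" for a b
    using crossed_long[of a b "m + 2 * n"] that nc by force
  have "2 \<le> m + 2 * n - m" "m + 2 * n - m \<le> 2 * n" using n_pos by auto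
  with nA show False
  proof (cases rule: blocked_cases)
    case (R a b c d)
    then show False using crossedI[OF R(1,2), of "m + 2 * n"] nc by linarith
  next
    case (M a b c d)
    then show False using long[OF M(1)] long'[OF M(2)] by linarith
  next
    case (L a b c d)
    then show False using crossedI[OF L(1,2), of m] assms by linarith
  next
    case (TL a b)
    then show False using long[OF TL(1)] by linarith
  next
    case (TM a b)
    then show False using long'[OF TM(1)] by linarith
  next
    case (TR a b)
    then show False using long''[OF TR(1)] by linarith
  qed
qed

text \<open>The right end \<open>q\<close> of a longest edge [p, q] is uncrossed. Otherwise the star
  with middle vertex \<open>q\<close> has a ceiling [c1, d1] with \<open>q < d1\<close>; being no
  longer than [p, q] it has \<open>p < c1\<close>, and both ceilings form a 3-crossing with
  [p, q].\<close>

lemma exists_uncrossed: "\<exists>a. \<not> crossed a"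
proof -
  let ?P = "\<lambda>k. \<exists>p q. A p q \<and> k = q - p"
  have "?P 2" using short[of 0] by force
  moreover have "k \<le> 2 * n" if "?P k" for k using that length_le by force
  ultimately obtain k where k: "?P k" "\<And>y. ?P y \<Longrightarrow> y \<le> k"
    using int_greatest[of ?P 2 "2 * n"] by blast
  from k(1) obtain p q where pq: "A p q" "k = q - p" by blast
  have "2 \<le> k" using k(2) \<open>?P 2\<close> by blast
  have "\<not> crossed q"
  proof
    assume "crossed q"
    then obtain c1 c2 d1 d2 where s: "star c1 c2 q d1 d2" using middle_star by blast
    then have e: "A c1 d1" "A c2 d2" "c1 < c2" "c2 < q" "q < d1" "d1 < d2" unfolding star_def by auto
    have "d1 - c1 \<le> k" using k(2) e(1) by blast
    then have "p < c1" using pq e by linarith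
    then show False using no_crossing[OF pq(1) e(1,2)] e by linarith
  qed
  then show ?thesis by blast
qed

text \<open>If an edge at \<open>p\<close> or \<open>q\<close> extends beyond [p, q], take the
  nearest one: the empty cone of the star below it makes [p, q] its neighbouring edge in that star.
  Otherwise \<open>q\<close> is uncrossed, and [q - 2 * n, q] must be [p, q] itself.\<close>

lemma upper_cstar:
  assumes pq: "A p q" "p < q"
  shows "(\<exists>i j z. cstar q i j p z) \<or> (q = p + 2 * n \<and> \<not> crossed p)"
proof -
  note R = cstar_rotate
  have len: "p + 2 \<le> q" "q \<le> p + 2 * n" using length_ge[OF pq(1)] length_le[OF pq(1)] pq(2) by linarith+
  consider (r) r where "q < r" "A p r" | (l) l where "l < p" "A l q"
    | (N) "\<And>r. q < r \<Longrightarrow> \<not> A p r" "\<And>l. l < p \<Longrightarrow> \<not> A l q" by blast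
  then show ?thesis
  proof cases
    case r
    then have "q < r \<and> A p r" by blast
    then obtain r where r: "q < r \<and> A p r" and rm: "\<And>x. q < x \<and> A p x \<Longrightarrow> r \<le> x"
      by (rule int_least[where l = q]) auto
    from r len have "p + 3 \<le> r" by linarith
    with lower_star[of p r] r consider (1) s1 m s4 where "star p s1 m r s4" | (2) s0 m s3 where "star s0 p m s3 r"
      by blast
    then show ?thesis
    proof cases
      case 1
      have "m = q"
        using cstar_cone[OF star_cstar[OF 1] pq(1)] 1 rm[of m] r unfolding star_def cyc_def by force
      with R[OF R[OF star_cstar[OF 1]]] have "cstar q r s4 p s1" by simp
      then show ?thesis by blast
    next
      case 2
      have "s3 = q"
        using cstar_cone[OF R[OF star_cstar[OF 2]] pq(1)] 2 rm[of s3] r unfolding star_def cyc_def by force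
      with R[OF R[OF R[OF star_cstar[OF 2]]]] have "cstar q r s0 p m" by simp
      then show ?thesis by blast
    qed
  next
    case l
    then have "l < p \<and> A l q" by blast
    then obtain l where l: "l < p \<and> A l q" and lm: "\<And>x. x < p \<and> A x q \<Longrightarrow> x \<le> l"
      by (rule int_greatest[where l = p]) auto
    from l len have "l + 3 \<le> q" by linarith
    with lower_star[of l q] l consider (1) s1 m s4 where "star l s1 m q s4" | (2) s0 m s3 where "star s0 l m s3 q"
      by blast
    then show ?thesis
    proof cases
      case 1
      have "s1 = p"
        using cstar_cone[OF R[OF R[OF R[OF star_cstar[OF 1]]]] sym[OF pq(1)]] 1 lm[of s1] l
        unfolding star_def cyc_def by force
      with R[OF R[OF R[OF star_cstar[OF 1]]]] have "cstar q s4 l p m" by simp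
      then show ?thesis by blast
    next
      case 2
      have "m = p"
        using cstar_cone[OF R[OF R[OF R[OF R[OF star_cstar[OF 2]]]]] sym[OF pq(1)]] 2 lm[of m] l
        unfolding star_def cyc_def by force
      with R[OF R[OF R[OF R[OF star_cstar[OF 2]]]]] have "cstar q s0 l p s3" by simp
      then show ?thesis by blast
    qed
  next
    case N
    have "\<not> crossed q"
    proof
      assume "crossed q"
      then obtain c1 c2 d1 d2 where s: "star c1 c2 q d1 d2" using middle_star by blast
      then have e: "A c1 q" "A c1 d1" "A c2 d2" "c1 < c2" "c2 < q" "q < d1" "d1 < d2" unfolding star_def by auto
      have "p \<le> c1" using N(2)[of c1] e by force
      moreover have "p \<noteq> c1" using N(1) e by blast
      ultimately show False using no_crossing[OF pq(1) e(2,3)] e by linarith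
    qed
    then have "A (q - 2 * n) q" using shift[OF uncrossed_edge, of q "-2"] by simp
    then have q: "q = p + 2 * n" using N(2) len by force
    moreover have "\<not> crossed p" using \<open>\<not> crossed q\<close> crossed_shift[of p 2] q by auto
    ultimately show ?thesis by blast
  qed
qed

text \<open>Let [u, r] be the first edge at \<open>u\<close> beyond \<open>v\<close>; the star below
  it has a cone at \<open>u\<close> that is bounded by \<open>r\<close> and contains
  \<open>v\<close>. If there is no such edge, \<open>u\<close> is crossed, for an uncrossed vertex
  has neighbours at distance \<open>2 * n\<close>, and \<open>v\<close> lies in the cone through
  infinity of the star with middle vertex \<open>u\<close>.\<close>

lemma cone_exists:
  assumes nA: "\<not> A u v" and len: "u \<noteq> v" "\<bar>u - v\<bar> \<le> 2 * n" "2 < \<bar>u - v\<bar>"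
  shows "\<exists>i j q z. cstar u i j q z \<and> cyc j v q"
proof -
  note R = cstar_rotate
  consider (r) r where "u < v" "v < r" "A u r" | (l) l where "v < u" "l < v" "A l u"
    | (N1) "u < v" "\<And>r. v < r \<Longrightarrow> \<not> A u r" | (N2) "v < u" "\<And>r. r < v \<Longrightarrow> \<not> A r u" using len by force
  then show ?thesis
  proof cases
    case r
    note uv = r(1)
    from r have "v < r \<and> A u r" by blast
    then obtain r where r: "v < r \<and> A u r" and rm: "\<And>x. v < x \<and> A u x \<Longrightarrow> r \<le> x"
      by (rule int_least[where l = v]) auto
    have "u + 3 \<le> r" using r uv len by linarith
    with lower_star[of u r] r consider (1) s1 m s4 where "star u s1 m r s4" | (2) s0 m s3 where "star s0 u m s3 r"
      by blast
    then show ?thesis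
    proof cases
      case 1
      then have "m < v" using rm[of m] r nA unfolding star_def by (cases m v rule: linorder_cases) auto
      then have "cyc m v r" using r unfolding cyc_def by auto
      with star_cstar[OF 1] show ?thesis by blast
    next
      case 2
      then have "s3 < v" using rm[of s3] r nA unfolding star_def by (cases s3 v rule: linorder_cases) auto
      then have "cyc s3 v r" using r unfolding cyc_def by auto
      with R[OF star_cstar[OF 2]] show ?thesis by blast
    qed
  next
    case l
    note uv = l(1)
    from l have "l < v \<and> A l u" by blast
    then obtain l where l: "l < v \<and> A l u" and lm: "\<And>x. x < v \<and> A x u \<Longrightarrow> x \<le> l"
      by (rule int_greatest[where l = v]) auto
    have nA': "\<not> A v u" using nA sym by blast
    have "l + 3 \<le> u" using l uv len by linarith
    with lower_star[of l u] l consider (1) s1 m s4 where "star l s1 m u s4" | (2) s0 m s3 where "star s0 l m s3 u"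
      by blast
    then show ?thesis
    proof cases
      case 1
      then have "v < s1" using lm[of s1] l nA' unfolding star_def by (cases s1 v rule: linorder_cases) auto
      then have "cyc l v s1" using l unfolding cyc_def by auto
      with R[OF R[OF R[OF star_cstar[OF 1]]]] show ?thesis by blast
    next
      case 2
      then have "v < m" using lm[of m] l nA' unfolding star_def by (cases m v rule: linorder_cases) auto
      then have "cyc l v m" using l unfolding cyc_def by auto
      with R[OF R[OF R[OF R[OF star_cstar[OF 2]]]]] show ?thesis by blast
    qed
  next
    case N1
    have "crossed u"
    proof (rule ccontr)
      assume "\<not> crossed u"
      from uncrossed_edge[OF this] N1 nA len show False by (cases "v = u + 2 * n") force+
    qed
    then obtain s0 s1 s3 s4 where s: "star s0 s1 u s3 s4" using middle_star by blast
    then have "s4 < v" using N1(2)[of s4] nA unfolding star_def by (cases s4 v rule: linorder_cases) auto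
    moreover have "s0 < s4" using s unfolding star_def by linarith
    ultimately have "s4 < v" "s0 < s4" .
    then have "cyc s4 v s0" unfolding cyc_def by auto
    with R[OF R[OF star_cstar[OF s]]] show ?thesis by blast
  next
    case N2
    have nA': "\<not> A v u" using nA sym by blast
    have "crossed u"
    proof (rule ccontr)
      assume "\<not> crossed u"
      from shift[OF uncrossed_edge[OF this], of "-2"] have "A (u - 2 * n) u" by simp
      with N2 nA' len show False by (cases "v = u - 2 * n") force+
    qed
    then obtain s0 s1 s3 s4 where s: "star s0 s1 u s3 s4" using middle_star by blast
    then have "v < s0" using N2(2)[of s0] nA' unfolding star_def by (cases s0 v rule: linorder_cases) auto
    moreover have "s0 < s4" using s unfolding star_def by linarith
    ultimately have "v < s0" "s0 < s4" .
    then have "cyc s4 v s0" unfolding cyc_def by auto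
    with R[OF R[OF star_cstar[OF s]]] show ?thesis by blast
  qed
qed

end


section \<open>Flips\<close>

context crossing_free
begin

text \<open>For adjacent stars, the order conditions say exactly that [a, b] lies in the cone of the
  first star at \<open>a\<close> and in the cone of the second star at \<open>b\<close>.\<close>

definition flip_target :: "int \<Rightarrow> int \<Rightarrow> int \<Rightarrow> int \<Rightarrow> int \<Rightarrow> int \<Rightarrow> int \<Rightarrow> int \<Rightarrow> int \<Rightarrow> int \<Rightarrow> bool" where
  "flip_target p i1 i2 q z o1 o2 y a b \<longleftrightarrow>
     cyc p y i2 \<and> cyc q z o2 \<and> a = i2 \<and> b = o2 \<or> cyc p i1 y \<and> cyc q o1 z \<and> a = i1 \<and> b = o1"

lemma chords_crossI: "a < c \<Longrightarrow> c < b \<Longrightarrow> b < d \<Longrightarrow> chords_cross a b c d"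
  unfolding chords_cross_def cyc_def by auto

lemma chords_cross_commute: "chords_cross a b c d \<Longrightarrow> chords_cross c d a b"
  unfolding chords_cross_def cyc_def by (smt (verit))

lemma chords_cross_swap: "chords_cross a b c d = chords_cross b a c d" "chords_cross a b c d = chords_cross a b d c"
  unfolding chords_cross_def cyc_def by (smt (verit))+

lemma chords_cross_doubleton: "{a, b} = {a', b'} \<Longrightarrow> {c, d} = {c', d'} \<Longrightarrow> chords_cross a b c d \<Longrightarrow> chords_cross a' b' c' d'"
  using chords_cross_swap by (auto simp: doubleton_eq_iff)

lemma not_chords_cross_self: "\<not> chords_cross a b a b"
  unfolding chords_cross_def cyc_def by auto

text \<open>Only [p, q] itself is exchanged, not its translates. A 3-crossing would consist of the
  new edge and two old ones, which \<open>flip_alpha\<close> and \<open>flip_beta\<close>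
  exclude.\<close>

lemma single_flip_crossing_free:
  assumes L: "cstar p i1 i2 q z" and U: "cstar q o1 o2 p y" and f: "flip_target p i1 i2 q z o1 o2 y a b"
  shows "crossing_free (\<lambda>u v. A u v \<and> {u, v} \<noteq> {p, q} \<or> {u, v} = {a, b})"
    (is "crossing_free ?B")
proof
  have *: False if "A u v" "{u, v} \<noteq> {p, q}" "A s t" "{s, t} \<noteq> {p, q}"
    "chords_cross a b u v" "chords_cross a b s t" "chords_cross u v s t" for u v s t
    using f flip_alpha[OF L U _ _ that(1-4)] flip_beta[OF L U _ _ that(1-4)] that(5-7)
    unfolding flip_target_def by blast
  have **: False if "?B c d" "?B e f" "{u, v} = {a, b}" "chords_cross u v c d" "chords_cross u v e f"
    "chords_cross c d e f" for u v c d e f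
  proof -
    have x: "chords_cross a b c d" "chords_cross a b e f"
      using chords_cross_doubleton[OF that(3) refl] that by auto
    have "{c, d} \<noteq> {a, b}" "{e, f} \<noteq> {a, b}"
      using x not_chords_cross_self chords_cross_doubleton[OF refl, of c d a b a b]
        chords_cross_doubleton[OF refl, of e f a b a b] by blast+
    then show False using *[of c d e f] that x by blast
  qed
  show False if H: "?B u v" "?B c d" "?B e f" and o: "u < c" "c < e" "e < v" "v < d" "d < f" for u v c d e f
  proof -
    have x: "chords_cross u v c d" "chords_cross u v e f" "chords_cross c d e f"
      by (rule chords_crossI; use o in linarith)+
    note y = chords_cross_commute[OF x(1)] chords_cross_commute[OF x(2)] chords_cross_commute[OF x(3)]
    show False
      using no_crossing[of u v c d e f] o H **[OF H(2,3) _ x] **[OF H(1,3) _ y(1) x(3) x(2)]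
        **[OF H(1,2) _ y(2) y(3) x(1)] by blast
  qed
  show "?B v u" if "?B u v" for u v
    using that sym by (auto simp: insert_commute)
qed

end

section \<open>Exchanging a whole translation class: the generic case\<close>

context cover_graph
begin

definition orb :: "int \<Rightarrow> int \<Rightarrow> int \<Rightarrow> int \<Rightarrow> bool" where
  "orb p q x y \<longleftrightarrow> (\<exists>k. {x, y} = {p + k * n, q + k * n})"

definition flip :: "int \<Rightarrow> int \<Rightarrow> int \<Rightarrow> int \<Rightarrow> int \<Rightarrow> int \<Rightarrow> bool" where
  "flip p q a b x y \<longleftrightarrow> A x y \<and> \<not> orb p q x y \<or> orb a b x y"

lemma cyc_shift: "cyc (a + t) (b + t) (c + t) = cyc a b c"
  unfolding cyc_def by auto

lemma cstar_shift: "cstar p i j q z \<Longrightarrow> cstar (p + k * n) (i + k * n) (j + k * n) (q + k * n) (z + k * n)"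
  unfolding cstar_def cyc_shift using shift by blast

text \<open>The target lies in an empty cone of the first star.\<close>

lemma flip_target_nonedge:
  assumes L: "cstar p i1 i2 q z" and U: "cstar q o1 o2 p y" and f: "flip_target p i1 i2 q z o1 o2 y a b"
  shows "\<not> A a b"
proof -
  have "cyc z o2 p" if "cyc q z o2"
    using that U unfolding cstar_def cyc_def by (smt (verit))
  then show ?thesis
    using f cstar_cone[OF cstar_rotate[OF L]] cstar_cone[OF cstar_rotate[OF cstar_rotate[OF L]]]
    unfolding flip_target_def by blast
qed

lemma crossing_free_mono:
  assumes "crossing_free B" "\<And>x y. C x y \<Longrightarrow> B x y" "\<And>x y. C x y \<Longrightarrow> C y x"
  shows "crossing_free C"
proof
  show False if "C a b" "C c d" "C e f" and o: "a < c" "c < e" "e < b" "b < d" "d < f" for a b c d e f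
    using crossing_free.no_crossing[OF assms(1) assms(2)[OF that(1)] assms(2)[OF that(2)] assms(2)[OF that(3)] o] .
qed (rule assms(3))

text \<open>When no other edge of the two stars is a translate of \<open>[p, q]\<close>, translates can be flipped one at a time,
  and a 3-crossing involves at most three of them.\<close>

lemma flip_crossing_free:
  assumes L: "cstar p i1 i2 q z" and U: "cstar q o1 o2 p y" and f: "flip_target p i1 i2 q z o1 o2 y a b"
    and pq: "p \<noteq> q"
    and gen: "\<not> orb p q p i2" "\<not> orb p q i1 q" "\<not> orb p q i1 z" "\<not> orb p q i2 z"
      "\<not> orb p q q o2" "\<not> orb p q o1 p" "\<not> orb p q o1 y" "\<not> orb p q o2 y"
  shows "crossing_free (flip p q a b)"
proof -
  define AJ where "AJ J u v \<longleftrightarrow> A u v \<and> (\<forall>k\<in>J. {u, v} \<noteq> {p + k * n, q + k * n}) \<or>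
      (\<exists>k\<in>J. {u, v} = {a + k * n, b + k * n})" for J :: "int set" and u v
  have AJ: "crossing_free (AJ J)" if "finite J" for J
    using that
  proof (induction J rule: finite_induct)
    case empty
    show ?case unfolding AJ_def by (simp add: crossing_free_axioms)
  next
    case (insert k J)
    interpret J: crossing_free "AJ J" by (rule insert.IH)
    have e: "AJ J (x + k * n) (x' + k * n)" if "A x x'" "\<not> orb p q x x'" for x x'
    proof -
      have "{x + k * n, x' + k * n} \<noteq> {p + l * n, q + l * n}" for l
      proof
        assume "{x + k * n, x' + k * n} = {p + l * n, q + l * n}"
        then have "{x, x'} = {p + (l - k) * n, q + (l - k) * n}"
          by (auto simp: doubleton_eq_iff algebra_simps)
        then show False using that(2) unfolding orb_def by blast
      qed
      then show ?thesis unfolding AJ_def using shift[OF that(1)] by blast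
    qed
    have e': "AJ J (p + k * n) (q + k * n)"
    proof -
      have "A p q" using L unfolding cstar_def by blast
      moreover have "{p + k * n, q + k * n} \<noteq> {p + l * n, q + l * n}" if "l \<in> J" for l
        using that insert.hyps(2) n_pos pq by (auto simp: doubleton_eq_iff)
      ultimately show ?thesis unfolding AJ_def using shift by blast
    qed
    \<comment> \<open>Both stars at the \<open>k\<close>-th translate are still intact: its common
      edge is not yet exchanged, and by \<open>gen\<close> the other edges are never
      removed.\<close>
    have Ls: "J.cstar (p + k * n) (i1 + k * n) (i2 + k * n) (q + k * n) (z + k * n)"
      using L e e' gen unfolding cstar_def J.cstar_def cyc_shift by blast
    have Us: "J.cstar (q + k * n) (o1 + k * n) (o2 + k * n) (p + k * n) (y + k * n)"
      using U e J.sym[OF e'] gen unfolding cstar_def J.cstar_def cyc_shift by blast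
    have "J.flip_target (p + k * n) (i1 + k * n) (i2 + k * n) (q + k * n) (z + k * n) (o1 + k * n) (o2 + k * n)
       (y + k * n) (a + k * n) (b + k * n)"
      using f unfolding J.flip_target_def flip_target_def cyc_shift by auto
    from J.single_flip_crossing_free[OF Ls Us this]
    show ?case
    proof (rule crossing_free_mono)
      fix u v
      assume H: "AJ (insert k J) u v"
      have "{u, v} \<noteq> {p + k * n, q + k * n}" if "{u, v} = {a + l * n, b + l * n}" for l
      proof
        assume "{u, v} = {p + k * n, q + k * n}"
        with that have x: "{a + l * n, b + l * n} = {p + k * n, q + k * n}" by simp
        have "A (p + k * n) (q + k * n)" using shift L unfolding cstar_def by blast
        with x have "A (a + l * n) (b + l * n)" using sym by (auto simp: doubleton_eq_iff)
        from shift[OF this, of "- l"] show False using flip_target_nonedge[OF L U f] by simp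
      qed
      with H show "AJ J u v \<and> {u, v} \<noteq> {p + k * n, q + k * n} \<or> {u, v} = {a + k * n, b + k * n}"
        unfolding AJ_def by blast
    next
      show "AJ (insert k J) v u" if "AJ (insert k J) u v" for u v
        using that sym unfolding AJ_def by (auto simp: insert_commute)
    qed
  qed
  have AJ_flip: "\<exists>k. \<forall>J. k \<in> J \<longrightarrow> AJ J u v" if "flip p q a b u v" for u v
    using that unfolding flip_def orb_def AJ_def by blast
  show ?thesis
  proof
    show "flip p q a b v u" if "flip p q a b u v" for u v
      using that sym unfolding flip_def orb_def by (auto simp: insert_commute)
    show False if H: "flip p q a b u v" "flip p q a b c d" "flip p q a b e f"
      and o: "u < c" "c < e" "e < v" "v < d" "d < f" for u v c d e f
    proof -
      obtain k1 where k1: "\<forall>J. k1 \<in> J \<longrightarrow> AJ J u v" using AJ_flip[OF H(1)] ..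
      obtain k2 where k2: "\<forall>J. k2 \<in> J \<longrightarrow> AJ J c d" using AJ_flip[OF H(2)] ..
      obtain k3 where k3: "\<forall>J. k3 \<in> J \<longrightarrow> AJ J e f" using AJ_flip[OF H(3)] ..
      have J: "AJ {k1, k2, k3} u v" "AJ {k1, k2, k3} c d" "AJ {k1, k2, k3} e f"
        using k1 k2 k3 by simp_all
      show False using crossing_free.no_crossing[OF AJ J o] by simp
    qed
  qed
qed

lemma orb_self: "orb p q p q"
  unfolding orb_def by (rule exI[of _ 0]) simp

text \<open>The means of refuting a wrong replacement [c, d]: two crossing edges that survive the
  removal and both cross [c, d].\<close>

lemma flip_chords:
  assumes B: "crossing_free (flip p q c d)" and e: "A x y" "\<not> orb p q x y" "A x' y'" "\<not> orb p q x' y'"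
    "chords_cross c d x y" "chords_cross c d x' y'" "chords_cross x y x' y'"
  shows False
proof -
  have "flip p q c d c d" "flip p q c d x y" "flip p q c d x' y'"
    using e orb_self unfolding flip_def by blast+
  from crossing_free.no_crossing_chords[OF B this e(5-7)] show False .
qed

text \<open>Hypothesis \<open>e\<close> puts [c, d] in a cone at one of the vertices other than
  \<open>p\<close> and \<open>q\<close>. If \<open>c\<close> is not an end of the target, two
  crossing edges of the stars always refute it; if it is, a refuting pair exists on either side of
  the target, so \<open>d\<close> is its other end.\<close>

lemma flip_unique_end:
  assumes L: "cstar p i1 i2 q z" and U: "cstar q o1 o2 p y" and f: "flip_target p i1 i2 q z o1 o2 y a b"
    and gen: "\<not> orb p q p i2" "\<not> orb p q i1 q" "\<not> orb p q i1 z" "\<not> orb p q i2 z"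
      "\<not> orb p q q o2" "\<not> orb p q o1 p" "\<not> orb p q o1 y" "\<not> orb p q o2 y"
    and B: "crossing_free (flip p q c d)"
    and e: "c = i1 \<and> cyc q d z \<or> c = i2 \<and> cyc z d p \<or> c = o1 \<and> cyc p d y \<or> c = o2 \<and> cyc y d q"
  shows "c = a \<and> d = b \<or> c = b \<and> d = a"
proof -
  have LA: "A p i2" "A i1 q" "A i1 z" "A i2 z" and UA: "A q o2" "A o1 p" "A o1 y" "A o2 y"
    using L U unfolding cstar_def by auto
  have LC: "cyc p i1 i2" "cyc p i2 q" "cyc p q z" and UC: "cyc q o1 o2" "cyc q o2 p" "cyc q p y"
    using L U unfolding cstar_def by auto
  note K = flip_chords[OF B]
  consider (a) "cyc p y i2" "cyc q z o2" "a = i2" "b = o2" | (b) "cyc p i1 y" "cyc q o1 z" "a = i1" "b = o1"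
    using f unfolding flip_target_def by blast
  then show ?thesis
  proof cases
    case a
    from e consider "c = i1" "cyc q d z" | "c = i2" "cyc z d p" | "c = o1" "cyc p d y" | "c = o2" "cyc y d q"
      by blast
    then show ?thesis
    proof cases
      case 1
      then show ?thesis using K[OF LA(4) gen(4) UA(1) gen(5)] a(1,2) LC UC
        unfolding chords_cross_def cyc_def by smt
    next
      case 2
      then show ?thesis using K[OF UA(1) gen(5) LA(3) gen(3)] K[OF UA(2) gen(6) UA(4) gen(8)] a LC UC
        unfolding chords_cross_def cyc_def by smt
    next
      case 3
      then show ?thesis using K[OF UA(4) gen(8) LA(1) gen(1)] a(1,2) LC UC
        unfolding chords_cross_def cyc_def by smt
    next
      case 4
      then show ?thesis using K[OF LA(1) gen(1) UA(3) gen(7)] K[OF LA(2) gen(2) LA(4) gen(4)] a LC UC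
        unfolding chords_cross_def cyc_def by smt
    qed
  next
    case b
    from e consider "c = i1" "cyc q d z" | "c = i2" "cyc z d p" | "c = o1" "cyc p d y" | "c = o2" "cyc y d q"
      by blast
    then show ?thesis
    proof cases
      case 2
      then show ?thesis using K[OF LA(3) gen(3) UA(2) gen(6)] b(1,2) LC UC
        unfolding chords_cross_def cyc_def by smt
    next
      case 1
      then show ?thesis using K[OF UA(2) gen(6) LA(4) gen(4)] K[OF UA(1) gen(5) UA(3) gen(7)] b LC UC
        unfolding chords_cross_def cyc_def by smt
    next
      case 4
      then show ?thesis using K[OF UA(3) gen(7) LA(2) gen(2)] b(1,2) LC UC
        unfolding chords_cross_def cyc_def by smt
    next
      case 3
      then show ?thesis using K[OF LA(2) gen(2) UA(4) gen(8)] K[OF LA(1) gen(1) LA(3) gen(3)] b LC UC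
        unfolding chords_cross_def cyc_def by smt
    qed
  qed
qed

lemma flip_shift: "flip p q (c + k * n) (d + k * n) = flip p q c d"
proof -
  have "orb (c + k * n) (d + k * n) x y \<longleftrightarrow> orb c d x y" for x y
  proof
    assume "orb (c + k * n) (d + k * n) x y"
    then obtain l where "{x, y} = {c + (l + k) * n, d + (l + k) * n}" unfolding orb_def by (auto simp: algebra_simps)
    then show "orb c d x y" unfolding orb_def by blast
  next
    assume "orb c d x y"
    then obtain l where "{x, y} = {c + l * n, d + l * n}" unfolding orb_def by blast
    then have "{x, y} = {c + k * n + (l - k) * n, d + k * n + (l - k) * n}" by (simp add: algebra_simps)
    then show "orb (c + k * n) (d + k * n) x y" unfolding orb_def by blast
  qed
  then show ?thesis unfolding flip_def by simp
qed

end

context max_cover_graph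
begin

text \<open>\<open>k\<close> is the index of the translate of [p, q] whose removal unblocks [c, d]
  at its end \<open>c\<close>. Since that edge crosses [c, d] in the star around \<open>c\<close>,
  shifting back makes \<open>c\<close> the vertex \<open>i\<close> or \<open>j\<close>, with
  \<open>d - k * n\<close> in its cone.\<close>

lemma flip_ends:
  assumes nA: "\<not> A c d" and len: "2 < \<bar>c - d\<bar>" "\<bar>c - d\<bar> \<le> 2 * n" and B: "crossing_free (flip p q c d)"
  obtains k i j z where "cstar p i j q z"
      "c = i + k * n \<and> cyc q (d - k * n) z \<or> c = j + k * n \<and> cyc z (d - k * n) p"
  | k i j z where "cstar q i j p z"
      "c = i + k * n \<and> cyc p (d - k * n) z \<or> c = j + k * n \<and> cyc z (d - k * n) q"
proof -
  have "c \<noteq> d" using len by auto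
  then obtain i j q' z where s: "cstar c i j q' z" and dc: "cyc j d q'"
    using cone_exists[OF nA _ len(2,1)] by blast
  have "orb p q i q' \<or> orb p q j z"
  proof (rule ccontr)
    assume "\<not> (orb p q i q' \<or> orb p q j z)"
    moreover have "A i q'" "A j z" using s unfolding cstar_def by auto
    moreover have "chords_cross c d i q'" "chords_cross c d j z" "chords_cross i q' j z"
      using s dc unfolding cstar_def chords_cross_def cyc_def by (smt (verit))+
    ultimately show False using flip_chords[OF B] by blast
  qed
  then obtain k where k: "{i - k * n, q' - k * n} = {p, q} \<or> {j - k * n, z - k * n} = {p, q}"
    unfolding orb_def by (auto simp: doubleton_eq_iff algebra_simps)
  have s': "cstar (c - k * n) (i - k * n) (j - k * n) (q' - k * n) (z - k * n)"
    using cstar_shift[OF s, of "- k"] by simp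
  have dc': "cyc (j - k * n) (d - k * n) (q' - k * n)" using dc cyc_shift[of j "- k * n" d q'] by simp
  note R = cstar_rotate
  have cc: "c = (c - k * n) + k * n" by simp
  from k consider "i - k * n = p" "q' - k * n = q" | "i - k * n = q" "q' - k * n = p"
    | "j - k * n = p" "z - k * n = q" | "j - k * n = q" "z - k * n = p"
    by (auto simp: doubleton_eq_iff)
  then show ?thesis
  proof cases
    case 1
    show ?thesis
      by (rule that(2)[OF R[OF R[OF R[OF s', unfolded 1]]]]) (use dc' cc 1 in auto)
  next
    case 2
    show ?thesis
      by (rule that(1)[OF R[OF R[OF R[OF s', unfolded 2]]]]) (use dc' cc 2 in auto)
  next
    case 3
    show ?thesis
      by (rule that(2)[OF R[OF R[OF R[OF R[OF s', unfolded 3]]]]]) (use dc' cc 3 in auto)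
  next
    case 4
    show ?thesis
      by (rule that(1)[OF R[OF R[OF R[OF R[OF s', unfolded 4]]]]]) (use dc' cc 4 in auto)
  qed
qed

end

section \<open>The degenerate exchanges: interaction of translates\<close>

context cover_graph
begin

lemma orb_shift: "orb p q (x + k * n) (y + k * n) = orb p q x y"
proof
  assume "orb p q (x + k * n) (y + k * n)"
  then obtain l where "{x + k * n, y + k * n} = {p + l * n, q + l * n}" unfolding orb_def by blast
  then have "{x, y} = {p + (l - k) * n, q + (l - k) * n}" by (auto simp: doubleton_eq_iff algebra_simps)
  then show "orb p q x y" unfolding orb_def by blast
next
  assume "orb p q x y"
  then obtain l where "{x, y} = {p + l * n, q + l * n}" unfolding orb_def by blast
  then have "{x + k * n, y + k * n} = {p + (l + k) * n, q + (l + k) * n}" by (auto simp: doubleton_eq_iff algebra_simps)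
  then show "orb p q (x + k * n) (y + k * n)" unfolding orb_def by blast
qed

lemma orb_commute: "orb p q x y = orb p q y x"
  unfolding orb_def by (simp add: insert_commute)

text \<open>Keeps the product \<open>k * n\<close> out of linear arithmetic: for lengths up to
  \<open>2 * n\<close>, the multiples \<open>- n\<close>, \<open>0\<close> and \<open>n\<close> are
  singled out and the others are merely large.\<close>

lemma multiple_cases:
  fixes k :: int
  obtains "k * n = 0" | "k * n = n" | "k * n = - n" | "2 * n \<le> k * n" | "k * n \<le> - 2 * n"
proof -
  consider "k = 0" | "k = 1" | "k = -1" | "2 \<le> k" | "k \<le> -2" by linarith
  then show ?thesis
  proof cases
    case 4
    then show ?thesis using mult_right_mono[OF 4, of n] n_pos that(4) by simp
  next
    case 5
    then show ?thesis using mult_right_mono[OF 5, of n] n_pos that(5) by simp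
  qed (use that in auto)
qed

text \<open>Up to translation, a 3-crossing after the exchange contains one new edge
  (\<open>one\<close>) or two consecutive new ones (\<open>two\<close>). Three are impossible: by
  \<open>k1\<close> their indices would pairwise differ by exactly 1.\<close>

lemma flip_crossing_freeI:
  assumes ab: "a < b" "b - a \<le> 2 * n"
    and one: "\<And>u v s t. A u v \<Longrightarrow> \<not> orb p q u v \<Longrightarrow> A s t \<Longrightarrow> \<not> orb p q s t \<Longrightarrow> u < s \<Longrightarrow> s < v \<Longrightarrow> v < t \<Longrightarrow>
      u < a \<and> a < v \<and> v < b \<or> a < u \<and> u < b \<and> b < v \<Longrightarrow> s < a \<and> a < t \<and> t < b \<or> a < s \<and> s < b \<and> b < t \<Longrightarrow> False"
    and two: "\<And>u v. A u v \<Longrightarrow> \<not> orb p q u v \<Longrightarrow> a + n < b \<Longrightarrow>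
      u < a \<and> a < v \<and> v < b \<or> a < u \<and> u < b \<and> b < v \<Longrightarrow>
      u < a + n \<and> a + n < v \<and> v < b + n \<or> a + n < u \<and> u < b + n \<and> b + n < v \<Longrightarrow> False"
  shows "crossing_free (flip p q a b)"
proof
  let ?c = "\<lambda>u v s t. u < s \<and> s < v \<and> v < t \<or> s < u \<and> u < t \<and> t < v"
  show "flip p q a b v u" if "flip p q a b u v" for u v
    using that sym unfolding flip_def orb_def by (auto simp: insert_commute)
  have cl: "(A u v \<and> \<not> orb p q u v) \<or> (\<exists>k. u = a + k * n \<and> v = b + k * n)" if "flip p q a b u v" "u < v" for u v
    using that ab unfolding flip_def orb_def by (auto simp: doubleton_eq_iff)
  have k1: "k - l = 1 \<or> l - k = 1" if "?c (a + k * n) (b + k * n) (a + l * n) (b + l * n)" for k l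
  proof -
    have *: "(k - l) * n = k * n - l * n" by (simp add: algebra_simps)
    have "n = 1 * n" by simp
    show ?thesis using multiple_cases[of "k - l"] that ab n_pos *
      by (smt (verit) mult_cancel_right1 mult_minus_left)
  qed
  have one': False if g: "A u v" "\<not> orb p q u v" and h: "A s t" "\<not> orb p q s t" and o: "u < s" "s < v" "v < t"
    and c: "?c (a + k * n) (b + k * n) u v" "?c (a + k * n) (b + k * n) s t" for u v s t k
  proof -
    have A: "A (u - k * n) (v - k * n)" "A (s - k * n) (t - k * n)"
      "\<not> orb p q (u - k * n) (v - k * n)" "\<not> orb p q (s - k * n) (t - k * n)"
      using shift[OF g(1), of "- k"] shift[OF h(1), of "- k"] orb_shift[of p q _ "- k"] g h by auto
    show False by (rule one[OF A(1,3) A(2,4)]) (use o c in linarith)+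
  qed
  have two': False if g: "A u v" "\<not> orb p q u v" 
    and c: "?c (a + k * n) (b + k * n) u v" "?c (a + l * n) (b + l * n) u v" "?c (a + k * n) (b + k * n) (a + l * n) (b + l * n)"
    and l: "l = k + 1" for u v k l
  proof -
    have A: "A (u - k * n) (v - k * n)" "\<not> orb p q (u - k * n) (v - k * n)"
      using shift[OF g(1), of "- k"] orb_shift[of p q _ "- k"] g by auto
    have l': "l * n = k * n + n" using l by (simp add: algebra_simps)
    show False by (rule two[OF A]) (use c n_pos in \<open>unfold l'; linarith\<close>)+
  qed
  have two'': False if g: "A u v" "\<not> orb p q u v" 
    and c: "?c (a + k * n) (b + k * n) u v" "?c (a + l * n) (b + l * n) u v" "?c (a + k * n) (b + k * n) (a + l * n) (b + l * n)"
    for u v k l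
    using two'[OF g c] two'[OF g c(2,1)] c(3) k1[OF c(3)] by (smt (verit))
  show False if H: "flip p q a b u v" "flip p q a b c d" "flip p q a b e f"
    and o: "u < c" "c < e" "e < v" "v < d" "d < f" for u v c d e f
  proof -
    have o': "u < v" "c < d" "e < f" "?c u v c d" "?c u v e f" "?c c d e f" "?c c d u v" "?c e f u v" "?c e f c d"
      "c < v" "e < d" using o by auto
    from cl[OF H(1) o'(1)] show False
    proof (elim disjE conjE exE)
      assume g: "A u v" "\<not> orb p q u v"
      from cl[OF H(2) o'(2)] show False
      proof (elim disjE conjE exE)
        assume h: "A c d" "\<not> orb p q c d"
        from cl[OF H(3) o'(3)] show False
        proof (elim disjE conjE exE)
          assume "A e f" then show False using no_crossing[OF g(1) h(1) _ o] by blast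
        next
          fix k assume k: "e = a + k * n" "f = b + k * n"
          show False by (rule one'[OF g h o(1) o'(10) o(4), of k]) (use o'(8,9) in \<open>simp_all only: k\<close>)
        qed
      next
        fix k assume k: "c = a + k * n" "d = b + k * n"
        from cl[OF H(3) o'(3)] show False
        proof (elim disjE conjE exE)
          assume h: "A e f" "\<not> orb p q e f"
          have "u < e" "v < f" using o by auto
          show False by (rule one'[OF g h \<open>u < e\<close> o(3) \<open>v < f\<close>, of k]) (use o'(6,7) in \<open>simp_all only: k\<close>)
        next
          fix l assume l: "e = a + l * n" "f = b + l * n"
          show False by (rule two''[OF g, of k l]) (use o'(6-9) in \<open>simp_all only: k l\<close>)
        qed
      qed
    next
      fix k assume k: "u = a + k * n" "v = b + k * n"
      from cl[OF H(2) o'(2)] show False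
      proof (elim disjE conjE exE)
        assume g: "A c d" "\<not> orb p q c d"
        from cl[OF H(3) o'(3)] show False
        proof (elim disjE conjE exE)
          assume h: "A e f" "\<not> orb p q e f"
          show False by (rule one'[OF g h o(2) o'(11) o(5), of k]) (use o'(4,5) in \<open>simp_all only: k\<close>)
        next
          fix l assume l: "e = a + l * n" "f = b + l * n"
          show False by (rule two''[OF g, of k l]) (use o'(4,5,6,9) in \<open>simp_all only: k l\<close>)
        qed
      next
        fix l assume l: "c = a + l * n" "d = b + l * n"
        from cl[OF H(3) o'(3)] show False
        proof (elim disjE conjE exE)
          assume h: "A e f" "\<not> orb p q e f"
          show False by (rule two''[OF h, of k l]) (use o'(4-6) in \<open>simp_all only: k l\<close>)
        next
          fix m assume m: "e = a + m * n" "f = b + m * n"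
          have "k - l = 1 \<or> l - k = 1" "k - m = 1 \<or> m - k = 1" "l - m = 1 \<or> m - l = 1"
            using k1[of k l] k1[of k m] k1[of l m] o'(4-6) unfolding k l m by blast+
          then show False by linarith
        qed
      qed
    qed
  qed
qed

lemma star_shift_up: "star s0 s1 s2 s3 s4 \<Longrightarrow> star (s0 + n) (s1 + n) (s2 + n) (s3 + n) (s4 + n)"
  unfolding star_def using shift_up by auto

text \<open>The five pairs listed are all the pairs of crossing edges of the pentagram.\<close>

lemma edge_vs_star:
  assumes "star s0 s1 s2 s3 s4" "A u v"
  defines "X \<equiv> \<lambda>a b. u < a \<and> a < v \<and> v < b \<or> a < u \<and> u < b \<and> b < v"
  shows "\<not> (X s0 s2 \<and> X s1 s3)" "\<not> (X s0 s2 \<and> X s1 s4)" "\<not> (X s0 s3 \<and> X s1 s4)"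
    "\<not> (X s0 s3 \<and> X s2 s4)" "\<not> (X s1 s3 \<and> X s2 s4)"
proof -
  have e: "A s0 s2" "A s0 s3" "A s1 s3" "A s1 s4" "A s2 s4" and o: "s0 < s1" "s1 < s2" "s2 < s3" "s3 < s4"
    using assms(1) unfolding star_def by auto
  note cc = no_crossing'[OF assms(2)]
  show "\<not> (X s0 s2 \<and> X s1 s3)"
    using cc[OF e(1) e(3)] o unfolding X_def by (smt (verit))
  show "\<not> (X s0 s2 \<and> X s1 s4)"
    using cc[OF e(1) e(4)] o unfolding X_def by (smt (verit))
  show "\<not> (X s0 s3 \<and> X s1 s4)"
    using cc[OF e(2) e(4)] o unfolding X_def by (smt (verit))
  show "\<not> (X s0 s3 \<and> X s2 s4)"
    using cc[OF e(2) e(5)] o unfolding X_def by (smt (verit))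
  show "\<not> (X s1 s3 \<and> X s2 s4)"
    using cc[OF e(3) e(5)] o unfolding X_def by (smt (verit))
qed

text \<open>The degenerate case where the star above \<open>[b + n, s2 + n]\<close> is the translate by \<open>n\<close> of the star below it.\<close>

lemma self_flip_crossing_free:
  assumes S: "star b (b + n) s2 s3 (s2 + n)"
  shows "crossing_free (flip b s2 (s2 - n) s3)"
proof (rule flip_crossing_freeI)
  have o: "b + n < s2" "s2 < s3" "s3 < s2 + n" "A b s3" using S unfolding star_def by auto
  have l: "s3 \<le> b + 2 * n" using length_le[OF o(4)] by linarith
  show "s2 - n < s3" "s3 - (s2 - n) \<le> 2 * n" using o n_pos by linarith+
  have L: "cstar (b + n) s2 s3 (s2 + n) b" using cstar_rotate[OF star_cstar[OF S]] .
  have U: "cstar (s2 + n) (s3 + n) (s2 + n + n) (b + n) (b + n + n)"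
    using cstar_rotate[OF cstar_rotate[OF star_cstar[OF star_shift_up[OF S]]]] .
  \<comment> \<open>The new edge appears as its translate [s2, s3 + n], the common bisector of the
    star and its translate by \<open>n\<close>. Exchanging [b + n, s2 + n] alone suffices for
    3-crossings with one new edge.\<close>
  have f: "flip_target (b + n) s2 s3 (s2 + n) b (s3 + n) (s2 + n + n) (b + n + n) s2 (s3 + n)"
    unfolding flip_target_def cyc_def using o l n_pos by auto
  interpret F: crossing_free "\<lambda>u v. A u v \<and> {u, v} \<noteq> {b + n, s2 + n} \<or> {u, v} = {s2, s3 + n}"
    by (rule single_flip_crossing_free[OF L U f])
  show False if g: "A u v" "\<not> orb b s2 u v" and h: "A s t" "\<not> orb b s2 s t" and x: "u < s" "s < v" "v < t"
    and y: "u < s2 - n \<and> s2 - n < v \<and> v < s3 \<or> s2 - n < u \<and> u < s3 \<and> s3 < v"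
    "s < s2 - n \<and> s2 - n < t \<and> t < s3 \<or> s2 - n < s \<and> s < s3 \<and> s3 < t" for u v s t
  proof -
    have "\<not> orb b s2 (u + 1 * n) (v + 1 * n)" "\<not> orb b s2 (s + 1 * n) (t + 1 * n)"
      using g(2) h(2) orb_shift by blast+
    then have "{u + n, v + n} \<noteq> {b + n, s2 + n}" "{s + n, t + n} \<noteq> {b + n, s2 + n}"
      unfolding orb_def by (metis mult_1)+
    then have "A (u + n) (v + n) \<and> {u + n, v + n} \<noteq> {b + n, s2 + n} \<or> {u + n, v + n} = {s2, s3 + n}"
      "A (s + n) (t + n) \<and> {s + n, t + n} \<noteq> {b + n, s2 + n} \<or> {s + n, t + n} = {s2, s3 + n}"
      using shift_up g(1) h(1) by blast+
    note w = F.no_crossing'[OF this, of s2 "s3 + n"]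
    show False by (rule w) (use x y in auto)
  qed
  show False if g: "A u v" "\<not> orb b s2 u v" and x: "s2 - n + n < s3"
    and y: "u < s2 - n \<and> s2 - n < v \<and> v < s3 \<or> s2 - n < u \<and> u < s3 \<and> s3 < v"
    "u < s2 - n + n \<and> s2 - n + n < v \<and> v < s3 + n \<or> s2 - n + n < u \<and> u < s3 + n \<and> s3 + n < v" for u v
  proof -
    have "{u, v} \<noteq> {b + 1 * n, s2 + 1 * n}" using g(2) unfolding orb_def by blast
    then have ne: "u \<noteq> b + n \<or> v \<noteq> s2 + n" by auto
    show False
      using edge_vs_star[OF S g(1)] edge_vs_star[OF star_shift_up[OF S] g(1)] ne y o l n_pos
      by (smt (verit))
  qed
qed

end

context cover_graph
begin

text \<open>For \<open>p < c\<close>, an edge [c, d] reaching further would cross both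
  [p, p + 2 * n] and its translate by \<open>- n\<close>; for \<open>c = p\<close> it would be too
  long.\<close>

lemma central_contain:
  assumes p: "A p (p + 2 * n)" and g: "A c d" "p \<le> c" "c < p + n"
  shows "d \<le> p + 2 * n"
proof (rule ccontr)
  assume "\<not> d \<le> p + 2 * n"
  then show False
    using no_crossing'[OF g(1) p shift_down[OF p]] length_le[OF g(1)] g(2,3) n_pos by (smt (verit))
qed

text \<open>Removing the translates of [p, p + 2 * n] makes \<open>m\<close> uncrossed
  (\<open>II\<close>), so that [m, m + 2 * n] can take over. By \<open>RI\<close> a remaining edge
  over \<open>m\<close> lies between \<open>s1\<close> and \<open>p + 2 * n\<close> or encloses
  [s1, s4]; \<open>RII\<close> and \<open>RIII\<close> are consequences for \<open>m + 2 * n\<close>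
  and \<open>m + 3 * n\<close>.\<close>

lemma central_flip_crossing_free:
  assumes S: "star p s1 m (p + 2 * n) s4"
  shows "crossing_free (flip p (p + 2 * n) m (m + 2 * n))"
proof (rule flip_crossing_freeI)
  have o: "p < s1" "s1 < m" "m < p + 2 * n" "p + 2 * n < s4" and e: "A p m" "A p (p + 2 * n)" "A s1 s4"
    using S unfolding star_def by auto
  have up: "A (p + n) (p + n + 2 * n)" "A (p + n + n) (p + n + n + 2 * n)" "A (p - n) (p - n + 2 * n)"
    using shift_up[OF e(2)] shift_up[OF shift_up[OF e(2)]] shift_down[OF e(2)] by (simp_all add: algebra_simps)
  note cont = central_contain[OF e(2)] central_contain[OF up(1)] central_contain[OF up(3)]
  have s1: "p + n \<le> s1" using cont(1)[OF e(3)] o by linarith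
  have s4: "s4 \<le> p + 3 * n" using cont(2)[OF e(3)] s1 o by linarith
  have norb: "u \<noteq> p + k * n \<or> v \<noteq> p + 2 * n + k * n" if "\<not> orb p (p + 2 * n) u v" for u v k
    using that unfolding orb_def by auto
  have RI: "p + n \<le> u \<and> (s1 \<le> u \<and> v \<le> p + 2 * n \<or> u \<le> s1 \<and> s4 \<le> v \<and> v \<le> p + 3 * n)"
    if g: "A u v" "\<not> orb p (p + 2 * n) u v" and x: "u < m" "m < v" for u v
    using edge_vs_star[OF S g(1)] cont(1)[OF g(1)] cont(2)[OF g(1)] cont(3)[OF g(1)] length_le[OF g(1)]
      norb[OF g(2), of 0] x o s1 s4 n_pos by (smt (verit))
  have down: "A (u + k * n) (v + k * n)" "\<not> orb p (p + 2 * n) (u + k * n) (v + k * n)"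
    if "A u v" "\<not> orb p (p + 2 * n) u v" for u v k
    using that shift orb_shift by blast+
  have RII: "p + 3 * n \<le> u" if g: "A u v" "\<not> orb p (p + 2 * n) u v" and x: "u < m + 2 * n" "m + 2 * n < v" for u v
    using RI[OF down[OF g, of "-2"]] x s1 by simp
  have RIII: "p + 4 * n \<le> u" if g: "A u v" "\<not> orb p (p + 2 * n) u v" and x: "u < m + 3 * n" "m + 3 * n < v" for u v
    using RI[OF down[OF g, of "-3"]] x s1 by simp
  have II: False if g: "A u v" "\<not> orb p (p + 2 * n) u v" and h: "A s t" "\<not> orb p (p + 2 * n) s t"
    and x: "u < s" "s < m" "m < v" "v < t" for u v s t
    using RI[OF g] RI[OF h] x no_crossing'[OF e(1) g(1) h(1)] no_crossing'[OF e(2) g(1) h(1)] o s1 n_pos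
    by (smt (verit))
  show "m < m + 2 * n" "m + 2 * n - m \<le> 2 * n" using n_pos by auto
  show False if g: "A u v" "\<not> orb p (p + 2 * n) u v" and h: "A s t" "\<not> orb p (p + 2 * n) s t"
    and x: "u < s" "s < v" "v < t"
    and y: "u < m \<and> m < v \<and> v < m + 2 * n \<or> m < u \<and> u < m + 2 * n \<and> m + 2 * n < v"
    "s < m \<and> m < t \<and> t < m + 2 * n \<or> m < s \<and> s < m + 2 * n \<and> m + 2 * n < t" for u v s t
    using II[OF g h] II[OF down[OF g, of "-2"] down[OF h, of "-2"]] RI[OF g] RII[OF h] RII[OF g] RI[OF h] x y o n_pos
    by (smt (verit))
  show False if g: "A u v" "\<not> orb p (p + 2 * n) u v" and "m + n < m + 2 * n"
    and y: "u < m \<and> m < v \<and> v < m + 2 * n \<or> m < u \<and> u < m + 2 * n \<and> m + 2 * n < v"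
    "u < m + n \<and> m + n < v \<and> v < m + 2 * n + n \<or> m + n < u \<and> u < m + 2 * n + n \<and> m + 2 * n + n < v" for u v
    using RI[OF g] RII[OF g] RIII[OF g] edge_vs_star[OF star_shift_up[OF S] g(1)] norb[OF g(2), of 1] y o s1 s4 n_pos
    by (smt (verit))
qed

end

context max_cover_graph
begin

text \<open>Both stars at [b, s2] are translates of the given one, so by \<open>flip_ends\<close>
  each end of a replacement is a translate of \<open>s2\<close> or \<open>s3\<close>. An end at
  \<open>s3\<close> forces the target (\<open>main\<close>). Two ends at translates of
  \<open>s2\<close> are not at distance \<open>n\<close>, as [s2, s2 + n] is an edge, so they are at
  distance \<open>2 * n\<close>, which is refuted last.\<close>

lemma self_flip_unique:
  assumes S: "star b (b + n) s2 s3 (s2 + n)"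
    and nA: "\<not> A c d" and len: "2 < \<bar>c - d\<bar>" "\<bar>c - d\<bar> \<le> 2 * n" and B: "crossing_free (flip b s2 c d)"
  shows "orb (s2 - n) s3 c d"
proof -
  note R = cstar_rotate
  have o: "b + n < s2" "s2 < s3" "s3 < s2 + n" and e: "A b s2" "A b s3" "A (b + n) s3" "A s2 (s2 + n)"
    using S unfolding star_def by auto
  have l: "s3 \<le> b + 2 * n" using length_le[OF e(2)] by linarith
  have up: "cstar s2 s3 (s2 + n) b (b + n)" using R[OF R[OF star_cstar[OF S]]] .
  have lo: "cstar b (s2 - n) (s3 - n) s2 (b - n)"
    using cstar_shift[OF R[OF star_cstar[OF S]], of "-1"] by simp
  have ends: "(\<exists>k. c = s3 + k * n \<and> b < d - k * n \<and> d - k * n < b + n) \<or> (\<exists>k. c = s2 + k * n)"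
    if "\<not> A c d" "2 < \<bar>c - d\<bar>" "\<bar>c - d\<bar> \<le> 2 * n" "crossing_free (flip b s2 c d)" for c d
    using that
  proof (cases rule: flip_ends)
    case (1 k i j z)
    from cstar_unique[OF lo 1(1)] have ij: "i = s2 - n" "j = s3 - n" "z = b - n" by auto
    from 1(2) show ?thesis
    proof
      assume "c = i + k * n \<and> cyc s2 (d - k * n) z"
      then have "c = s2 + (k - 1) * n" using ij by (simp add: algebra_simps)
      then show ?thesis by blast
    next
      assume a: "c = j + k * n \<and> cyc z (d - k * n) b"
      then have "b - n < d - k * n \<and> d - k * n < b" unfolding ij cyc_def using n_pos by auto
      then have "c = s3 + (k - 1) * n \<and> b < d - (k - 1) * n \<and> d - (k - 1) * n < b + n"
        using a ij by (auto simp: algebra_simps)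
      then show ?thesis by blast
    qed
  next
    case (2 k i j z)
    from cstar_unique[OF up 2(1)] have ij: "i = s3" "j = s2 + n" "z = b + n" by auto
    from 2(2) show ?thesis
    proof
      assume a: "c = i + k * n \<and> cyc b (d - k * n) z"
      then have "b < d - k * n \<and> d - k * n < b + n" unfolding ij cyc_def using n_pos by auto
      then show ?thesis using a ij by blast
    next
      assume "c = j + k * n \<and> cyc z (d - k * n) s2"
      then have "c = s2 + (k + 1) * n" using ij by (simp add: algebra_simps)
      then show ?thesis by blast
    qed
  qed
  \<comment> \<open>The removed edges have length \<open>s2 - b\<close>, strictly between
    \<open>n\<close> and \<open>2 * n\<close>; lengths alone show that the refuting edges below
    survive.\<close>
  have norb: "\<not> orb b s2 x y" if "\<bar>x - y\<bar> \<noteq> s2 - b" for x y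
    using that o n_pos unfolding orb_def by (auto simp: doubleton_eq_iff)
  have main: "orb (s2 - n) s3 d c" if B: "crossing_free (flip b s2 c d)" and c: "c = s3 + k * n" and
    d: "b < d - k * n" "d - k * n < b + n" for c d k
  proof -
    define D where "D = d - k * n"
    have d: "b < D" "D < b + n" using d unfolding D_def by auto
    have "flip b s2 c d = flip b s2 (c + (- k) * n) (d + (- k) * n)" using flip_shift[of b s2 c "- k" d] by simp
    with B c have B': "crossing_free (flip b s2 s3 D)" unfolding D_def by simp
    have A1: "A (s2 - n) s2" "A (s2 - n - n) (s2 - n)" "A b (s3 - n)" "A (b + n) (s3 + n)"
      using shift_down[OF e(4)] shift_down[OF shift_down[OF e(4)]] shift_down[OF e(3)] shift_up[OF e(2)] by auto
    have no: "\<not> orb b s2 (s2 - n) s2" "\<not> orb b s2 (s2 - n - n) (s2 - n)" "\<not> orb b s2 b (s3 - n)"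
      "\<not> orb b s2 (b + n) (s3 + n)" by (rule norb; use o l n_pos in linarith)+
    consider "D < s2 - n" | "D = s2 - n" | "s2 - n < D" by linarith
    then show ?thesis
    proof cases
      case 1
      have "chords_cross s3 D (s2 - n - n) (s2 - n)" "chords_cross s3 D b (s3 - n)"
          "chords_cross (s2 - n - n) (s2 - n) b (s3 - n)"
          unfolding chords_cross_def cyc_def using 1 d o l n_pos by (smt (verit))+
      from flip_chords[OF B' A1(2) no(2) A1(3) no(3) this] have False .
      then show ?thesis ..
    next
      case 2
      then have "d = s2 - n + k * n" unfolding D_def by simp
      with c show ?thesis unfolding orb_def by blast
    next
      case 3
      have "chords_cross s3 D (s2 - n) s2" "chords_cross s3 D (b + n) (s3 + n)"
          "chords_cross (s2 - n) s2 (b + n) (s3 + n)"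
          unfolding chords_cross_def cyc_def using 3 d o l n_pos by (smt (verit))+
      from flip_chords[OF B' A1(1) no(1) A1(4) no(4) this] have False .
      then show ?thesis ..
    qed
  qed
  have B2: "crossing_free (flip b s2 d c)"
    using B orb_commute unfolding flip_def[abs_def] orb_def by (simp add: insert_commute)
  have nA2: "\<not> A d c" using nA sym by blast
  have len2: "2 < \<bar>d - c\<bar>" "\<bar>d - c\<bar> \<le> 2 * n" using len by auto
  consider (1) k where "c = s3 + k * n" "b < d - k * n" "d - k * n < b + n"
    | (2) k where "d = s3 + k * n" "b < c - k * n" "c - k * n < b + n"
    | (3) k l where "c = s2 + k * n" "d = s2 + l * n"
    using ends[OF nA len B] ends[OF nA2 len2 B2] by blast
  then show ?thesis
  proof cases
    case 1
    then show ?thesis using main[OF B 1] orb_commute by blast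
  next
    case 2
    then show ?thesis using main[OF B2 2] by blast
  next
    case 3
    have nA': "\<not> A (min c d) (max c d)" using nA nA2 by (auto simp: min_def max_def)
    have dif: "(l - k) * n = d - c" using 3 by (simp add: algebra_simps)
    have nn: "l - k \<noteq> 1" "l - k \<noteq> -1"
    proof -
      show "l - k \<noteq> 1"
      proof
        assume "l - k = 1"
        then have "d = c + n" using dif by simp
        then show False using nA shift[OF e(4), of k] 3(1) by (simp add: algebra_simps)
      qed
      show "l - k \<noteq> -1"
      proof
        assume "l - k = -1"
        then have "c = d + n" using dif by (metis add_uminus_conv_diff diff_add_cancel mult_minus1 minus_diff_eq add.commute)
        then show False using nA2 shift[OF e(4), of l] 3(2) by (simp add: algebra_simps)
      qed
    qed
    define x where "x = min c d"
    have "\<bar>d - c\<bar> = 2 * n"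
      using multiple_cases[of "l - k"] dif nn len n_pos
      by (smt (verit) mult_cancel_right1 mult_minus_left)
    then have x: "max c d = x + 2 * n" unfolding x_def by linarith
    have nAx: "\<not> A x (x + 2 * n)" using nA' x unfolding x_def by simp
    \<comment> \<open>As [x, x + 2 * n] is missing, \<open>x\<close> is crossed and lies strictly
      between consecutive uncrossed vertices \<open>a'\<close> and \<open>a' + n\<close>. The edges
      of length \<open>2 * n\<close> starting there cross each other and the chord.\<close>
    obtain a where a: "\<not> crossed a" using exists_uncrossed by blast
    have Aa: "A a (a + 2 * n)" using uncrossed_edge[OF a] .
    have "crossed x" using nAx uncrossed_edge by blast
    then have "\<not> n dvd (x - a)" using crossed_iff[OF a Aa] by blast
    define k' r where "k' = (x - a) div n" and "r = (x - a) mod n"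
    have xm: "x = a + k' * n + r" unfolding k'_def r_def by simp
    have "r \<noteq> 0" using \<open>\<not> n dvd (x - a)\<close> unfolding r_def by (simp add: dvd_eq_mod_eq_0)
    moreover have "0 \<le> r" "r < n" using n_pos unfolding r_def by simp_all
    ultimately have r: "0 < r" "r < n" by simp_all
    define a' where "a' = a + k' * n"
    have E: "A a' (a' + 2 * n)" "A (a' + n) (a' + 3 * n)"
      using shift[OF Aa, of k'] shift[OF Aa, of "k' + 1"] unfolding a'_def by (simp_all add: algebra_simps)
    have no: "\<not> orb b s2 a' (a' + 2 * n)" "\<not> orb b s2 (a' + n) (a' + 3 * n)"
      by (rule norb; use o l in linarith)+
    have Bx: "crossing_free (flip b s2 x (x + 2 * n))"
      using B B2 x unfolding x_def by (auto simp: min_def max_def split: if_splits)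
    have x': "x = a' + r" using xm unfolding a'_def .
    have c: "chords_cross a' (a' + 2 * n) x (x + 2 * n)" "chords_cross x (x + 2 * n) (a' + n) (a' + 3 * n)"
      "chords_cross a' (a' + 2 * n) (a' + n) (a' + 3 * n)"
      by (rule chords_crossI; use x' r in linarith)+
    from flip_chords[OF Bx E(1) no(1) E(2) no(2) chords_cross_commute[OF c(1)] c(2,3)] have False .
    then show ?thesis ..
  qed
qed

text \<open>A star above [p, p + 2 * n] would have an edge longer than \<open>2 * n\<close>, so only
  the star below provides ends, namely translates of \<open>s1\<close> and \<open>m\<close>.
  Comparing the conditions at both ends leaves two translates of \<open>m\<close> at distance
  \<open>2 * n\<close>.\<close>

lemma central_flip_unique:
  assumes S: "star p s1 m (p + 2 * n) s4"
    and nA: "\<not> A c d" and len: "2 < \<bar>c - d\<bar>" "\<bar>c - d\<bar> \<le> 2 * n" and B: "crossing_free (flip p (p + 2 * n) c d)"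
  shows "orb m (m + 2 * n) c d"
proof -
  have o: "p < s1" "s1 < m" "m < p + 2 * n" "p + 2 * n < s4" and e: "A p m" "A p (p + 2 * n)" "A s1 s4"
    using S unfolding star_def by auto
  have up: "A (p + n) (p + n + 2 * n)" using shift_up[OF e(2)] by (simp add: algebra_simps)
  have s1: "p + n \<le> s1" using central_contain[OF e(2,3)] o by linarith
  have s4: "s4 \<le> p + 3 * n" using central_contain[OF up e(3)] s1 o by linarith
  have no_upper: False if "cstar (p + 2 * n) i j p z" for i j z
  proof -
    have "A i p" "A (p + 2 * n) j" "cyc (p + 2 * n) i j" "cyc (p + 2 * n) j p"
      using that unfolding cstar_def by auto
    then show False using length_le[of i p] length_le[of "p + 2 * n" j] unfolding cyc_def by (smt (verit))
  qed
  have ends: "(\<exists>k. c = s1 + k * n \<and> p + 2 * n < d - k * n \<and> d - k * n < s4) \<or>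
      (\<exists>k. c = m + k * n \<and> (d - k * n < p \<or> s4 < d - k * n))"
    if "\<not> A c d" "2 < \<bar>c - d\<bar>" "\<bar>c - d\<bar> \<le> 2 * n" "crossing_free (flip p (p + 2 * n) c d)" for c d
    using that
  proof (cases rule: flip_ends)
    case (1 k i j z)
    from cstar_unique[OF star_cstar[OF S] 1(1)] have ij: "i = s1" "j = m" "z = s4" by auto
    have "cyc (p + 2 * n) x s4 \<Longrightarrow> p + 2 * n < x \<and> x < s4" "cyc s4 x p \<Longrightarrow> x < p \<or> s4 < x" for x
      using o unfolding cyc_def by (smt (verit))+
    with 1(2) show ?thesis unfolding ij by blast
  next
    case (2 k i j z)
    then show ?thesis using no_upper by blast
  qed
  have B2: "crossing_free (flip p (p + 2 * n) d c)"
    using B unfolding flip_def[abs_def] orb_def by (simp add: insert_commute)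
  have nA2: "\<not> A d c" using nA sym by blast
  have len2: "2 < \<bar>d - c\<bar>" "\<bar>d - c\<bar> \<le> 2 * n" using len by auto
  have D: "(k - l) * n = k * n - l * n" "(k - l) * n = 0 \<or> (k - l) * n = n \<or> (k - l) * n = - n \<or>
    2 * n \<le> (k - l) * n \<or> (k - l) * n \<le> - 2 * n" for k l :: int
    using multiple_cases[of "k - l"] by (auto simp: algebra_simps)
  from ends[OF nA len B] ends[OF nA2 len2 B2] show ?thesis
  proof (elim disjE exE conjE)
    fix k l assume "c = s1 + k * n" "p + 2 * n < d - k * n" "d - k * n < s4"
      "d = s1 + l * n" "p + 2 * n < c - l * n" "c - l * n < s4"
    then show ?thesis using o by linarith
  next
    fix k l assume "c = s1 + k * n" "p + 2 * n < d - k * n" "d - k * n < s4"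
      "d = m + l * n" "c - l * n < p"
    then show ?thesis using o s1 s4 D[of l k] by linarith
  next
    fix k l assume "c = s1 + k * n" "p + 2 * n < d - k * n" "d - k * n < s4"
      "d = m + l * n" "s4 < c - l * n"
    then show ?thesis using o s1 s4 D[of l k] n_pos by linarith
  next
    fix k l assume "d = s1 + k * n" "p + 2 * n < c - k * n" "c - k * n < s4"
      "c = m + l * n" "d - l * n < p"
    then show ?thesis using o s1 s4 D[of l k] by linarith
  next
    fix k l assume "d = s1 + k * n" "p + 2 * n < c - k * n" "c - k * n < s4"
      "c = m + l * n" "s4 < d - l * n"
    then show ?thesis using o s1 s4 D[of l k] n_pos by linarith
  next
    fix k l assume "c = m + k * n" "d - k * n < p" "d = m + l * n" "c - l * n < p"
    then show ?thesis using o by linarith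
  next
    fix k l assume "c = m + k * n" "s4 < d - k * n" "d = m + l * n" "s4 < c - l * n"
    then show ?thesis using o by linarith
  next
    fix k l assume H: "c = m + k * n" "d - k * n < p" "d = m + l * n" "s4 < c - l * n"
    then have "c = d + 2 * n" using o s1 s4 D[of k l] len n_pos by linarith
    then show ?thesis using H(3) unfolding orb_def by (intro exI[of _ l]) auto
  next
    fix k l assume H: "c = m + k * n" "s4 < d - k * n" "d = m + l * n" "c - l * n < p"
    then have "d = c + 2 * n" using o s1 s4 D[of k l] len n_pos by linarith
    then show ?thesis using H(1) unfolding orb_def by (intro exI[of _ k]) auto
  qed
qed

end

section \<open>Reflection, and the unique replacement of every relevant edge\<close>

lemma crossing_free_mirror:
  assumes "crossing_free F"
  shows "crossing_free (\<lambda>x y. F (- x) (- y))"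
proof
  show "F (- y) (- x)" if "F (- x) (- y)" for x y using crossing_free.sym[OF assms that] .
  show False if "F (- a) (- b)" "F (- c) (- d)" "F (- e) (- f)" "a < c" "c < e" "e < b" "b < d" "d < f"
    for a b c d e f
    by (rule crossing_free.no_crossing[OF assms crossing_free.sym[OF assms that(3)]
          crossing_free.sym[OF assms that(2)] crossing_free.sym[OF assms that(1)]]) (use that in auto)
qed

context cover_graph
begin

text \<open>Existence asks only for length at least 2 and a crossing-free result; relevance of the
  new edge and maximality are deduced later. Uniqueness is up to translation.\<close>

definition unique_flip :: "int \<Rightarrow> int \<Rightarrow> bool" where
  "unique_flip p q \<longleftrightarrow> (\<exists>a b. 2 \<le> \<bar>a - b\<bar> \<and> \<not> A a b \<and> crossing_free (flip p q a b) \<and>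
     (\<forall>c d. \<not> A c d \<longrightarrow> 2 < \<bar>c - d\<bar> \<longrightarrow> \<bar>c - d\<bar> \<le> 2 * n \<longrightarrow> crossing_free (flip p q c d) \<longrightarrow> orb a b c d))"

lemma orb_mirror: "orb (- p) (- q) (- x) (- y) = orb p q x y"
proof -
  have "{- x, - y} = {- p + k * n, - q + k * n} \<longleftrightarrow> {x, y} = {p + (- k) * n, q + (- k) * n}" for k
    by (auto simp: doubleton_eq_iff)
  then show ?thesis unfolding orb_def by (metis minus_minus)
qed

lemma unique_flip_commute: "unique_flip p q = unique_flip q p"
proof -
  have "flip p q = flip q p"
    unfolding flip_def[abs_def] orb_def by (simp add: insert_commute)
  then show ?thesis unfolding unique_flip_def by simp
qed

lemma unique_flip_shift: "unique_flip (p + k * n) (q + k * n) = unique_flip p q"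
proof -
  have "orb (p + k * n) (q + k * n) x y = orb p q x y" for x y
    using orb_shift[of p q "x - k * n" k "y - k * n"] orb_shift[of "p + k * n" "q + k * n" x "- k" y]
    unfolding orb_def 
  proof -
    have "{x, y} = {p + k * n + l * n, q + k * n + l * n} \<longleftrightarrow> {x, y} = {p + (l + k) * n, q + (l + k) * n}" for l
      by (simp add: algebra_simps)
    then show "(\<exists>l. {x, y} = {p + k * n + l * n, q + k * n + l * n}) = (\<exists>l. {x, y} = {p + l * n, q + l * n})"
      by (metis diff_add_cancel)
  qed
  then show ?thesis unfolding unique_flip_def flip_def by simp
qed

text \<open>[p, m] and [s1, q] share an end with [p, q] and are shorter. If [s1, s4] were a
  translate, it would be the one by \<open>n\<close>, and [p, q], [p + n, m + n], [m, s4] would form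
  a 3-crossing. Only [m, s4] remains, which is the self-adjacent case.\<close>

lemma lower_generic:
  assumes S: "star p s1 m q s4"
  shows "\<not> orb p q p m" "\<not> orb p q s1 q" "\<not> orb p q s1 s4" "orb p q m s4 \<Longrightarrow> m = p + n \<and> s4 = q + n"
proof -
  have o: "p < s1" "s1 < m" "m < q" "q < s4" and e: "A p m" "A p q" "A s1 q" "A s1 s4" "A m s4"
    using S unfolding star_def by auto
  have t: "\<exists>t. x = p + t \<and> y = q + t \<and> (t = 0 \<or> t = n \<or> t = - n \<or> 2 * n \<le> t \<or> t \<le> - 2 * n)"
    if "orb p q x y" "x < y" for x y
  proof -
    from that(1) obtain k where "{x, y} = {p + k * n, q + k * n}" unfolding orb_def by blast
    then have "x = p + k * n" "y = q + k * n" using that(2) o by (auto simp: doubleton_eq_iff)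
    then show ?thesis using multiple_cases[of k] by blast
  qed
  show "\<not> orb p q p m" "\<not> orb p q s1 q"
    using t o by force+
  have l: "q \<le> p + 2 * n" using length_le[OF e(2)] o by linarith
  show "\<not> orb p q s1 s4"
  proof
    assume "orb p q s1 s4"
    from t[OF this] show False
      using no_crossing[OF e(2) shift_up[OF e(1)] e(5)] o l n_pos by (smt (verit))
  qed
  show "m = p + n \<and> s4 = q + n" if "orb p q m s4"
    using t[OF that] o l n_pos by (smt (verit))
qed

text \<open>If another edge of the upper star were a translate of [p, q], shifting back would give a
  star at [p, q] again, which by \<open>cstar_unique\<close> is the upper or the lower one. In the
  first case a translation would rotate the five vertices of the star, hence be trivial; in the
  second an edge at \<open>z\<close> is a translate of [p, q], against \<open>gen\<close>.\<close>

lemma upper_generic: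
  assumes L: "cstar p i1 i2 q z" and U: "cstar q o1 o2 p y"
    and gen: "\<not> orb p q i1 z" "\<not> orb p q i2 z"
  shows "\<not> orb p q q o2" "\<not> orb p q o1 p" "\<not> orb p q o1 y" "\<not> orb p q o2 y"
proof -
  note R = cstar_rotate
  have d: "p \<noteq> q" "o1 \<noteq> q" "o2 \<noteq> p" using U unfolding cstar_def cyc_def by auto
  note r1 = R[OF U] note r2 = R[OF r1] note r3 = R[OF r2] note r4 = R[OF r3]
  have ob: "\<exists>k. (x = p + k * n \<and> y = q + k * n) \<or> (x = q + k * n \<and> y = p + k * n)" if "orb p q x y" for x y
    using that unfolding orb_def by (auto simp: doubleton_eq_iff)
  have g: "orb p q x y \<Longrightarrow> x \<noteq> i1 \<or> y \<noteq> z" "orb p q x y \<Longrightarrow> x \<noteq> i2 \<or> y \<noteq> z" for x y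
    using gen by auto
  have o: "orb p q (p - k * n) (q - k * n)" "orb p q (q - k * n) (p - k * n)" for k
    using orb_shift[of p q p "- k" q] orb_shift[of p q q "- k" p] orb_self orb_commute by auto
  show "\<not> orb p q q o2"
  proof
    assume "orb p q q o2"
    from ob[OF this] obtain k where "(q = p + k * n \<and> o2 = q + k * n) \<or> (q = q + k * n \<and> o2 = p + k * n)" by blast
    then show False
    proof
      assume a: "q = p + k * n \<and> o2 = q + k * n"
      have "cstar (o2 - k * n) (p - k * n) (y - k * n) (q - k * n) (o1 - k * n)" using cstar_shift[OF r2, of "- k"] by simp
      moreover have "o2 - k * n = q" "q - k * n = p" using a by auto
      ultimately have "cstar q (p - k * n) (y - k * n) p (o1 - k * n)" by (simp only:)
      from cstar_unique[OF U this] show False using a d by auto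
    next
      assume "q = q + k * n \<and> o2 = p + k * n"
      then show False using d by auto
    qed
  qed
  show "\<not> orb p q o1 p"
  proof
    assume "orb p q o1 p"
    from ob[OF this] obtain k where "(o1 = p + k * n \<and> p = q + k * n) \<or> (o1 = q + k * n \<and> p = p + k * n)" by blast
    then show False
    proof
      assume a: "o1 = p + k * n \<and> p = q + k * n"
      have "cstar (p - k * n) (y - k * n) (q - k * n) (o1 - k * n) (o2 - k * n)" using cstar_shift[OF r3, of "- k"] by simp
      moreover have "p - k * n = q" "o1 - k * n = p" using a by auto
      ultimately have "cstar q (y - k * n) (q - k * n) p (o2 - k * n)" by (simp only:)
      from cstar_unique[OF U this] show False using a d by auto
    next
      assume "o1 = q + k * n \<and> p = p + k * n"
      then show False using d by auto
    qed
  qed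
  show "\<not> orb p q o1 y"
  proof
    assume "orb p q o1 y"
    from ob[OF this] obtain k where "(o1 = p + k * n \<and> y = q + k * n) \<or> (o1 = q + k * n \<and> y = p + k * n)" by blast
    then show False
    proof
      assume a: "o1 = p + k * n \<and> y = q + k * n"
      have "cstar (o1 - k * n) (o2 - k * n) (p - k * n) (y - k * n) (q - k * n)" using cstar_shift[OF r1, of "- k"] by simp
      moreover have "o1 - k * n = p" "y - k * n = q" using a by auto
      ultimately have "cstar p (o2 - k * n) (p - k * n) q (q - k * n)" by (simp only:)
      from cstar_unique[OF L this] show False using g(2)[OF o(1)[of k]] by auto
    next
      assume a: "o1 = q + k * n \<and> y = p + k * n"
      have "cstar (o1 - k * n) (o2 - k * n) (p - k * n) (y - k * n) (q - k * n)" using cstar_shift[OF r1, of "- k"] by simp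
      moreover have "o1 - k * n = q" "y - k * n = p" using a by auto
      ultimately have "cstar q (o2 - k * n) (p - k * n) p (q - k * n)" by (simp only:)
      from cstar_unique[OF U this] show False using a d by auto
    qed
  qed
  show "\<not> orb p q o2 y"
  proof
    assume "orb p q o2 y"
    from ob[OF this] obtain k where "(y = p + k * n \<and> o2 = q + k * n) \<or> (y = q + k * n \<and> o2 = p + k * n)" by blast
    then show False
    proof
      assume a: "y = p + k * n \<and> o2 = q + k * n"
      have "cstar (y - k * n) (q - k * n) (o1 - k * n) (o2 - k * n) (p - k * n)" using cstar_shift[OF r4, of "- k"] by simp
      moreover have "y - k * n = p" "o2 - k * n = q" using a by auto
      ultimately have "cstar p (q - k * n) (o1 - k * n) q (p - k * n)" by (simp only:)
      from cstar_unique[OF L this] show False using g(1)[OF o(2)[of k]] by auto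
    next
      assume a: "y = q + k * n \<and> o2 = p + k * n"
      have "cstar (y - k * n) (q - k * n) (o1 - k * n) (o2 - k * n) (p - k * n)" using cstar_shift[OF r4, of "- k"] by simp
      moreover have "y - k * n = q" "o2 - k * n = p" using a by auto
      ultimately have "cstar q (q - k * n) (o1 - k * n) p (p - k * n)" by (simp only:)
      from cstar_unique[OF U this] show False using a d by auto
    qed
  qed
qed

end

context max_cover_graph
begin

lemma generic_unique_flip:
  assumes L: "cstar p i1 i2 q z" and U: "cstar q o1 o2 p y"
    and gL: "\<not> orb p q p i2" "\<not> orb p q i1 q" "\<not> orb p q i1 z" "\<not> orb p q i2 z"
  shows "unique_flip p q"
proof -
  note gen = gL upper_generic[OF L U gL(3,4)]
  obtain a b where f: "flip_target p i1 i2 q z o1 o2 y a b"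
    using flip_cases[OF L U] unfolding flip_target_def by blast
  have pq: "p \<noteq> q" using L unfolding cstar_def cyc_def by auto
  have "orb a b c d" if nA: "\<not> A c d" and len: "2 < \<bar>c - d\<bar>" "\<bar>c - d\<bar> \<le> 2 * n"
    and B: "crossing_free (flip p q c d)" for c d
  proof -
    have fin: "orb a b c d" if e: "c - k * n = i1 \<and> cyc q (d - k * n) z \<or> c - k * n = i2 \<and> cyc z (d - k * n) p \<or>
      c - k * n = o1 \<and> cyc p (d - k * n) y \<or> c - k * n = o2 \<and> cyc y (d - k * n) q" for k
    proof -
      have "flip p q (c - k * n) (d - k * n) = flip p q c d" using flip_shift[of p q c "- k" d] by simp
      with B have "crossing_free (flip p q (c - k * n) (d - k * n))" by simp
      from flip_unique_end[OF L U f gen this e]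
      have "{c, d} = {a + k * n, b + k * n}" by auto
      then show ?thesis unfolding orb_def by blast
    qed
    from nA len B show ?thesis
    proof (cases rule: flip_ends)
      case (1 k i j z')
      from cstar_unique[OF L 1(1)] 1(2) show ?thesis using fin[of k] by auto
    next
      case (2 k i j z')
      from cstar_unique[OF U 2(1)] 2(2) show ?thesis using fin[of k] by auto
    qed
  qed
  moreover have "2 \<le> \<bar>a - b\<bar>"
  proof -
    have "cyc p i1 q" "cyc p i2 q" "cyc q o1 p" "cyc q o2 p"
      using L U unfolding cstar_def cyc_def by (smt (verit))+
    then have "cyc p a q" "cyc q b p" using f unfolding flip_target_def by blast+
    then show ?thesis unfolding cyc_def by (smt (verit))
  qed
  ultimately show ?thesis unfolding unique_flip_def
    using flip_target_nonedge[OF L U f] flip_crossing_free[OF L U f pq gen] by blast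
qed

lemma unique_flip_lower0:
  assumes S: "star p s1 m q s4" and ns: "q = p + 2 * n \<or> \<not> orb p q m s4"
  shows "unique_flip p q"
proof -
  have o: "p < s1" "s1 < m" "m < q" "q < s4" and e: "A p q" "A s1 s4" using S unfolding star_def by auto
  show ?thesis
  proof (cases "q = p + 2 * n")
    case True
    note S' = S[unfolded True]
    have "\<not> A m (m + 2 * n)"
      by (rule notI, rule cstar_cone[OF cstar_rotate[OF cstar_rotate[OF star_cstar[OF S]]], of "m + 2 * n"])
        (use o length_le[OF e(2)] in \<open>auto simp: cyc_def\<close>)
    moreover have "2 \<le> \<bar>m - (m + 2 * n)\<bar>" using n_pos by simp
    ultimately show ?thesis unfolding unique_flip_def True
      using central_flip_crossing_free[OF S'] central_flip_unique[OF S'] by blast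
  next
    case False
    with upper_cstar[OF e(1)] o obtain o1 o2 y where U: "cstar q o1 o2 p y" by auto
    show ?thesis
      using generic_unique_flip[OF star_cstar[OF S] U] lower_generic(1-3)[OF S] ns False by blast
  qed
qed

lemma unique_flip_self:
  assumes S: "star b (b + n) s2 s3 (s2 + n)"
  shows "unique_flip (b + n) (s2 + n)"
proof -
  have o: "b + n < s2" "s2 < s3" "s3 < s2 + n" using S unfolding star_def by auto
  have "A b s3" using S unfolding star_def by blast
  from length_le[OF this] o have l: "s3 \<le> b + 2 * n" by linarith
  have "\<not> A (s2 - n) s3"
  proof
    assume "A (s2 - n) s3"
    from cstar_cone[OF cstar_rotate[OF cstar_rotate[OF cstar_rotate[OF star_cstar[OF S]]]] sym[OF this]]
    show False using o l unfolding cyc_def by auto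
  qed
  moreover have "2 \<le> \<bar>s2 - n - s3\<bar>" using o by linarith
  ultimately have "unique_flip b s2" unfolding unique_flip_def
    using self_flip_crossing_free[OF S] self_flip_unique[OF S] by blast
  then show ?thesis using unique_flip_shift[of b 1 s2] by simp
qed

text \<open>Reflection exchanges left and right blocking. It sends a pair of consecutive translates
  to [x, y] and [x - n, y - n], which explains the additional shift by \<open>n\<close> in the last
  three cases.\<close>

lemma mirror_max_cover_graph: "max_cover_graph (\<lambda>x y. A (- x) (- y)) n"
proof -
  interpret C: crossing_free "\<lambda>x y. A (- x) (- y)"
    by (rule crossing_free_mirror[OF crossing_free_axioms])
  show ?thesis
  proof (unfold_locales, goal_cases)
    case 1 show ?case by (rule n_pos)
  next
    case (2 x y) then show ?case using shift_down[of "- x" "- y"] by simp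
  next
    case (3 x y) then show ?case using shift_up[of "- x" "- y"] by (simp add: algebra_simps)
  next
    case (4 x y) then show ?case using length_ge[of "- x" "- y"] by simp
  next
    case (5 x y) then show ?case using length_le[of "- x" "- y"] by simp
  next
    case (6 x) then show ?case using sym[OF short[of "- x - 2"]] by (simp add: algebra_simps)
  next
    case (7 x y)
    have nA: "\<not> A (- y) (- x)" using 7(1) sym by blast
    have l: "2 \<le> - x - - y" "- x - - y \<le> 2 * n" using 7 by auto
    have m: "A (- (- u)) (- (- v))" "A (- (- v)) (- (- u))" if "A u v" for u v using that sym by auto
    from nA l show ?case
    proof (cases rule: blocked_cases)
      case (R a b c d)
      show ?thesis using R m(2)[OF R(1)] m(2)[OF R(2)]
        by (intro disjI1 exI[of _ "- d"] exI[of _ "- c"] exI[of _ "- b"] exI[of _ "- a"]) auto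
    next
      case (M a b c d)
      show ?thesis using M m(2)[OF M(1)] m(2)[OF M(2)]
        by (intro disjI1 exI[of _ "- d"] exI[of _ "- c"] exI[of _ "- b"] exI[of _ "- a"]) auto
    next
      case (L a b c d)
      show ?thesis using L m(2)[OF L(1)] m(2)[OF L(2)]
        by (intro disjI1 exI[of _ "- d"] exI[of _ "- c"] exI[of _ "- b"] exI[of _ "- a"]) auto
    next
      case (TL a b)
      have "A (- (n - b)) (- (n - a))" using shift_down[OF sym[OF TL(1)]] by simp
      then show ?thesis using TL by (intro disjI2 exI[of _ "n - b"] exI[of _ "n - a"]) auto
    next
      case (TM a b)
      have "A (- (n - b)) (- (n - a))" using shift_down[OF sym[OF TM(1)]] by simp
      then show ?thesis using TM by (intro disjI2 exI[of _ "n - b"] exI[of _ "n - a"]) auto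
    next
      case (TR a b)
      have "A (- (n - b)) (- (n - a))" using shift_down[OF sym[OF TR(1)]] by simp
      then show ?thesis using TR by (intro disjI2 exI[of _ "n - b"] exI[of _ "n - a"]) auto
    qed
  qed
qed

text \<open>The two shapes of the star below [p, q] are mirror images. The generic and central
  arguments are formulated for the shape \<open>p s1 m q s4\<close>, the self-adjacent one for the
  other shape, so in each shape one of the cases needs the reflection.\<close>

theorem unique_flip:
  assumes "A p q" "p + 3 \<le> q"
  shows "unique_flip p q"
proof -
  interpret M: max_cover_graph "\<lambda>x y. A (- x) (- y)" n by (rule mirror_max_cover_graph)
  have fm: "M.flip (- p) (- q) (- a) (- b) = (\<lambda>x y. flip p q a b (- x) (- y))" for p q a b
    unfolding M.flip_def flip_def using orb_mirror[of p q "- x" "- y" for x y] orb_mirror[of a b "- x" "- y" for x y]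
    by simp
  have um: "unique_flip p q" if "M.unique_flip (- q) (- p)" for p q
  proof -
    from that have "M.unique_flip (- p) (- q)" using M.unique_flip_commute by blast
    then obtain a b where ab0: "2 \<le> \<bar>a - b\<bar>" and ab: "\<not> A (- a) (- b)" "crossing_free (M.flip (- p) (- q) a b)"
      "\<And>c d. \<not> A (- c) (- d) \<Longrightarrow> 2 < \<bar>c - d\<bar> \<Longrightarrow> \<bar>c - d\<bar> \<le> 2 * n \<Longrightarrow>
         crossing_free (M.flip (- p) (- q) c d) \<Longrightarrow> orb a b c d"
      unfolding M.unique_flip_def by blast
    have "crossing_free (flip p q (- a) (- b))"
      using crossing_free_mirror[OF ab(2)] fm[of p q "- a" "- b"] by simp
    moreover have "orb (- a) (- b) c d" if "\<not> A c d" "2 < \<bar>c - d\<bar>" "\<bar>c - d\<bar> \<le> 2 * n"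
      "crossing_free (flip p q c d)" for c d
    proof -
      have "crossing_free (M.flip (- p) (- q) (- c) (- d))"
        using crossing_free_mirror[OF that(4)] fm[of p q c d] by simp
      then have "orb a b (- c) (- d)" using ab(3)[of "- c" "- d"] that by simp
      then show ?thesis using orb_mirror[of "- a" "- b" c d] by simp
    qed
    moreover have "2 \<le> \<bar>- a - - b\<bar>" using ab0 by linarith
    ultimately show ?thesis unfolding unique_flip_def using ab(1) by blast
  qed
  have ms: "M.star (- s4) (- s3) (- s2) (- s1) (- s0)" if "star s0 s1 s2 s3 s4" for s0 s1 s2 s3 s4
    using that sym unfolding star_def M.star_def by auto
  from lower_star[OF assms] show ?thesis
  proof (elim disjE exE)
    fix s1 m s4 assume S: "star p s1 m q s4"
    show ?thesis
    proof (cases "orb p q m s4")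
      case True
      with lower_generic(4)[OF S] have x: "m = p + n" "s4 = q + n" by auto
      have "M.star (- q - n) (- q - n + n) (- p - n) (- s1) (- p - n + n)"
        using ms[OF S] x by simp
      from M.unique_flip_self[OF this] show ?thesis using um[of q p] by simp
    next
      case False
      then show ?thesis using unique_flip_lower0[OF S] by blast
    qed
  next
    fix s0 m s3 assume S: "star s0 p m s3 q"
    note S' = ms[OF S]
    show ?thesis
    proof (cases "orb p q s0 m")
      case True
      then have "orb (- q) (- p) (- m) (- s0)" using orb_mirror[of p q s0 m] orb_def by (simp add: insert_commute)
      from M.lower_generic(4)[OF S' this] have x: "p = s0 + n" "q = m + n" by auto
      from unique_flip_self[of s0 m s3] S x show ?thesis by simp
    next
      case False
      then have "\<not> orb (- q) (- p) (- m) (- s0)" using orb_mirror[of p q s0 m] orb_def by (simp add: insert_commute)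
      then show ?thesis using um M.unique_flip_lower0[OF S'] by blast
    qed
  qed
qed

end


section \<open>Transfer to the half-cylinder\<close>

context cover_graph
begin

text \<open>No edge is a translate of \<open>[x, x]\<close>, so \<open>flip x x x y\<close> just adds the translates of \<open>[x, y]\<close>.\<close>

lemma not_crossing_free_insert:
  assumes "\<not> crossing_free (flip x x x y)" "2 \<le> y - x" "y - x \<le> 2 * n"
  shows "(\<exists>a b c d. A a b \<and> A c d \<and> a < c \<and> b < d \<and>
        (x < a \<and> c < y \<and> y < b \<or> a < x \<and> x < c \<and> c < b \<and> b < y \<and> y < d \<or>
         c < x \<and> x < b \<and> d < y)) \<or>
      (\<exists>a b. A a b \<and> x + n < y \<and>
        (a < x \<and> x + n < b \<and> b < y \<or> x < a \<and> a < x + n \<and> y < b \<and> b < y + n \<or>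
         x + n < a \<and> a < y \<and> y + n < b))"
proof (rule ccontr)
  assume H: "\<not> ?thesis"
  have "crossing_free (flip x x x y)"
  proof (rule flip_crossing_freeI)
    show "x < y" "y - x \<le> 2 * n" using assms by auto
    show False if "A u v" "A s t" and o: "u < s" "s < v" "v < t"
      "u < x \<and> x < v \<and> v < y \<or> x < u \<and> u < y \<and> y < v" "s < x \<and> x < t \<and> t < y \<or> x < s \<and> s < y \<and> y < t"
      for u v s t
    proof -
      have "x < u \<and> s < y \<and> y < v \<or> u < x \<and> x < s \<and> s < v \<and> v < y \<and> y < t \<or> s < x \<and> x < v \<and> t < y"
        using o by (smt (verit))
      with H that(1,2) o show False by (smt (verit))
    qed
    show False if "A u v" "x + n < y" and o: "u < x \<and> x < v \<and> v < y \<or> x < u \<and> u < y \<and> y < v"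
      "u < x + n \<and> x + n < v \<and> v < y + n \<or> x + n < u \<and> u < y + n \<and> y + n < v" for u v
    proof -
      have "u < x \<and> x + n < v \<and> v < y \<or> x < u \<and> u < x + n \<and> y < v \<and> v < y + n \<or> x + n < u \<and> u < y \<and> y + n < v"
        using o n_pos by (smt (verit))
      with H that(1,2) show False by blast
    qed
  qed
  with assms(1) show False by blast
qed

end

definition cyl_graph :: "nat \<Rightarrow> int set set set \<Rightarrow> int \<Rightarrow> int \<Rightarrow> bool" where
  "cyl_graph n T x y \<longleftrightarrow> x \<noteq> y \<and> proj n {x, y} \<in> T"

lemma translate_doubleton: "translate {x, y} t = {x + t, y + t}"
  by (simp add: translate_def)

lemma proj_shift: "proj n {x + k * int n, y + k * int n} = proj n {x, y}"
  using proj_eq_iff[of n "{x, y}"] translate_doubleton by metis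

lemma proj_eq_iff_shift: "proj n {p, q} = proj n {x, y} \<longleftrightarrow> (\<exists>k. {x, y} = {p + k * int n, q + k * int n})"
  unfolding proj_eq_iff translate_doubleton by blast

lemma proj_length:
  assumes "proj n {p, q} = proj n {x, y}"
  shows "\<bar>x - y\<bar> = \<bar>p - q\<bar>"
  using assms unfolding proj_eq_iff_shift by (auto simp: doubleton_eq_iff)

lemma cyl_edgesE:
  assumes "E \<in> cyl_edges n"
  obtains p q where "E = proj n {p, q}" "p + 2 \<le> q"
proof -
  obtain e where e: "E = proj n e" "e \<in> cover_edges" "2 \<le> cover_length e"
    using assms unfolding cyl_edges_def by blast
  from e(2) obtain a b where "e = {a, b}" "a < b" "cover_length e = b - a" by (rule cover_edgesE)
  with e that[of a b] show ?thesis by auto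
qed

lemma proj_in_cyl_edges: "2 \<le> \<bar>p - q\<bar> \<Longrightarrow> proj n {p, q} \<in> cyl_edges n"
proof -
  assume a: "2 \<le> \<bar>p - q\<bar>"
  then have "p \<noteq> q" by auto
  then have "{p, q} \<in> cover_edges" unfolding cover_edges_def by blast
  moreover have "2 \<le> cover_length {p, q}" using a cover_length_doubleton[of p q] by linarith
  ultimately show ?thesis unfolding cyl_edges_def by blast
qed

lemma proj_in_relevant_edges:
  "proj n {p, q} \<in> relevant_edges n \<longleftrightarrow> 2 < \<bar>p - q\<bar> \<and> \<bar>p - q\<bar> \<le> 2 * int n"
proof
  assume "proj n {p, q} \<in> relevant_edges n"
  then obtain e where e: "proj n {p, q} = proj n e" "e \<in> cover_edges" "2 < cover_length e" "cover_length e \<le> 2 * int n"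
    unfolding relevant_edges_def by blast
  from e(2) obtain a b where "e = {a, b}" "a < b" "cover_length e = b - a" by (rule cover_edgesE)
  with e proj_length[of n p q a b] show "2 < \<bar>p - q\<bar> \<and> \<bar>p - q\<bar> \<le> 2 * int n" by auto
next
  assume a: "2 < \<bar>p - q\<bar> \<and> \<bar>p - q\<bar> \<le> 2 * int n"
  then have "p \<noteq> q" by auto
  then have "{p, q} \<in> cover_edges" unfolding cover_edges_def by blast
  moreover have "2 < cover_length {p, q}" "cover_length {p, q} \<le> 2 * int n"
    using a cover_length_doubleton[of p q] by linarith+
  ultimately show "proj n {p, q} \<in> relevant_edges n"
    unfolding relevant_edges_def by blast
qed

lemma relevant_edgesE:
  assumes "E \<in> relevant_edges n"
  obtains p q where "E = proj n {p, q}" "p + 3 \<le> q" "q \<le> p + 2 * int n"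
proof -
  have "E \<in> cyl_edges n" using assms unfolding relevant_edges_def cyl_edges_def by force
  then obtain p q where pq: "E = proj n {p, q}" "p + 2 \<le> q" by (rule cyl_edgesE)
  with assms proj_in_relevant_edges[of n p q] that[of p q] show ?thesis by auto
qed

lemma relevant_subset_cyl: "relevant_edges n \<subseteq> cyl_edges n"
  unfolding relevant_edges_def cyl_edges_def by force

lemma finite_bounded_edges:
  assumes "n \<ge> 1"
  shows "finite {proj n {p, q} | p q. p \<le> q \<and> q \<le> p + 2 * int n}" (is "finite ?S")
proof -
  have "?S \<subseteq> (\<lambda>(p, q). proj n {p, q}) ` ({0..int n} \<times> {0..3 * int n})"
  proof
    fix E assume "E \<in> ?S"
    then obtain p q where E: "E = proj n {p, q}" "p \<le> q" "q \<le> p + 2 * int n" by blast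
    define k where "k = p div int n"
    have r: "p + (- k) * int n = p mod int n" unfolding k_def using minus_div_mult_eq_mod[of p "int n"] by simp
    have "0 \<le> p mod int n" "p mod int n < int n" using assms by auto
    then have "0 \<le> p + (- k) * int n" "p + (- k) * int n < int n" using r by auto
    moreover have "E = proj n {p + (- k) * int n, q + (- k) * int n}" using E(1) proj_shift[of n p "- k" q] by simp
    ultimately show "E \<in> (\<lambda>(p, q). proj n {p, q}) ` ({0..int n} \<times> {0..3 * int n})"
      using E(2,3) by (intro image_eqI[of _ _ "(p + (- k) * int n, q + (- k) * int n)"]) auto
  qed
  then show ?thesis by (rule finite_subset) auto
qed

lemma three_crossing_free_iff: "three_crossing_free n T \<longleftrightarrow> crossing_free (cyl_graph n T)"
proof
  assume T: "three_crossing_free n T"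
  show "crossing_free (cyl_graph n T)"
  proof
    show "cyl_graph n T y x" if "cyl_graph n T x y" for x y
      using that unfolding cyl_graph_def by (simp add: insert_commute)
    show False if H: "cyl_graph n T a b" "cyl_graph n T c d" "cyl_graph n T e f"
      and o: "a < c" "c < e" "e < b" "b < d" "d < f" for a b c d e f
    proof -
      let ?X = "{{a, b}, {c, d}, {e, f}}"
      have cov: "?X \<subseteq> cover_edges" unfolding cover_edges_def using o by force
      have "?X \<subseteq> lift n T" unfolding lift_def using cov H unfolding cyl_graph_def by auto
      moreover have "{a, b} \<noteq> {c, d}" "{a, b} \<noteq> {e, f}" "{c, d} \<noteq> {e, f}"
        using o by (auto simp: doubleton_eq_iff)
      then have "card ?X = 3" by simp
      moreover have "pairwise edges_cross ?X"
        using edges_crossI[of a c b d] edges_crossI[of a e b f] edges_crossI[of c e d f] o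
        unfolding pairwise_def by auto
      ultimately show False using T cov unfolding three_crossing_free_def three_crossing_def by blast
    qed
  qed
next
  assume "crossing_free (cyl_graph n T)"
  then interpret crossing_free "cyl_graph n T" .
  show "three_crossing_free n T"
    unfolding three_crossing_free_def
  proof
    assume "\<exists>X. X \<subseteq> lift n T \<and> three_crossing X"
    then obtain X where X: "X \<subseteq> lift n T" "three_crossing X" by blast
    then obtain e f g where efg: "X = {e, f, g}" "e \<noteq> f" "e \<noteq> g" "f \<noteq> g"
      unfolding three_crossing_def card_3_iff by blast
    then have cr: "edges_cross e f" "edges_cross e g" "edges_cross f g"
      using X(2) unfolding three_crossing_def pairwise_def by blast+
    have l: "e \<in> lift n T" "f \<in> lift n T" "g \<in> lift n T" using X(1) efg by auto
    have ex: "\<exists>a b. e = {a, b} \<and> a < b \<and> cyl_graph n T a b" if "e \<in> lift n T" for e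
    proof -
      from that have "e \<in> cover_edges" "proj n e \<in> T" unfolding lift_def by auto
      from this(1) obtain a b where "e = {a, b}" "a < b" "cover_length e = b - a" by (rule cover_edgesE)
      with \<open>proj n e \<in> T\<close> show ?thesis unfolding cyl_graph_def by blast
    qed
    obtain a b where e: "e = {a, b}" "a < b" "cyl_graph n T a b" using ex[OF l(1)] by blast
    obtain c d where f: "f = {c, d}" "c < d" "cyl_graph n T c d" using ex[OF l(2)] by blast
    obtain u v where g: "g = {u, v}" "u < v" "cyl_graph n T u v" using ex[OF l(3)] by blast
    show False
      by (rule no_crossing'[OF e(3) f(3) g(3) edges_crossD[OF cr(1)[unfolded e(1) f(1)] e(2) f(2)]
            edges_crossD[OF cr(2)[unfolded e(1) g(1)] e(2) g(2)] edges_crossD[OF cr(3)[unfolded f(1) g(1)] f(2) g(2)]])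
  qed
qed

lemma cyl_graph_cover_graph:
  assumes n: "n \<ge> 1" and T: "T \<subseteq> cyl_edges n" "three_crossing_free n T"
  shows "cover_graph (cyl_graph n T) (int n)"
proof -
  interpret crossing_free "cyl_graph n T" using T(2) three_crossing_free_iff by blast
  show ?thesis
  proof
    show "1 \<le> int n" using n by simp
    show "cyl_graph n T (x + int n) (y + int n)" if "cyl_graph n T x y" for x y
      using that proj_shift[of n x 1 y] unfolding cyl_graph_def by simp
    show "cyl_graph n T (x - int n) (y - int n)" if "cyl_graph n T x y" for x y
      using that proj_shift[of n x "-1" y] unfolding cyl_graph_def by simp
    show "2 \<le> \<bar>x - y\<bar>" if "cyl_graph n T x y" for x y
    proof -
      have "proj n {x, y} \<in> cyl_edges n" using that T(1) unfolding cyl_graph_def by blast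
      then obtain p q where "proj n {x, y} = proj n {p, q}" "p + 2 \<le> q" by (rule cyl_edgesE)
      then show ?thesis using proj_length[of n x y p q] by auto
    qed
    show "\<bar>x - y\<bar> \<le> 2 * int n" if "cyl_graph n T x y" for x y
    proof (rule ccontr)
      assume "\<not> \<bar>x - y\<bar> \<le> 2 * int n"
      then have "2 * int n < cover_length {x, y}" using cover_length_doubleton[of x y] by linarith
      moreover have "{x, y} \<in> cover_edges" using that unfolding cyl_graph_def cover_edges_def by blast
      ultimately show False
        using long_edge_three_crossing[OF n, of "{x, y}" T] T(2) that unfolding cyl_graph_def by blast
    qed
  qed
qed

lemma cyl_graph_exchange:
  assumes g: "cover_graph (cyl_graph n T) (int n)" and c: "c \<noteq> d"
  shows "cyl_graph n (insert (proj n {c, d}) (T - {proj n {p, q}})) = cover_graph.flip (cyl_graph n T) (int n) p q c d"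
proof -
  interpret cover_graph "cyl_graph n T" "int n" by (rule g)
  have ne: "x \<noteq> y" if "orb c d x y" for x y using that c unfolding orb_def by (auto simp: doubleton_eq_iff)
  have o: "orb a b x y \<longleftrightarrow> proj n {x, y} = proj n {a, b}" for a b x y
    unfolding orb_def proj_eq_iff_shift[symmetric] by metis
  show ?thesis
    unfolding flip_def[abs_def] o using ne[unfolded o] by (auto simp: cyl_graph_def fun_eq_iff)
qed

lemma two_triangulation_max_cover_graph:
  assumes n: "n \<ge> 1" and T: "T \<in> two_triangulations n"
  shows "max_cover_graph (cyl_graph n T) (int n)"
proof -
  have T': "T \<subseteq> cyl_edges n" "three_crossing_free n T" using T unfolding two_triangulations_def by auto
  interpret cover_graph "cyl_graph n T" "int n" by (rule cyl_graph_cover_graph[OF n T'])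
  have nonedge: "\<not> crossing_free (flip x x x y)" if "\<not> cyl_graph n T x y" "2 \<le> y - x" for x y
  proof
    assume cf: "crossing_free (flip x x x y)"
    have E: "proj n {x, y} \<notin> T" "x \<noteq> y" using that unfolding cyl_graph_def by auto
    have "proj n {x, x} \<notin> T"
    proof
      assume "proj n {x, x} \<in> T"
      with T'(1) have "proj n {x, x} \<in> cyl_edges n" by blast
      then obtain p q where "proj n {x, x} = proj n {p, q}" "p + 2 \<le> q" by (rule cyl_edgesE)
      then show False using proj_length[of n x x p q] by auto
    qed
    then have "cyl_graph n (insert (proj n {x, y}) T) = flip x x x y"
      using cyl_graph_exchange[OF cover_graph_axioms E(2), of x x] by simp
    with cf have "three_crossing_free n (insert (proj n {x, y}) T)" using three_crossing_free_iff by simp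
    moreover have "insert (proj n {x, y}) T \<subseteq> cyl_edges n" using T'(1) proj_in_cyl_edges[of x y n] that(2) by auto
    ultimately have "insert (proj n {x, y}) T = T" using T unfolding two_triangulations_def by blast
    then show False using E by blast
  qed
  show ?thesis
  proof
    \<comment> \<open>Every blocking configuration has two distinct vertices strictly between
      \<open>x\<close> and \<open>y\<close>, one of them possibly \<open>x + n\<close>; this is
      impossible for \<open>y = x + 2\<close>.\<close>
    show "cyl_graph n T x (x + 2)" for x
    proof (rule ccontr)
      assume "\<not> cyl_graph n T x (x + 2)"
      moreover have "2 \<le> x + 2 - x" by simp
      ultimately have "\<not> crossing_free (flip x x x (x + 2))" by (rule nonedge)
      from not_crossing_free_insert[OF this] show False using n by auto
    qed
    show "(\<exists>a b c d. cyl_graph n T a b \<and> cyl_graph n T c d \<and> a < c \<and> b < d \<and>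
        (x < a \<and> c < y \<and> y < b \<or> a < x \<and> x < c \<and> c < b \<and> b < y \<and> y < d \<or>
         c < x \<and> x < b \<and> d < y)) \<or>
      (\<exists>a b. cyl_graph n T a b \<and> x + int n < y \<and>
        (a < x \<and> x + int n < b \<and> b < y \<or> x < a \<and> a < x + int n \<and> y < b \<and> b < y + int n \<or>
         x + int n < a \<and> a < y \<and> y + int n < b))"
      if "\<not> cyl_graph n T x y" "2 \<le> y - x" "y - x \<le> 2 * int n" for x y
      by (rule not_crossing_free_insert[OF nonedge[OF that(1,2)] that(2,3)])
  qed
qed

text \<open>Edges of a crossing-free set have length at most \<open>2 * n\<close>, so up to
  translation there are finitely many candidates and a maximal extension exists.\<close>

lemma extend_to_two_triangulation:
  assumes n: "n \<ge> 1" and T: "T \<subseteq> cyl_edges n" "three_crossing_free n T"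
  obtains T' where "T' \<in> two_triangulations n" "T \<subseteq> T'"
proof -
  let ?S = "{proj n {p, q} | p q. p \<le> q \<and> q \<le> p + 2 * int n}"
  let ?P = "{U. T \<subseteq> U \<and> U \<subseteq> cyl_edges n \<and> three_crossing_free n U}"
  have "U \<subseteq> ?S" if U: "U \<in> ?P" for U
  proof
    fix E assume E: "E \<in> U"
    with U have "E \<in> cyl_edges n" by blast
    then obtain p q where pq: "E = proj n {p, q}" "p + 2 \<le> q" by (rule cyl_edgesE)
    interpret cover_graph "cyl_graph n U" "int n" using cyl_graph_cover_graph[OF n] U by blast
    have "cyl_graph n U p q" using pq E unfolding cyl_graph_def by auto
    from length_le[OF this] pq(2) have "p \<le> q" "q \<le> p + 2 * int n" by linarith+
    with pq(1) show "E \<in> ?S" by blast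
  qed
  then have fP: "finite ?P" using finite_bounded_edges[OF n] by (intro finite_subset[of ?P "Pow ?S"]) auto
  have nP: "?P \<noteq> {}" using T by blast
  from finite_has_maximal[OF fP nP] obtain M where M: "M \<in> ?P" "\<forall>U\<in>?P. M \<subseteq> U \<longrightarrow> M = U"
    by (rule bexE)
  have "T' = M" if "T' \<subseteq> cyl_edges n" "three_crossing_free n T'" "M \<subseteq> T'" for T'
  proof -
    have "T' \<in> ?P" using that M(1) by auto
    from bspec[OF M(2) this] that(3) have "M = T'" by (rule mp)
    then show ?thesis by (rule HOL.sym)
  qed
  with M(1) have "M \<in> two_triangulations n" unfolding two_triangulations_def by simp
  moreover have "T \<subseteq> M" using M(1) by simp
  ultimately show ?thesis by (rule that)
qed

lemma two_triangulation_short_edges: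
  assumes n: "n \<ge> 1" and T: "T \<in> two_triangulations n"
  shows "T - relevant_edges n = {proj n {x, x + 2} | x. True}"
proof -
  interpret max_cover_graph "cyl_graph n T" "int n" by (rule two_triangulation_max_cover_graph[OF n T])
  show ?thesis
  proof (intro equalityI subsetI)
    fix E assume E: "E \<in> T - relevant_edges n"
    then have "E \<in> cyl_edges n" using T unfolding two_triangulations_def by blast
    then obtain p q where pq: "E = proj n {p, q}" "p + 2 \<le> q" by (rule cyl_edgesE)
    have "cyl_graph n T p q" using pq E unfolding cyl_graph_def by auto
    from length_le[OF this] E pq proj_in_relevant_edges[of n p q] have "q = p + 2" by auto
    then show "E \<in> {proj n {x, x + 2} | x. True}" using pq by blast
  next
    fix E assume "E \<in> {proj n {x, x + 2} | x. True}"
    then obtain x where "E = proj n {x, x + 2}" by blast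
    then show "E \<in> T - relevant_edges n"
      using short[of x] proj_in_relevant_edges[of n x "x + 2"] unfolding cyl_graph_def by auto
  qed
qed

section \<open>Purity, flips and the pseudomanifold property\<close>

lemma finite_relevant_edges:
  assumes "n \<ge> 1"
  shows "finite (relevant_edges n)"
proof (rule finite_subset[OF _ finite_bounded_edges[OF assms]])
  show "relevant_edges n \<subseteq> {proj n {p, q} | p q. p \<le> q \<and> q \<le> p + 2 * int n}"
  proof
    fix E assume "E \<in> relevant_edges n"
    then obtain p q where pq: "E = proj n {p, q}" "p + 3 \<le> q" "q \<le> p + 2 * int n" by (rule relevant_edgesE)
    then have "p \<le> q" by linarith
    with pq(1,3) show "E \<in> {proj n {p, q} | p q. p \<le> q \<and> q \<le> p + 2 * int n}" by blast
  qed
qed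

lemma card_two_triangulation:
  assumes n: "n \<ge> 1" and T: "T \<in> two_triangulations n"
  shows "card (T \<inter> relevant_edges n) = 2 * (n - 1)"
proof -
  interpret max_cover_graph "cyl_graph n T" "int n" by (rule two_triangulation_max_cover_graph[OF n T])
  obtain a where a: "\<not> crossed a" using exists_uncrossed by blast
  note ci = crossed_iff[OF a uncrossed_edge[OF a]]
  \<comment> \<open>One representative of each crossed class modulo \<open>n\<close>.\<close>
  define M where "M = {a<..<a + int n}"
  have "crossed m" if "m \<in> M" for m
    using that zdvd_not_zless[of "m - a" "int n"] unfolding ci M_def by auto
  then have "\<forall>m\<in>M. \<exists>t. star (fst t) (fst (snd t)) m (fst (snd (snd t))) (snd (snd (snd t)))"
    using middle_star by (metis fst_conv snd_conv)
  then obtain t where t: "\<forall>m\<in>M. star (fst (t m)) (fst (snd (t m))) m (fst (snd (snd (t m)))) (snd (snd (snd (t m))))"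
    by (rule bchoice[THEN exE])
  define f0 f1 f3 f4 where "f0 m = fst (t m)" and "f1 m = fst (snd (t m))" and "f3 m = fst (snd (snd (t m)))"
    and "f4 m = snd (snd (snd (t m)))" for m
  have S: "star (f0 m) (f1 m) m (f3 m) (f4 m)" if "m \<in> M" for m
    using t that unfolding f0_def f1_def f3_def f4_def by blast
  define g where "g = (\<lambda>(m, i). if i then proj n {f0 m, f3 m} else proj n {f1 m, f4 m})"
  have star_shift: "star (s0 + k * int n) (s1 + k * int n) (s2 + k * int n) (s3 + k * int n) (s4 + k * int n)"
    if "star s0 s1 s2 s3 s4" for s0 s1 s2 s3 s4 k
    using that shift unfolding star_def by auto
  have Mk: "k = 0" if "m \<in> M" "m + k * int n \<in> M" for m k
  proof -
    have "\<bar>k * int n\<bar> < int n" using that unfolding M_def by auto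
    then show ?thesis using n by (simp add: abs_mult)
  qed
  have "inj_on g (M \<times> UNIV)"
  proof (rule inj_onI, clarify)
    fix m i m' j assume m: "m \<in> M" "m' \<in> M" and eq: "g (m, i) = g (m', j)"
    have o: "f0 m < f1 m" "f1 m < f3 m" "f3 m < f4 m" "f0 m < f3 m" "f1 m < f4 m"
      "f0 m' < f1 m'" "f1 m' < f3 m'" "f3 m' < f4 m'" "f0 m' < f3 m'" "f1 m' < f4 m'"
      using S[OF m(1)] S[OF m(2)] unfolding star_def by auto
    have ord: "\<exists>k. x = p + k * int n \<and> y = q + k * int n" if "proj n {p, q} = proj n {x, y}" "p < q" "x < y" for p q x y
      using that unfolding proj_eq_iff_shift by (auto simp: doubleton_eq_iff)
    note c = star_cstar[OF star_shift[OF S[OF m(1)]]] and c' = star_cstar[OF S[OF m(2)]]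
    show "m = m' \<and> i = j"
    proof (cases "i = j")
      case True
      have "\<exists>k. m' = m + k * int n"
      proof (cases i)
        case True
        with eq \<open>i = j\<close> have "proj n {f0 m, f3 m} = proj n {f0 m', f3 m'}" unfolding g_def by simp
        from ord[OF this] o obtain k where k: "f0 m' = f0 m + k * int n" "f3 m' = f3 m + k * int n" by blast
        from cstar_unique[OF c[of k, folded k] c'] show ?thesis by auto
      next
        case False
        with eq \<open>i = j\<close> have "proj n {f1 m, f4 m} = proj n {f1 m', f4 m'}" unfolding g_def by simp
        from ord[OF this] o obtain k where k: "f1 m' = f1 m + k * int n" "f4 m' = f4 m + k * int n" by blast
        from cstar_unique[OF cstar_rotate[OF c[of k, folded k]] cstar_rotate[OF c']] show ?thesis by auto
      qed
      then obtain k where "m' = m + k * int n" by blast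
      with Mk[of m k] m True show ?thesis by simp
    next
      case False
      \<comment> \<open>\<open>cstar_unique\<close> would match the two stars with labels rotated by
        one, making the leftmost vertex of one a translate of the rightmost vertex of the
        other.\<close>
      have mixed: False if "m \<in> M" "m' \<in> M" "proj n {f0 m, f3 m} = proj n {f1 m', f4 m'}" for m m'
      proof -
        have o: "f0 m < f3 m" "f1 m' < f4 m'" "f0 m' < f1 m'" "f3 m < f4 m"
          using S[OF that(1)] S[OF that(2)] unfolding star_def by auto
        from ord[OF that(3)] o obtain k where k: "f1 m' = f0 m + k * int n" "f4 m' = f3 m + k * int n" by blast
        from cstar_unique[OF star_cstar[OF star_shift[OF S[OF that(1)], of k, folded k]] cstar_rotate[OF star_cstar[OF S[OF that(2)]]]]
        have "f0 m' = f4 m + k * int n" by auto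
        then show False using k o by linarith
      qed
      show ?thesis
      proof (cases i)
        case True
        then show ?thesis using mixed[of m m'] eq False m unfolding g_def by simp
      next
        case i: False
        then show ?thesis using mixed[of m' m] eq False m unfolding g_def by simp
      qed
    qed
  qed
  moreover have "g ` (M \<times> UNIV) = T \<inter> relevant_edges n"
  proof (intro equalityI subsetI)
    fix E assume "E \<in> g ` (M \<times> UNIV)"
    then obtain m i where m: "m \<in> M" "E = g (m, i)" by auto
    note s = S[OF m(1)]
    have e: "cyl_graph n T (f0 m) (f3 m)" "cyl_graph n T (f1 m) (f4 m)" "f0 m + 2 < f3 m" "f1 m + 2 < f4 m"
      using s unfolding star_def by auto
    then show "E \<in> T \<inter> relevant_edges n"
      using m(2) length_le[OF e(1)] length_le[OF e(2)] unfolding g_def cyl_graph_def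
      by (auto simp: proj_in_relevant_edges)
  next
    fix E assume E: "E \<in> T \<inter> relevant_edges n"
    then obtain p q where pq: "E = proj n {p, q}" "p + 3 \<le> q" by (auto elim: relevant_edgesE)
    have A: "cyl_graph n T p q" using pq E unfolding cyl_graph_def by auto
    have middle: "\<exists>k. m + k * int n \<in> M" if "star s0 s1 m s3 s4" for s0 s1 m s3 s4
    proof -
      have "crossed m" using that crossedI[of s0 s3 s1 s4 m] unfolding star_def by auto
      then have nd: "\<not> int n dvd m - a" using ci by blast
      define k where "k = (m - a) div int n"
      have "m - a - k * int n = (m - a) mod int n" unfolding k_def by (simp add: minus_div_mult_eq_mod)
      moreover have "(m - a) mod int n \<noteq> 0" using nd by (simp add: dvd_eq_mod_eq_0)
      moreover have "0 \<le> (m - a) mod int n" "(m - a) mod int n < int n" using n by auto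
      ultimately have "m + (- k) * int n \<in> M" unfolding M_def by auto
      then show ?thesis by blast
    qed
    from lower_star[OF A pq(2)] show "E \<in> g ` (M \<times> UNIV)"
    proof (elim disjE exE)
      fix s1 m s4 assume s: "star p s1 m q s4"
      obtain k where k: "m + k * int n \<in> M" using middle[OF s] by blast
      from star_middle_unique[OF S[OF k] star_shift[OF s, of k]]
      have "g (m + k * int n, True) = proj n {p + k * int n, q + k * int n}" unfolding g_def by auto
      then have "E = g (m + k * int n, True)" using pq(1) proj_shift by simp
      then show ?thesis using k by blast
    next
      fix s0 m s3 assume s: "star s0 p m s3 q"
      obtain k where k: "m + k * int n \<in> M" using middle[OF s] by blast
      from star_middle_unique[OF S[OF k] star_shift[OF s, of k]]
      have "g (m + k * int n, False) = proj n {p + k * int n, q + k * int n}" unfolding g_def by auto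
      then have "E = g (m + k * int n, False)" using pq(1) proj_shift by simp
      then show ?thesis using k by blast
    qed
  qed
  ultimately have "card (T \<inter> relevant_edges n) = card (M \<times> (UNIV :: bool set))"
    using card_image by metis
  also have "\<dots> = 2 * (n - 1)" unfolding M_def using n by (simp add: card_cartesian_product)
  finally show ?thesis .
qed

lemma flip_exists_unique:
  assumes n: "n \<ge> 1" and T: "T \<in> two_triangulations n" and E: "E \<in> T" "E \<in> relevant_edges n"
  shows "\<exists>!F. F \<in> cyl_edges n \<and> F \<notin> T \<and> insert F (T - {E}) \<in> two_triangulations n"
proof -
  interpret max_cover_graph "cyl_graph n T" "int n" by (rule two_triangulation_max_cover_graph[OF n T])
  have Tc: "T \<subseteq> cyl_edges n" using T unfolding two_triangulations_def by blast
  obtain p q where pq: "E = proj n {p, q}" "p + 3 \<le> q" using E(2) by (rule relevant_edgesE)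
  have A: "cyl_graph n T p q" using pq E unfolding cyl_graph_def by auto
  obtain a b where ab: "2 \<le> \<bar>a - b\<bar>" "\<not> cyl_graph n T a b" "crossing_free (flip p q a b)"
    and uniq: "\<And>c d. \<not> cyl_graph n T c d \<Longrightarrow> 2 < \<bar>c - d\<bar> \<Longrightarrow> \<bar>c - d\<bar> \<le> 2 * int n \<Longrightarrow>
      crossing_free (flip p q c d) \<Longrightarrow> orb a b c d"
    using unique_flip[OF A pq(2)] unfolding unique_flip_def by blast
  have free: "three_crossing_free n (insert (proj n {c, d}) (T - {E})) \<longleftrightarrow> crossing_free (flip p q c d)"
    if "c \<noteq> d" for c d
    using cyl_graph_exchange[OF cover_graph_axioms that, of p q] three_crossing_free_iff pq(1) by metis
  \<comment> \<open>A replacement is relevant: all edges of length 2 already belong to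
    \<open>T\<close>, and an edge longer than \<open>2 * n\<close> forms a 3-crossing with its own
    translates.\<close>
  have len: "2 < \<bar>c - d\<bar>" "\<bar>c - d\<bar> \<le> 2 * int n"
    if "2 \<le> \<bar>c - d\<bar>" "\<not> cyl_graph n T c d" "crossing_free (flip p q c d)" for c d
  proof -
    have cd: "c \<noteq> d" using that(1) by auto
    show "2 < \<bar>c - d\<bar>"
    proof (rule ccontr)
      assume "\<not> 2 < \<bar>c - d\<bar>"
      then have "d = c + 2 \<or> c = d + 2" using that(1) by linarith
      then show False using that(2) short[of c] sym[OF short[of d]] by auto
    qed
    have "insert (proj n {c, d}) (T - {E}) \<subseteq> cyl_edges n" using Tc proj_in_cyl_edges[OF that(1)] by blast
    from cyl_graph_cover_graph[OF n this] free[OF cd] that(3)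
    interpret B: cover_graph "cyl_graph n (insert (proj n {c, d}) (T - {E}))" "int n" by blast
    have "cyl_graph n (insert (proj n {c, d}) (T - {E})) c d" using cd unfolding cyl_graph_def by blast
    from B.length_le[OF this] show "\<bar>c - d\<bar> \<le> 2 * int n" .
  qed
  let ?F = "proj n {a, b}"
  have abne: "a \<noteq> b" using ab(1) by auto
  have F: "?F \<in> cyl_edges n" "?F \<notin> T" "?F \<in> relevant_edges n"
    using proj_in_cyl_edges[OF ab(1)] ab(2) abne len[OF ab] proj_in_relevant_edges[of n a b]
    unfolding cyl_graph_def by auto
  have "insert ?F (T - {E}) \<in> two_triangulations n"
  proof -
    have "insert ?F (T - {E}) \<subseteq> cyl_edges n" "three_crossing_free n (insert ?F (T - {E}))"
      using F(1) Tc free[OF abne] ab(3) by auto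
    then obtain U where U: "U \<in> two_triangulations n" "insert ?F (T - {E}) \<subseteq> U"
      using extend_to_two_triangulation[OF n] by blast
    let ?R = "relevant_edges n"
    have fin: "finite (X \<inter> ?R)" for X using finite_relevant_edges[OF n] by blast
    have "insert ?F (T - {E}) \<inter> ?R = insert ?F (T \<inter> ?R - {E})" using F by blast
    moreover have "card (insert ?F (T \<inter> ?R - {E})) = card (T \<inter> ?R)"
    proof -
      have "card (insert ?F (T \<inter> ?R - {E})) = Suc (card (T \<inter> ?R - {E}))"
        using F(2) fin[of T] by (intro card_insert_disjoint) auto
      also have "\<dots> = card (T \<inter> ?R)"
        using E fin[of T] by (intro card_Suc_Diff1) auto
      finally show ?thesis .
    qed
    ultimately have "card (insert ?F (T - {E}) \<inter> ?R) = card (U \<inter> ?R)"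
      using card_two_triangulation[OF n T] card_two_triangulation[OF n U(1)] by simp
    moreover have "insert ?F (T - {E}) \<inter> ?R \<subseteq> U \<inter> ?R" using U(2) by blast
    ultimately have "insert ?F (T - {E}) \<inter> ?R = U \<inter> ?R" using fin[of U] card_subset_eq by metis
    moreover have "U - ?R = T - ?R"
      using two_triangulation_short_edges[OF n T] two_triangulation_short_edges[OF n U(1)] by simp
    ultimately have "U = insert ?F (T - {E})" using U(2) E by blast
    then show ?thesis using U(1) by simp
  qed
  moreover have "F' = ?F" if F': "F' \<in> cyl_edges n" "F' \<notin> T" "insert F' (T - {E}) \<in> two_triangulations n" for F'
  proof -
    from F'(1) obtain c d where cd: "F' = proj n {c, d}" "c + 2 \<le> d" by (rule cyl_edgesE)
    have cd': "2 \<le> \<bar>c - d\<bar>" "c \<noteq> d" "\<not> cyl_graph n T c d" using cd F'(2) unfolding cyl_graph_def by auto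
    have "three_crossing_free n (insert F' (T - {E}))" using F'(3) unfolding two_triangulations_def by blast
    then have cf: "crossing_free (flip p q c d)" using free[OF cd'(2)] cd(1) by blast
    from uniq[OF cd'(3) len[OF cd'(1,3) cf] cf] have "orb a b c d" .
    then show ?thesis unfolding orb_def cd(1) proj_eq_iff_shift[of n a b c d, symmetric] by simp
  qed
  ultimately show ?thesis using F by blast
qed

theorem theorem1p2:
  fixes n :: nat
  assumes "n \<ge> 1"
  shows "regular_graph (two_triangulations n) (flip_adjacent n) \<and>
    pure_complex (relevant_edges n) (Delta n) \<and>
    weak_pseudomanifold (relevant_edges n) (Delta n)"
proof -
  let ?R = "relevant_edges n" and ?TT = "two_triangulations n"
  have fin: "finite (X \<inter> ?R)" for X using finite_relevant_edges[OF assms] by blast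
  \<comment> \<open>The degree is the number of relevant edges: each has exactly one flip, and the
    neighbour determines the flipped edge as the only element of \<open>T\<close> that it
    lacks.\<close>
  have regular: "finite {w \<in> ?TT. flip_adjacent n T w} \<and> card {w \<in> ?TT. flip_adjacent n T w} = 2 * (n - 1)"
    if T: "T \<in> ?TT" for T
  proof -
    have "\<forall>E\<in>T \<inter> ?R. \<exists>F. F \<in> cyl_edges n \<and> F \<notin> T \<and> insert F (T - {E}) \<in> ?TT"
      using flip_exists_unique[OF assms T] by blast
    then obtain \<phi> where \<phi>: "\<forall>E\<in>T \<inter> ?R. \<phi> E \<in> cyl_edges n \<and> \<phi> E \<notin> T \<and> insert (\<phi> E) (T - {E}) \<in> ?TT"
      by (rule bchoice[THEN exE])
    define h where "h E = insert (\<phi> E) (T - {E})" for E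
    have \<phi>': "\<phi> E \<in> cyl_edges n" "\<phi> E \<notin> T" "h E \<in> ?TT" if "E \<in> T" "E \<in> ?R" for E
      using bspec[OF \<phi>, of E] that unfolding h_def by simp_all
    have diff: "T - h E = {E}" if "E \<in> T" "E \<in> ?R" for E
      using \<phi>'(2)[OF that] that(1) unfolding h_def by auto
    have "inj_on h (T \<inter> ?R)"
      by (rule inj_onI) (metis IntD1 IntD2 diff singleton_inject)
    moreover have "{w \<in> ?TT. flip_adjacent n T w} = h ` (T \<inter> ?R)"
    proof (intro equalityI subsetI)
      fix w assume "w \<in> {w \<in> ?TT. flip_adjacent n T w}"
      then obtain E F where w: "w \<in> ?TT" "E \<in> T" "E \<in> ?R" "F \<in> cyl_edges n" "F \<notin> T" "w = insert F (T - {E})"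
        unfolding flip_adjacent_def by blast
      then have "F = \<phi> E"
        using flip_exists_unique[OF assms T w(2,3)] \<phi>'[OF w(2,3)] unfolding h_def by blast
      then have "w = h E" using w(6) unfolding h_def by simp
      then show "w \<in> h ` (T \<inter> ?R)" using w(2,3) by blast
    next
      fix w assume "w \<in> h ` (T \<inter> ?R)"
      then obtain E where E: "E \<in> T" "E \<in> ?R" "w = h E" by blast
      have "T \<noteq> w" using diff[OF E(1,2)] E(3) by blast
      then have "flip_adjacent n T w"
        unfolding flip_adjacent_def using \<phi>'[OF E(1,2)] T E h_def by blast
      then show "w \<in> {w \<in> ?TT. flip_adjacent n T w}" using \<phi>'(3)[OF E(1,2)] E(3) by simp
    qed
    ultimately show ?thesis using fin[of T] card_two_triangulation[OF assms T] by (simp add: card_image)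
  qed
  have facet_card: "card F = 2 * (n - 1)" if "F \<in> facets (Delta n)" for F
    using that card_two_triangulation[OF assms] unfolding facets_Delta[OF assms] by blast
  have simplicial: "simplicial_complex ?R (Delta n)"
    unfolding simplicial_complex_def
  proof (intro conjI ballI allI impI)
    \<comment> \<open>Over the empty graph, \<open>flip p p p q\<close> is the translation class of
      [p, q]; thus a single relevant edge is crossing-free and extends to a 2-triangulation.\<close>
    interpret E: cover_graph "\<lambda>_ _. False" "int n" by unfold_locales (use assms in auto)
    have "three_crossing_free n {}" unfolding three_crossing_free_def three_crossing_def lift_def by auto
    then show "{} \<in> Delta n"
      using extend_to_two_triangulation[OF assms, of "{}"] unfolding Delta_def by blast
    show "finite F" "F \<subseteq> ?R" if "F \<in> Delta n" for F
      using that fin finite_subset unfolding Delta_def by blast+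
    show "G \<in> Delta n" if "F \<in> Delta n" "G \<subseteq> F" for F G
      using that unfolding Delta_def by blast
    show "{v} \<in> Delta n" if v: "v \<in> ?R" for v
    proof -
      from v obtain p q where pq: "v = proj n {p, q}" "p + 3 \<le> q" "q \<le> p + 2 * int n" by (rule relevant_edgesE)
      have "crossing_free (E.flip p p p q)"
        by (rule E.flip_crossing_freeI) (use pq in auto)
      moreover have "cyl_graph n {v} = E.flip p p p q"
      proof (intro ext)
        fix x y
        have "E.orb p q x y \<Longrightarrow> x \<noteq> y" using pq(2) unfolding E.orb_def by (auto simp: doubleton_eq_iff)
        moreover have "E.orb p q x y \<longleftrightarrow> proj n {p, q} = proj n {x, y}" unfolding E.orb_def proj_eq_iff_shift ..
        ultimately show "cyl_graph n {v} x y = E.flip p p p q x y"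
          unfolding cyl_graph_def E.flip_def pq(1) by auto
      qed
      ultimately have "three_crossing_free n {v}" using three_crossing_free_iff by simp
      then obtain T where "T \<in> ?TT" "{v} \<subseteq> T"
        using extend_to_two_triangulation[OF assms, of "{v}"] v relevant_subset_cyl by blast
      then show ?thesis using v unfolding Delta_def by blast
    qed
  qed
  have pure: "pure_complex ?R (Delta n)"
    unfolding pure_complex_def using simplicial facet_card by blast
  \<comment> \<open>By purity any facet containing \<open>F\<close> has exactly one further edge
    \<open>X\<close>. All 2-triangulations share the edges of length 2, so for \<open>X\<close>
    other than the missing edge \<open>E\<close>, the facet comes from
    \<open>insert X (T - {E})\<close>, the unique flip of \<open>E\<close>.\<close>
  have "card {G \<in> facets (Delta n). F \<subseteq> G} = 2"
    if G: "G \<in> facets (Delta n)" "F \<subseteq> G" "card G = card F + 1" for F G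
  proof -
    obtain T where T: "T \<in> ?TT" "G = T \<inter> ?R" using G(1) unfolding facets_Delta[OF assms] by blast
    have "finite G" using T fin by simp
    then have finF: "finite F" using G(2) finite_subset by blast
    have "card (G - F) = 1" using G(2,3) finF by (simp add: card_Diff_subset)
    then obtain E where E: "G - F = {E}" by (auto simp: card_1_singleton_iff)
    then have EG: "E \<in> T" "E \<in> ?R" "F = T \<inter> ?R - {E}" using T G(2) by blast+
    obtain F' where F': "F' \<in> cyl_edges n" "F' \<notin> T" "insert F' (T - {E}) \<in> ?TT"
      and uniq: "\<And>X. X \<in> cyl_edges n \<Longrightarrow> X \<notin> T \<Longrightarrow> insert X (T - {E}) \<in> ?TT \<Longrightarrow> X = F'"
      using flip_exists_unique[OF assms T(1) EG(1,2)] by blast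
    let ?U = "insert F' (T - {E})"
    have shorts: "W - ?R = T - ?R" if "W \<in> ?TT" for W
      using two_triangulation_short_edges[OF assms T(1)] two_triangulation_short_edges[OF assms that] by simp
    have GE: "G = insert E F" using E G(2) by blast
    have "E \<notin> ?U" using EG(1) F'(2) by auto
    then have ne: "G \<noteq> ?U \<inter> ?R" using GE by blast
    have "{H \<in> facets (Delta n). F \<subseteq> H} = {G, ?U \<inter> ?R}"
    proof (intro equalityI subsetI)
      fix H assume "H \<in> {H \<in> facets (Delta n). F \<subseteq> H}"
      then obtain W where W: "W \<in> ?TT" "H = W \<inter> ?R" "F \<subseteq> H" "card H = card F + 1"
        using facet_card G(1,3) unfolding facets_Delta[OF assms] by auto
      have "card (H - F) = 1" using W(3,4) finF by (simp add: card_Diff_subset)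
      then obtain X where X: "H - F = {X}" by (auto simp: card_1_singleton_iff)
      then have HX: "H = insert X F" "X \<notin> F" using W(3) by blast+
      show "H \<in> {G, ?U \<inter> ?R}"
      proof (cases "X = E")
        case True
        then show ?thesis using HX(1) GE by simp
      next
        case False
        have "W = H \<union> (W - ?R)" using W(2) by blast
        also have "\<dots> = insert X F \<union> (T - ?R)" using HX(1) shorts[OF W(1)] by simp
        also have "\<dots> = insert X (T - {E})" using EG(2,3) by auto
        finally have W': "W = insert X (T - {E})" .
        have XR: "X \<in> ?R" using HX(1) W(2) by blast
        then have "X \<notin> T" using HX(2) EG(3) False by simp
        moreover have "X \<in> cyl_edges n" using XR relevant_subset_cyl by blast
        ultimately have "X = F'" using uniq W(1) W' by simp
        then show ?thesis using W' W(2) by simp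
      qed
    next
      fix H assume "H \<in> {G, ?U \<inter> ?R}"
      then show "H \<in> {H \<in> facets (Delta n). F \<subseteq> H}"
      proof
        assume "H = G"
        then show ?thesis using G by simp
      next
        assume "H \<in> {?U \<inter> ?R}"
        then have "H = ?U \<inter> ?R" by simp
        moreover have "F \<subseteq> ?U \<inter> ?R" using EG(3) by auto
        ultimately show ?thesis using F'(3) unfolding facets_Delta[OF assms] by auto
      qed
    qed
    then show ?thesis using ne by simp
  qed
  then have "weak_pseudomanifold ?R (Delta n)"
    unfolding weak_pseudomanifold_def using pure by blast
  moreover have "regular_graph ?TT (flip_adjacent n)"
    unfolding regular_graph_def using regular by blast
  ultimately show ?thesis using pure by blast
qed

end
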